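(* Let $k$ be a field of characteristic $0$, let $Q$ be an ordered quiver, and let $\mathcal{A}:=kQ/I$ be the incidence algebra associated to it. Let $\overline{\mathcal{A}}:=k\overline{Q}/\overline{I}$ be the incidence algebra associated to the quiver $\overline{Q}$ obtained by adjoining to $Q$ two new vertices $a$ and $b$. Then $$HH^n(\mathcal{A},\mathcal{A})\cong \mathrm{Ext}^{n+2}_{\overline{\mathcal{A}}}(k_a,k_b),\qquad n\geq 1,$$ where $k_a$ and $k_b$ are the one-dimensional simple right $\overline{\mathcal{A}}$-modules at the vertices $a$ and $b$, and $\mathrm{Ext}$ is taken in the category of right $\overline{\mathcal{A}}$-modules.
   Context: A quiver $Q=(Q_0,Q_1)$ is a directed graph with vertex set $Q_0$ and arrow set $Q_1$. An ordered quiver is a finite quiver without oriented cycles such that for each arrow $\alpha:x\to y$ there is no oriented path from $x$ to $y$ other than $\alpha$. Then $Q_0$ is a finite poset via $x\ge y$ iff there is an oriented path from $x$ to $y$. $kQ$ is the path algebra, with the convention that the product $pq$ is the path "first $q$, then $p$" (and zero if not composable), so that a path $p$ from $x$ to $y$ satisfies $p=e_y\,p\,e_x$, with $e_x$ the trivial path at $x$. $I$ is the parallel ideal: the two-sided ideal of $kQ$ generated by all differences of paths having the same initial and the same terminal points. The algebra $\mathcal{A}=kQ/I$ is the incidence algebra $\mathbf{I}(Q_0)$ of the poset $Q_0$, i.e. the functions $f:Q_0\times Q_0\to k$ with $f(x,y)=0$ if $x\not\le y$ and product $(fg)(x,y)=\sum_{x\le z\le y}f(x,z)g(z,y)$. $\overline{Q}$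 is the quiver obtained from $Q$ by adding two vertices $a$ and $b$, a new arrow from $b$ to each source of $Q$ (vertex that is not the terminal vertex of any arrow), and a new arrow from each sink of $Q$ (vertex that is not the initial vertex of any arrow) to $a$. $\overline{I}$ is the parallel ideal of $k\overline{Q}$, and $\overline{\mathcal{A}}=k\overline{Q}/\overline{I}$. For a vertex $x$ of $\overline{Q}$, $k_x$ is the one-dimensional right $\overline{\mathcal{A}}$-module on which the class $\overline{e_x}$ acts as the identity and the class of every other path acts as zero. $HH^n(\mathcal{A},\mathcal{A})$ is the Hochschild cohomology of $\mathcal{A}$ with coefficients in itself. *)

theory Defs
  imports "HOL-Algebra.Module" "HOL-Algebra.QuotRing" "HOL-Library.Poly_Mapping" "Graph_Theory.Arc_Walk"
begin

section \<open>Quivers\<close>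

text \<open>
  A quiver is a \<^typ>\<open>('v, 'e) pre_digraph\<close>; an oriented path from \<open>x\<close> to \<open>y\<close> is an arc walk,
  including the trivial walk \<open>[]\<close> at a vertex.
\<close>

definition ordered_quiver :: "('v, 'e) pre_digraph \<Rightarrow> bool" where
  "ordered_quiver Q \<longleftrightarrow>
     fin_digraph Q \<and>
     (\<forall>x p. pre_digraph.awalk Q x p x \<longrightarrow> p = []) \<and>
     (\<forall>\<alpha> \<in> arcs Q. \<forall>p. pre_digraph.awalk Q (tail Q \<alpha>) p (head Q \<alpha>) \<longrightarrow> p = [\<alpha>])"

datatype 'v ext_vertex = Vert 'v | Vert_a | Vert_b
datatype ('v, 'e) ext_arrow = Arrow 'e | From_b 'v | To_a 'v

definition sources :: "('v, 'e) pre_digraph \<Rightarrow> 'v set" where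
  "sources Q = {x \<in> verts Q. in_arcs Q x = {}}"

definition sinks :: "('v, 'e) pre_digraph \<Rightarrow> 'v set" where
  "sinks Q = {x \<in> verts Q. out_arcs Q x = {}}"

definition extended_quiver ::
    "('v, 'e) pre_digraph \<Rightarrow> ('v ext_vertex, ('v, 'e) ext_arrow) pre_digraph" where
  "extended_quiver Q =
     \<lparr>verts = Vert ` verts Q \<union> {Vert_a, Vert_b},
      arcs = Arrow ` arcs Q \<union> From_b ` sources Q \<union> To_a ` sinks Q,
      tail = (\<lambda>\<alpha>. case \<alpha> of Arrow e \<Rightarrow> Vert (tail Q e) | From_b x \<Rightarrow> Vert_b | To_a x \<Rightarrow> Vert x),
      head = (\<lambda>\<alpha>. case \<alpha> of Arrow e \<Rightarrow> Vert (head Q e) | From_b x \<Rightarrow> Vert x | To_a x \<Rightarrow> Vert_a)\<rparr>"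


section \<open>The path algebra and the incidence algebra\<close>

text \<open>
  The scalars form a type of class \<^class>\<open>field\<close>.  Vector spaces and algebras over it are records
  \<^typ>\<open>('k, 'x) module\<close> with an explicit carrier; the components \<open>mult\<close> and \<open>one\<close> are relevant for
  algebras only.  A path is its initial vertex together with its list of arrows.
\<close>

type_synonym ('v, 'e) path = "'v \<times> 'e list"

definition paths :: "('v, 'e) pre_digraph \<Rightarrow> ('v, 'e) path set" where
  "paths Q = {(x, p). \<exists>y. pre_digraph.awalk Q x p y}"

definition path_start :: "('v, 'e) path \<Rightarrow> 'v" where
  "path_start p = fst p"

definition path_end :: "('v, 'e) pre_digraph \<Rightarrow> ('v, 'e) path \<Rightarrow> 'v" where
  "path_end Q p = pre_digraph.awlast Q (fst p) (snd p)"

text \<open>The product \<open>pq\<close> of paths is ``first \<open>q\<close>, then \<open>p\<close>'', and zero if these do not compose.\<close>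

definition path_algebra ::
    "('v, 'e) pre_digraph \<Rightarrow> ('k::field, ('v, 'e) path \<Rightarrow>\<^sub>0 'k) module" where
  "path_algebra Q =
     \<lparr>carrier = {f. Poly_Mapping.keys f \<subseteq> paths Q},
      monoid.mult = (\<lambda>f g. \<Sum>p\<in>Poly_Mapping.keys f. \<Sum>q\<in>Poly_Mapping.keys g.
        if path_end Q q = path_start p
        then Poly_Mapping.single (fst q, snd q @ snd p)
          (Poly_Mapping.lookup f p * Poly_Mapping.lookup g q)
        else 0),
      one = (\<Sum>x\<in>verts Q. Poly_Mapping.single (x, []) 1),
      ring.zero = 0,
      add = (+),
      smult = (\<lambda>c. Poly_Mapping.map ((*) c))\<rparr>"

definition parallel_ideal ::
    "('v, 'e) pre_digraph \<Rightarrow> (('v, 'e) path \<Rightarrow>\<^sub>0 'k::field) set" where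
  "parallel_ideal Q =
     Idl\<^bsub>path_algebra Q\<^esub>
       {Poly_Mapping.single p 1 - Poly_Mapping.single q 1 | p q.
          p \<in> paths Q \<and> q \<in> paths Q \<and>
          path_start p = path_start q \<and> path_end Q p = path_end Q q}"

text \<open>
  The library quotient, equipped with the induced scalar multiplication \<open>c \<odot> (U + x) = U + c \<odot> x\<close>.
  It serves both for algebras modulo ideals and for vector spaces modulo subspaces.
\<close>

definition quotient :: "('k, 'x) module \<Rightarrow> 'x set \<Rightarrow> ('k, 'x set) module" where
  "quotient V U = ring.extend (V Quot U) (module.fields (\<lambda>c X. U <+>\<^bsub>V\<^esub> ((\<lambda>x. c \<odot>\<^bsub>V\<^esub> x) ` X)))"

lemma quotient_simps [simp]:
  "carrier (quotient V U) = a_rcosets\<^bsub>V\<^esub> U"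
  "mult (quotient V U) = rcoset_mult V U"
  "one (quotient V U) = U +>\<^bsub>V\<^esub> \<one>\<^bsub>V\<^esub>"
  "zero (quotient V U) = U"
  "add (quotient V U) = set_add V"
  "smult (quotient V U) c X = U <+>\<^bsub>V\<^esub> ((\<lambda>x. c \<odot>\<^bsub>V\<^esub> x) ` X)"
  by (simp_all add: quotient_def FactRing_def ring.defs module.defs)

definition incidence_algebra ::
    "('v, 'e) pre_digraph \<Rightarrow> ('k::field, (('v, 'e) path \<Rightarrow>\<^sub>0 'k) set) module" where
  "incidence_algebra Q = quotient (path_algebra Q) (parallel_ideal Q)"


section \<open>Cohomology of cochain complexes of vector spaces\<close>

definition cohomology ::
    "(nat \<Rightarrow> ('k, 'c) module) \<Rightarrow> (nat \<Rightarrow> 'c \<Rightarrow> 'c) \<Rightarrow> nat \<Rightarrow> ('k, 'c set) module" where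
  "cohomology C \<delta> n =
     quotient (C n \<lparr>carrier := {f \<in> carrier (C n). \<delta> n f = \<zero>\<^bsub>C (Suc n)\<^esub>}\<rparr>)
       (case n of 0 \<Rightarrow> {\<zero>\<^bsub>C 0\<^esub>} | Suc m \<Rightarrow> \<delta> m ` carrier (C m))"

definition isomorphic_spaces :: "('k, 'x) module \<Rightarrow> ('k, 'y) module \<Rightarrow> bool" where
  "isomorphic_spaces V W \<longleftrightarrow>
     (\<exists>\<phi>. bij_betw \<phi> (carrier V) (carrier W) \<and>
        (\<forall>x\<in>carrier V. \<forall>y\<in>carrier V. \<phi> (x \<oplus>\<^bsub>V\<^esub> y) = \<phi> x \<oplus>\<^bsub>W\<^esub> \<phi> y) \<and>
        (\<forall>c. \<forall>x\<in>carrier V. \<phi> (c \<odot>\<^bsub>V\<^esub> x) = c \<odot>\<^bsub>W\<^esub> \<phi> x))"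


section \<open>Hochschild cohomology of an algebra with coefficients in itself\<close>

text \<open>
  Hochschild cochains of degree \<open>n\<close> are the \<open>k\<close>-multilinear maps of \<open>n\<close> arguments, i.e.\ the linear
  maps on the \<open>n\<close>-fold tensor power; the arguments are given as a list of length \<open>n\<close>.
\<close>

definition tuples :: "('k, 'x) module \<Rightarrow> nat \<Rightarrow> 'x list set" where
  "tuples A n = {as. length as = n \<and> set as \<subseteq> carrier A}"

definition hochschild_cochains :: "('k, 'x) module \<Rightarrow> nat \<Rightarrow> ('k, 'x list \<Rightarrow> 'x) module" where
  "hochschild_cochains A n =
     \<lparr>carrier = {f \<in> tuples A n \<rightarrow>\<^sub>E carrier A. \<forall>as\<in>tuples A n. \<forall>i<n.
        (\<forall>x\<in>carrier A. \<forall>y\<in>carrier A. f (as[i := x \<oplus>\<^bsub>A\<^esub> y]) = f (as[i := x]) \<oplus>\<^bsub>A\<^esub> f (as[i := y])) \<and>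
        (\<forall>c. \<forall>x\<in>carrier A. f (as[i := c \<odot>\<^bsub>A\<^esub> x]) = c \<odot>\<^bsub>A\<^esub> f (as[i := x]))},
      monoid.mult = undefined,
      one = undefined,
      ring.zero = (\<lambda>as\<in>tuples A n. \<zero>\<^bsub>A\<^esub>),
      add = (\<lambda>f g. \<lambda>as\<in>tuples A n. f as \<oplus>\<^bsub>A\<^esub> g as),
      smult = (\<lambda>c f. \<lambda>as\<in>tuples A n. c \<odot>\<^bsub>A\<^esub> f as)\<rparr>"

text \<open>
  \<open>(\<delta>f)(a\<^sub>1,\<dots>,a\<^sub>n\<^sub>+\<^sub>1) = a\<^sub>1 f(a\<^sub>2,\<dots>,a\<^sub>n\<^sub>+\<^sub>1) + (\<Sum>i=1..n. (-1)\<^sup>i f(\<dots>,a\<^sub>i a\<^sub>i\<^sub>+\<^sub>1,\<dots>))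
    + (-1)\<^sup>n\<^sup>+\<^sup>1 f(a\<^sub>1,\<dots>,a\<^sub>n) a\<^sub>n\<^sub>+\<^sub>1\<close>, where \<open>a\<^sub>i\<close> is \<open>as ! (i - 1)\<close>.
\<close>

definition hochschild_coboundary ::
    "('k::field, 'x) module \<Rightarrow> nat \<Rightarrow> ('x list \<Rightarrow> 'x) \<Rightarrow> ('x list \<Rightarrow> 'x)" where
  "hochschild_coboundary A n f = (\<lambda>as\<in>tuples A (Suc n).
     hd as \<otimes>\<^bsub>A\<^esub> f (tl as) \<oplus>\<^bsub>A\<^esub>
     (\<Oplus>\<^bsub>A\<^esub>i\<in>{1..n}. (- 1) ^ i \<odot>\<^bsub>A\<^esub>
        f (take (i - 1) as @ [as ! (i - 1) \<otimes>\<^bsub>A\<^esub> as ! i] @ drop (Suc i) as)) \<oplus>\<^bsub>A\<^esub>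
     (- 1) ^ Suc n \<odot>\<^bsub>A\<^esub> (f (butlast as) \<otimes>\<^bsub>A\<^esub> last as))"

definition HH :: "('k::field, 'x) module \<Rightarrow> nat \<Rightarrow> ('k, ('x list \<Rightarrow> 'x) set) module" where
  "HH A n = cohomology (hochschild_cochains A) (hochschild_coboundary A) n"


section \<open>Right modules\<close>

text \<open>
  A right module over a ring with element type \<open>'x\<close> is a record \<^typ>\<open>('x, 'm) module\<close>, where
  \<open>a \<odot>\<^bsub>M\<^esub> x\<close> stands for \<open>x\<cdot>a\<close>.  (The locale \<^locale>\<open>module\<close> requires a commutative ring.)
\<close>

locale right_module = A?: ring A + M?: abelian_group M
  for A :: "('x, 'r) ring_scheme" (structure) and M :: "('x, 'm) module" (structure) +
  assumes act_closed:
      "\<lbrakk>a \<in> carrier A; x \<in> carrier M\<rbrakk> \<Longrightarrow> a \<odot>\<^bsub>M\<^esub> x \<in> carrier M"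
    and act_add_ring:
      "\<lbrakk>a \<in> carrier A; b \<in> carrier A; x \<in> carrier M\<rbrakk> \<Longrightarrow>
        (a \<oplus>\<^bsub>A\<^esub> b) \<odot>\<^bsub>M\<^esub> x = a \<odot>\<^bsub>M\<^esub> x \<oplus>\<^bsub>M\<^esub> b \<odot>\<^bsub>M\<^esub> x"
    and act_add:
      "\<lbrakk>a \<in> carrier A; x \<in> carrier M; y \<in> carrier M\<rbrakk> \<Longrightarrow>
        a \<odot>\<^bsub>M\<^esub> (x \<oplus>\<^bsub>M\<^esub> y) = a \<odot>\<^bsub>M\<^esub> x \<oplus>\<^bsub>M\<^esub> a \<odot>\<^bsub>M\<^esub> y"
    and act_mult:
      "\<lbrakk>a \<in> carrier A; b \<in> carrier A; x \<in> carrier M\<rbrakk> \<Longrightarrow>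
        (a \<otimes>\<^bsub>A\<^esub> b) \<odot>\<^bsub>M\<^esub> x = b \<odot>\<^bsub>M\<^esub> (a \<odot>\<^bsub>M\<^esub> x)"
    and act_one:
      "x \<in> carrier M \<Longrightarrow> \<one>\<^bsub>A\<^esub> \<odot>\<^bsub>M\<^esub> x = x"

definition rmod_hom ::
    "('x, 'r) ring_scheme \<Rightarrow> ('x, 'm) module \<Rightarrow> ('x, 'n) module \<Rightarrow> ('m \<Rightarrow> 'n) set" where
  "rmod_hom A M N = {f \<in> carrier M \<rightarrow>\<^sub>E carrier N.
     (\<forall>x\<in>carrier M. \<forall>y\<in>carrier M. f (x \<oplus>\<^bsub>M\<^esub> y) = f x \<oplus>\<^bsub>N\<^esub> f y) \<and>
     (\<forall>a\<in>carrier A. \<forall>x\<in>carrier M. f (a \<odot>\<^bsub>M\<^esub> x) = a \<odot>\<^bsub>N\<^esub> f x)}"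

text \<open>
  Lifting property against surjections \<open>X \<rightarrow> Y\<close>.  The type \<open>'p \<Rightarrow> 'x\<close> is large enough for \<open>X\<close> to be
  the free module on the carrier of \<open>P\<close>, so lifting the identity of \<open>P\<close> makes \<open>P\<close> a direct summand
  of a free module and hence gives the lifting property for surjections on all types.
\<close>

definition projective :: "('x, 'r) ring_scheme \<Rightarrow> ('x, 'p) module \<Rightarrow> bool" where
  "projective A P \<longleftrightarrow> right_module A P \<and>
     (\<forall>(X :: ('x, 'p \<Rightarrow> 'x) module) (Y :: ('x, 'p) module) g f.
        right_module A X \<and> right_module A Y \<and>
        g \<in> rmod_hom A X Y \<and> g ` carrier X = carrier Y \<and> f \<in> rmod_hom A P Y \<longrightarrow>
        (\<exists>h \<in> rmod_hom A P X. \<forall>x\<in>carrier P. g (h x) = f x))"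

definition projective_resolution ::
    "('x, 'r) ring_scheme \<Rightarrow> ('x, 'm) module \<Rightarrow>
      (nat \<Rightarrow> ('x, 'p) module) \<Rightarrow> (nat \<Rightarrow> 'p \<Rightarrow> 'p) \<Rightarrow> ('p \<Rightarrow> 'm) \<Rightarrow> bool" where
  "projective_resolution A M P d \<epsilon> \<longleftrightarrow>
     right_module A M \<and>
     (\<forall>n. projective A (P n)) \<and>
     \<epsilon> \<in> rmod_hom A (P 0) M \<and>
     (\<forall>n. d n \<in> rmod_hom A (P (Suc n)) (P n)) \<and>
     \<epsilon> ` carrier (P 0) = carrier M \<and>
     a_kernel (P 0) M \<epsilon> = d 0 ` carrier (P 1) \<and>
     (\<forall>n. a_kernel (P (Suc n)) (P n) (d n) = d (Suc n) ` carrier (P (Suc (Suc n))))"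

text \<open>For an algebra \<open>A\<close>, scalars act on homomorphisms by \<open>(c f)(x) = f(x)\<cdot>(c 1\<^sub>A)\<close>.\<close>

definition hom_space ::
    "('k, 'x) module \<Rightarrow> ('x, 'm) module \<Rightarrow> ('x, 'n) module \<Rightarrow> ('k, 'm \<Rightarrow> 'n) module" where
  "hom_space A M N =
     \<lparr>carrier = rmod_hom A M N,
      monoid.mult = undefined,
      one = undefined,
      ring.zero = (\<lambda>x\<in>carrier M. \<zero>\<^bsub>N\<^esub>),
      add = (\<lambda>f g. \<lambda>x\<in>carrier M. f x \<oplus>\<^bsub>N\<^esub> g x),
      smult = (\<lambda>c f. \<lambda>x\<in>carrier M. (c \<odot>\<^bsub>A\<^esub> \<one>\<^bsub>A\<^esub>) \<odot>\<^bsub>N\<^esub> f x)\<rparr>"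

definition Ext_via ::
    "('k, 'x) module \<Rightarrow> (nat \<Rightarrow> ('x, 'p) module) \<Rightarrow> (nat \<Rightarrow> 'p \<Rightarrow> 'p) \<Rightarrow> ('x, 'n) module \<Rightarrow>
      nat \<Rightarrow> ('k, ('p \<Rightarrow> 'n) set) module" where
  "Ext_via A P d N n =
     cohomology (\<lambda>i. hom_space A (P i) N) (\<lambda>i f. compose (carrier (P (Suc i))) f (d i)) n"

text \<open>
  A type closed under formal linear combinations, hence large enough to carry a free resolution of
  every right module on \<open>'m\<close> over every ring on \<open>'x\<close>; see \<open>projective_resolution_exists\<close> below.
\<close>

datatype ('m, 'x) formal = Base 'm | Comb "(('m, 'x) formal \<times> 'x) list"

definition Ext ::
    "('k, 'x) module \<Rightarrow> ('x, 'm) module \<Rightarrow> ('x, 'n) module \<Rightarrow> nat \<Rightarrow>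
      ('k, (('m, 'x) formal \<Rightarrow> 'n) set) module" where
  "Ext A M N n =
     (let (P, d, \<epsilon>) = (SOME (P, d, \<epsilon>). projective_resolution A M P d \<epsilon>) in Ext_via A P d N n)"


subsection \<open>Existence of projective resolutions\<close>

text \<open>The choice in \<open>Ext\<close> is never vacuous.\<close>

lemma rmod_homD:
  assumes "f \<in> rmod_hom A M N"
  shows "x \<in> carrier M \<Longrightarrow> f x \<in> carrier N"
    and "\<lbrakk>x \<in> carrier M; y \<in> carrier M\<rbrakk> \<Longrightarrow> f (x \<oplus>\<^bsub>M\<^esub> y) = f x \<oplus>\<^bsub>N\<^esub> f y"
    and "\<lbrakk>a \<in> carrier A; x \<in> carrier M\<rbrakk> \<Longrightarrow> f (a \<odot>\<^bsub>M\<^esub> x) = a \<odot>\<^bsub>N\<^esub> f x"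
  using assms by (auto simp: rmod_hom_def)

lemma rmod_homI:
  assumes "\<And>x. x \<in> carrier M \<Longrightarrow> f x \<in> carrier N"
    and "\<And>x y. \<lbrakk>x \<in> carrier M; y \<in> carrier M\<rbrakk> \<Longrightarrow> f (x \<oplus>\<^bsub>M\<^esub> y) = f x \<oplus>\<^bsub>N\<^esub> f y"
    and "\<And>a x. \<lbrakk>a \<in> carrier A; x \<in> carrier M\<rbrakk> \<Longrightarrow> f (a \<odot>\<^bsub>M\<^esub> x) = a \<odot>\<^bsub>N\<^esub> f x"
    and "right_module A M"
  shows "restrict f (carrier M) \<in> rmod_hom A M N"
proof -
  interpret right_module A M by fact
  show ?thesis using assms(1-3) by (auto simp: rmod_hom_def act_closed)
qed

lemma rmod_hom_zero:
  assumes "f \<in> rmod_hom A M N" "right_module A M" "right_module A N"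
  shows "f \<zero>\<^bsub>M\<^esub> = \<zero>\<^bsub>N\<^esub>"
proof -
  interpret M: right_module A M by fact
  interpret N: right_module A N by fact
  have "f \<zero>\<^bsub>M\<^esub> \<oplus>\<^bsub>N\<^esub> f \<zero>\<^bsub>M\<^esub> = f \<zero>\<^bsub>M\<^esub>"
    using rmod_homD(2)[OF assms(1), of "\<zero>\<^bsub>M\<^esub>" "\<zero>\<^bsub>M\<^esub>"] by simp
  then show ?thesis using rmod_homD(1)[OF assms(1), of "\<zero>\<^bsub>M\<^esub>"] by simp
qed

context right_module begin

lemma act_zero [simp]: "a \<in> carrier A \<Longrightarrow> a \<odot>\<^bsub>M\<^esub> \<zero>\<^bsub>M\<^esub> = \<zero>\<^bsub>M\<^esub>"
  using act_add[of a "\<zero>\<^bsub>M\<^esub>" "\<zero>\<^bsub>M\<^esub>"] act_closed[of a "\<zero>\<^bsub>M\<^esub>"] by simp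

lemma act_zero_ring [simp]: "x \<in> carrier M \<Longrightarrow> \<zero>\<^bsub>A\<^esub> \<odot>\<^bsub>M\<^esub> x = \<zero>\<^bsub>M\<^esub>"
  using act_add_ring[of "\<zero>\<^bsub>A\<^esub>" "\<zero>\<^bsub>A\<^esub>" x] act_closed[of "\<zero>\<^bsub>A\<^esub>" x] by simp

lemma act_finsum:
  assumes "finite T" "a \<in> carrier A" "\<And>t. t \<in> T \<Longrightarrow> f t \<in> carrier M"
  shows "a \<odot>\<^bsub>M\<^esub> finsum M f T = finsum M (\<lambda>t. a \<odot>\<^bsub>M\<^esub> f t) T"
  using assms
proof (induction T)
  case (insert t T)
  then show ?case by (simp add: Pi_def act_add act_closed)
qed simp

end

definition free_rmod :: "('x, 'r) ring_scheme \<Rightarrow> 's set \<Rightarrow> ('x, 's \<Rightarrow> 'x) module" where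
  "free_rmod A S =
    \<lparr>carrier = {f. (\<forall>s. f s \<in> carrier A) \<and> finite {s. f s \<noteq> \<zero>\<^bsub>A\<^esub>} \<and> (\<forall>s. s \<notin> S \<longrightarrow> f s = \<zero>\<^bsub>A\<^esub>)},
     monoid.mult = undefined, one = undefined,
     ring.zero = (\<lambda>s. \<zero>\<^bsub>A\<^esub>), add = (\<lambda>f g s. f s \<oplus>\<^bsub>A\<^esub> g s), smult = (\<lambda>a f s. f s \<otimes>\<^bsub>A\<^esub> a)\<rparr>"

lemma free_rmod_right_module:
  assumes "ring A" shows "right_module A (free_rmod A S)"
proof -
  interpret ring A by fact
  have *: "finite {s. f s \<noteq> \<zero>\<^bsub>A\<^esub>} \<Longrightarrow> finite {s. g s \<noteq> \<zero>\<^bsub>A\<^esub>} \<Longrightarrow>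
     finite {s. f s \<oplus>\<^bsub>A\<^esub> g s \<noteq> \<zero>\<^bsub>A\<^esub>}" for f g
    by (rule finite_subset[of _ "{s. f s \<noteq> \<zero>\<^bsub>A\<^esub>} \<union> {s. g s \<noteq> \<zero>\<^bsub>A\<^esub>}"]) auto
  have **: "finite {s. f s \<noteq> \<zero>\<^bsub>A\<^esub>} \<Longrightarrow> a \<in> carrier A \<Longrightarrow> finite {s. f s \<otimes>\<^bsub>A\<^esub> a \<noteq> \<zero>\<^bsub>A\<^esub>}" for f a
    by (rule finite_subset[of _ "{s. f s \<noteq> \<zero>\<^bsub>A\<^esub>}"]) auto
  have "abelian_group (free_rmod A S)"
  proof (rule abelian_groupI)
    fix f assume f: "f \<in> carrier (free_rmod A S)"
    have "{s. \<ominus>\<^bsub>A\<^esub> f s \<noteq> \<zero>\<^bsub>A\<^esub>} \<subseteq> {s. f s \<noteq> \<zero>\<^bsub>A\<^esub>}" using f by (auto simp: free_rmod_def)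
    then have "(\<lambda>s. \<ominus>\<^bsub>A\<^esub> f s) \<in> carrier (free_rmod A S)"
      using f finite_subset by (auto simp: free_rmod_def)
    moreover have "(\<lambda>s. \<ominus>\<^bsub>A\<^esub> f s) \<oplus>\<^bsub>free_rmod A S\<^esub> f = \<zero>\<^bsub>free_rmod A S\<^esub>"
      using f by (simp add: free_rmod_def l_neg)
    ultimately show "\<exists>g\<in>carrier (free_rmod A S). g \<oplus>\<^bsub>free_rmod A S\<^esub> f = \<zero>\<^bsub>free_rmod A S\<^esub>" by blast
  qed (simp_all add: free_rmod_def * a_ac)
  then show ?thesis
    by (intro right_module.intro right_module_axioms.intro assms)
      (auto simp: free_rmod_def ** m_assoc l_distr r_distr)
qed

definition basis_vector :: "('x, 'r) ring_scheme \<Rightarrow> 's \<Rightarrow> 's \<Rightarrow> 'x" where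
  "basis_vector A s = (\<lambda>t. if t = s then \<one>\<^bsub>A\<^esub> else \<zero>\<^bsub>A\<^esub>)"

lemma basis_vector_closed: "ring A \<Longrightarrow> s \<in> S \<Longrightarrow> basis_vector A s \<in> carrier (free_rmod A S)"
  by (auto simp: free_rmod_def basis_vector_def ring.ring_simprules)

lemma free_rmod_hom_exists:
  assumes A: "ring A" and M: "right_module A M" and \<phi>: "\<And>s. s \<in> S \<Longrightarrow> \<phi> s \<in> carrier M"
  shows "\<exists>h \<in> rmod_hom A (free_rmod A S) M. \<forall>s\<in>S. h (basis_vector A s) = \<phi> s"
proof -
  interpret M: right_module A M by fact
  let ?F = "free_rmod A S"
  interpret F: right_module A ?F by (rule free_rmod_right_module[OF A])
  define h where "h f = finsum M (\<lambda>s. f s \<odot>\<^bsub>M\<^esub> \<phi> s) {s. f s \<noteq> \<zero>\<^bsub>A\<^esub>}" for f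
  have h_eq: "h f = finsum M (\<lambda>s. f s \<odot>\<^bsub>M\<^esub> \<phi> s) T"
    if "f \<in> carrier ?F" "finite T" "{s. f s \<noteq> \<zero>\<^bsub>A\<^esub>} \<subseteq> T" "T \<subseteq> S" for f T
    unfolding h_def
    by (rule M.M.add.finprod_mono_neutral_cong_left)
      (use that \<phi> in \<open>auto simp: free_rmod_def intro!: M.act_closed\<close>)
  have "restrict h (carrier ?F) \<in> rmod_hom A ?F M"
  proof (rule rmod_homI[OF _ _ _ F.right_module_axioms])
    fix f g assume fg: "f \<in> carrier ?F" "g \<in> carrier ?F"
    let ?T = "{s. f s \<noteq> \<zero>\<^bsub>A\<^esub>} \<union> {s. g s \<noteq> \<zero>\<^bsub>A\<^esub>}"
    have T: "finite ?T" "?T \<subseteq> S" using fg unfolding free_rmod_def by auto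
    have c: "f s \<in> carrier A" "g s \<in> carrier A" for s using fg by (auto simp: free_rmod_def)
    have supp: "{s. (f \<oplus>\<^bsub>?F\<^esub> g) s \<noteq> \<zero>\<^bsub>A\<^esub>} \<subseteq> ?T" using c by (auto simp: free_rmod_def)
    have "h (f \<oplus>\<^bsub>?F\<^esub> g) = finsum M (\<lambda>s. (f \<oplus>\<^bsub>?F\<^esub> g) s \<odot>\<^bsub>M\<^esub> \<phi> s) ?T"
      by (rule h_eq) (use F.M.a_closed[OF fg] T supp in auto)
    also have "\<dots> = finsum M (\<lambda>s. f s \<odot>\<^bsub>M\<^esub> \<phi> s \<oplus>\<^bsub>M\<^esub> g s \<odot>\<^bsub>M\<^esub> \<phi> s) ?T"
      using c \<phi> T by (intro M.M.finsum_cong') (auto simp: free_rmod_def M.act_add_ring M.act_closed subset_iff)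
    also have "\<dots> = finsum M (\<lambda>s. f s \<odot>\<^bsub>M\<^esub> \<phi> s) ?T \<oplus>\<^bsub>M\<^esub> finsum M (\<lambda>s. g s \<odot>\<^bsub>M\<^esub> \<phi> s) ?T"
      using c \<phi> T by (intro M.M.finsum_addf) (auto simp: M.act_closed subset_iff)
    also have "\<dots> = h f \<oplus>\<^bsub>M\<^esub> h g"
      using h_eq[OF fg(1) T(1) _ T(2)] h_eq[OF fg(2) T(1) _ T(2)] by auto
    finally show "h (f \<oplus>\<^bsub>?F\<^esub> g) = h f \<oplus>\<^bsub>M\<^esub> h g" .
  next
    fix a f assume a: "a \<in> carrier A" and f: "f \<in> carrier ?F"
    let ?T = "{s. f s \<noteq> \<zero>\<^bsub>A\<^esub>}"
    have T: "finite ?T" "?T \<subseteq> S" and c: "\<And>s. f s \<in> carrier A"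
      using f unfolding free_rmod_def by auto
    have "h (a \<odot>\<^bsub>?F\<^esub> f) = finsum M (\<lambda>s. (a \<odot>\<^bsub>?F\<^esub> f) s \<odot>\<^bsub>M\<^esub> \<phi> s) ?T"
      by (rule h_eq) (use a f T F.act_closed in \<open>auto simp: free_rmod_def\<close>)
    also have "\<dots> = finsum M (\<lambda>s. a \<odot>\<^bsub>M\<^esub> (f s \<odot>\<^bsub>M\<^esub> \<phi> s)) ?T"
      using a c \<phi> T by (intro M.M.finsum_cong') (auto simp: free_rmod_def M.act_mult M.act_closed subset_iff)
    also have "\<dots> = a \<odot>\<^bsub>M\<^esub> h f"
      unfolding h_def using a c \<phi> T by (subst M.act_finsum) (auto simp: M.act_closed subset_iff)
    finally show "h (a \<odot>\<^bsub>?F\<^esub> f) = a \<odot>\<^bsub>M\<^esub> h f" .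
  next
    fix f assume "f \<in> carrier ?F"
    then have "f s \<odot>\<^bsub>M\<^esub> \<phi> s \<in> carrier M" if "f s \<noteq> \<zero>\<^bsub>A\<^esub>" for s
      using that \<phi> by (intro M.act_closed) (auto simp: free_rmod_def)
    then show "h f \<in> carrier M"
      unfolding h_def by (intro M.M.finsum_closed) auto
  qed
  moreover have "h (basis_vector A s) = \<phi> s" if "s \<in> S" for s
  proof -
    have "h (basis_vector A s) = finsum M (\<lambda>t. basis_vector A s t \<odot>\<^bsub>M\<^esub> \<phi> t) {s}"
      by (rule h_eq) (use that basis_vector_closed[OF A] in \<open>auto simp: basis_vector_def\<close>)
    then show ?thesis using \<phi>[OF that] by (simp add: basis_vector_def M.act_one M.act_closed Pi_def)
  qed
  ultimately show ?thesis
    using basis_vector_closed[OF A, of _ S] by (intro bexI[of _ "restrict h (carrier ?F)"]) simp_all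
qed

lemma free_rmod_hom_eq:
  assumes A: "ring A" and M: "right_module A M"
    and u: "u \<in> rmod_hom A (free_rmod A S) M" and v: "v \<in> rmod_hom A (free_rmod A S) M"
    and uv: "\<And>s. s \<in> S \<Longrightarrow> u (basis_vector A s) = v (basis_vector A s)"
    and f: "f \<in> carrier (free_rmod A S)"
  shows "u f = v f"
proof -
  interpret M: right_module A M by fact
  let ?F = "free_rmod A S"
  interpret F: right_module A ?F by (rule free_rmod_right_module[OF A])
  have "u f = v f" if "finite T" "f \<in> carrier ?F" "{s. f s \<noteq> \<zero>\<^bsub>A\<^esub>} \<subseteq> T" "T \<subseteq> S" for T f
    using that
  proof (induction T arbitrary: f rule: finite_induct)
    case empty
    then have "f = \<zero>\<^bsub>?F\<^esub>" by (auto simp: free_rmod_def)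
    then show ?case
      using rmod_hom_zero[OF u F.right_module_axioms M] rmod_hom_zero[OF v F.right_module_axioms M] by simp
  next
    case (insert t T)
    define f0 where "f0 = f(t := \<zero>\<^bsub>A\<^esub>)"
    have "{s. f0 s \<noteq> \<zero>\<^bsub>A\<^esub>} \<subseteq> {s. f s \<noteq> \<zero>\<^bsub>A\<^esub>}" by (auto simp: f0_def)
    then have "finite {s. f0 s \<noteq> \<zero>\<^bsub>A\<^esub>}" using insert.prems finite_subset by (auto simp: free_rmod_def)
    then have f0: "f0 \<in> carrier ?F" "{s. f0 s \<noteq> \<zero>\<^bsub>A\<^esub>} \<subseteq> T"
      using insert.prems by (auto simp: free_rmod_def f0_def)
    have ft: "f t \<in> carrier A" and t: "t \<in> S" using insert.prems by (auto simp: free_rmod_def)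
    have b: "basis_vector A t \<in> carrier ?F" by (rule basis_vector_closed[OF A t])
    have *: "f = f0 \<oplus>\<^bsub>?F\<^esub> (f t \<odot>\<^bsub>?F\<^esub> basis_vector A t)"
      using insert.prems by (auto simp: free_rmod_def f0_def basis_vector_def)
    have "u f = u f0 \<oplus>\<^bsub>M\<^esub> f t \<odot>\<^bsub>M\<^esub> u (basis_vector A t)"
      by (subst *) (simp add: rmod_homD[OF u] f0 b ft F.act_closed)
    also have "\<dots> = v f0 \<oplus>\<^bsub>M\<^esub> f t \<odot>\<^bsub>M\<^esub> v (basis_vector A t)"
      using insert f0 t uv by auto
    also have "\<dots> = v f"
      by (subst (2) *) (simp add: rmod_homD[OF v] f0 b ft F.act_closed)
    finally show ?case .
  qed
  moreover have "finite {s. f s \<noteq> \<zero>\<^bsub>A\<^esub>}" "{s. f s \<noteq> \<zero>\<^bsub>A\<^esub>} \<subseteq> S"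
    using f unfolding free_rmod_def by auto
  ultimately show ?thesis using f by blast
qed

text \<open>Transport of structure along an injection.\<close>

definition copy_rmod :: "('m \<Rightarrow> 'n) \<Rightarrow> ('x, 'm) module \<Rightarrow> ('x, 'n) module" where
  "copy_rmod j M = (let i = inv_into (carrier M) j in
    \<lparr>carrier = j ` carrier M, monoid.mult = undefined, one = undefined,
     ring.zero = j \<zero>\<^bsub>M\<^esub>, add = (\<lambda>x y. j (i x \<oplus>\<^bsub>M\<^esub> i y)), smult = (\<lambda>a x. j (a \<odot>\<^bsub>M\<^esub> i x))\<rparr>)"

lemma copy_rmod:
  assumes M: "right_module A M" and j: "inj_on j (carrier M)"
  shows "right_module A (copy_rmod j M)"
    and "restrict j (carrier M) \<in> rmod_hom A M (copy_rmod j M)"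
    and "restrict (inv_into (carrier M) j) (j ` carrier M) \<in> rmod_hom A (copy_rmod j M) M"
proof -
  interpret M: right_module A M by fact
  note [simp] = inv_into_f_f[OF j]
  have "abelian_group (copy_rmod j M)"
  proof (rule abelian_groupI)
    fix x assume "x \<in> carrier (copy_rmod j M)"
    then obtain m where m: "m \<in> carrier M" "x = j m" by (auto simp: copy_rmod_def Let_def)
    then show "\<exists>y\<in>carrier (copy_rmod j M). y \<oplus>\<^bsub>copy_rmod j M\<^esub> x = \<zero>\<^bsub>copy_rmod j M\<^esub>"
      by (intro bexI[of _ "j (\<ominus>\<^bsub>M\<^esub> m)"]) (auto simp: copy_rmod_def Let_def M.M.l_neg)
  qed (auto simp: copy_rmod_def Let_def M.M.a_ac)
  then show rm: "right_module A (copy_rmod j M)"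
    by (intro right_module.intro right_module_axioms.intro M.A.ring_axioms)
      (auto simp: copy_rmod_def Let_def M.act_closed M.act_add_ring M.act_add M.act_mult M.act_one)
  show "restrict j (carrier M) \<in> rmod_hom A M (copy_rmod j M)"
    by (rule rmod_homI[OF _ _ _ M]) (auto simp: copy_rmod_def Let_def)
  have "restrict (inv_into (carrier M) j) (carrier (copy_rmod j M)) \<in> rmod_hom A (copy_rmod j M) M"
    by (rule rmod_homI[OF _ _ _ rm]) (auto simp: copy_rmod_def Let_def M.act_closed)
  then show "restrict (inv_into (carrier M) j) (j ` carrier M) \<in> rmod_hom A (copy_rmod j M) M"
    by (simp add: copy_rmod_def Let_def)
qed

lemma rmod_hom_compose:
  assumes f: "f \<in> rmod_hom A L M" and g: "g \<in> rmod_hom A M N" and L: "right_module A L"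
  shows "restrict (\<lambda>x. g (f x)) (carrier L) \<in> rmod_hom A L N"
  by (rule rmod_homI[OF _ _ _ L]) (auto simp: rmod_homD[OF f] rmod_homD[OF g])

lemma copy_free_projective:
  fixes A :: "('x, 'r) ring_scheme" and j :: "('s \<Rightarrow> 'x) \<Rightarrow> 'p"
  assumes A: "ring A" and j: "inj_on j (carrier (free_rmod A S))"
  shows "projective A (copy_rmod j (free_rmod A S))"
proof -
  let ?F = "free_rmod A S" and ?P = "copy_rmod j (free_rmod A S)"
  have F: "right_module A ?F" by (rule free_rmod_right_module[OF A])
  note P = copy_rmod[OF F j]
  have carP: "carrier ?P = j ` carrier ?F" by (simp add: copy_rmod_def Let_def)
  show ?thesis
    unfolding projective_def
  proof (intro conjI allI impI P(1), elim conjE)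
    fix X :: "('x, 'p \<Rightarrow> 'x) module" and Y :: "('x, 'p) module" and g f
    assume X: "right_module A X" and Y: "right_module A Y" and g: "g \<in> rmod_hom A X Y"
      and surj: "g ` carrier X = carrier Y" and f: "f \<in> rmod_hom A ?P Y"
    let ?fj = "restrict (\<lambda>x. f (restrict j (carrier ?F) x)) (carrier ?F)"
    have fj: "?fj \<in> rmod_hom A ?F Y" by (rule rmod_hom_compose[OF P(2) f F])
    have "\<exists>x. x \<in> carrier X \<and> g x = ?fj (basis_vector A s)" if "s \<in> S" for s
    proof -
      have "?fj (basis_vector A s) \<in> g ` carrier X"
        unfolding surj by (rule rmod_homD(1)[OF fj basis_vector_closed[OF A that]])
      then show ?thesis by (elim imageE) (intro exI conjI, auto)
    qed
    then have "\<forall>s. \<exists>x. s \<in> S \<longrightarrow> x \<in> carrier X \<and> g x = ?fj (basis_vector A s)" by blast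
    then obtain \<phi> where "\<forall>s. s \<in> S \<longrightarrow> \<phi> s \<in> carrier X \<and> g (\<phi> s) = ?fj (basis_vector A s)"
      unfolding choice_iff by blast
    then have \<phi>: "\<And>s. s \<in> S \<Longrightarrow> \<phi> s \<in> carrier X \<and> g (\<phi> s) = ?fj (basis_vector A s)" by blast
    obtain h where h: "h \<in> rmod_hom A ?F X" "\<forall>s\<in>S. h (basis_vector A s) = \<phi> s"
      using free_rmod_hom_exists[OF A X, of S \<phi>] \<phi> by auto
    have gh: "restrict (\<lambda>x. g (h x)) (carrier ?F) \<in> rmod_hom A ?F Y"
      by (rule rmod_hom_compose[OF h(1) g F])
    have eq: "g (h x) = f (j x)" if "x \<in> carrier ?F" for x
    proof -
      have "restrict (\<lambda>x. g (h x)) (carrier ?F) x = ?fj x"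
      proof (rule free_rmod_hom_eq[OF A Y gh fj _ that])
        fix s assume s: "s \<in> S"
        show "restrict (\<lambda>x. g (h x)) (carrier ?F) (basis_vector A s) = ?fj (basis_vector A s)"
          using \<phi>[OF s] h(2) s basis_vector_closed[OF A s] by simp
      qed
      then show ?thesis using that by simp
    qed
    let ?i = "restrict (inv_into (carrier ?F) j) (j ` carrier ?F)"
    let ?h = "restrict (\<lambda>x. h (?i x)) (carrier ?P)"
    have "?h \<in> rmod_hom A ?P X" by (rule rmod_hom_compose[OF P(3) h(1) P(1)])
    moreover have "g (?h x) = f x" if x: "x \<in> carrier ?P" for x
    proof -
      obtain y where y: "y \<in> carrier ?F" "x = j y" using x carP by auto
      then show ?thesis using eq[OF y(1)] x carP by (simp add: inv_into_f_f[OF j])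
    qed
    ultimately show "\<exists>h\<in>rmod_hom A ?P X. \<forall>x\<in>carrier ?P. g (h x) = f x" by blast
  qed
qed

lemma inj_formal:
  "\<exists>j :: (('m, 'x) formal \<Rightarrow> 'x) \<Rightarrow> ('m, 'x) formal. inj_on j (carrier (free_rmod A S))"
proof -
  let ?graph = "\<lambda>f :: ('m, 'x) formal \<Rightarrow> 'x. (\<lambda>s. (s, f s)) ` {s. f s \<noteq> \<zero>\<^bsub>A\<^esub>}"
  have "\<forall>f\<in>carrier (free_rmod A S). \<exists>xs. set xs = ?graph f"
    by (intro ballI finite_list finite_imageI) (simp add: free_rmod_def)
  from bchoice[OF this] obtain l where
    l: "\<And>f. f \<in> carrier (free_rmod A S) \<Longrightarrow> set (l f) = ?graph f" by blast
  have "inj_on (\<lambda>f. Comb (l f)) (carrier (free_rmod A S))"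
  proof (rule inj_onI)
    fix f g :: "('m, 'x) formal \<Rightarrow> 'x"
    assume fg: "f \<in> carrier (free_rmod A S)" "g \<in> carrier (free_rmod A S)" "Comb (l f) = Comb (l g)"
    then have eq: "?graph f = ?graph g" using l[OF fg(1)] l[OF fg(2)] by simp
    show "f = g"
    proof
      fix s
      have "(s, y) \<in> ?graph f \<longleftrightarrow> (s, y) \<in> ?graph g" for y by (simp only: eq)
      then have "f s \<noteq> \<zero>\<^bsub>A\<^esub> \<and> y = f s \<longleftrightarrow> g s \<noteq> \<zero>\<^bsub>A\<^esub> \<and> y = g s" for y by auto
      from this[of "f s"] this[of "g s"] show "f s = g s" by auto
    qed
  qed
  then show ?thesis by blast
qed

lemma projective_cover_exists:
  fixes K :: "('x, ('m, 'x) formal) module"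
  assumes K: "right_module A K"
  shows "\<exists>(P :: ('x, ('m, 'x) formal) module) g.
    projective A P \<and> g \<in> rmod_hom A P K \<and> g ` carrier P = carrier K"
proof -
  interpret K: right_module A K by fact
  have A: "ring A" by (rule K.A.ring_axioms)
  let ?F = "free_rmod A (carrier K)"
  obtain j :: "(('m, 'x) formal \<Rightarrow> 'x) \<Rightarrow> ('m, 'x) formal" where j: "inj_on j (carrier ?F)"
    using inj_formal by blast
  have F: "right_module A ?F" by (rule free_rmod_right_module[OF A])
  note P = copy_rmod[OF F j]
  obtain h where h: "h \<in> rmod_hom A ?F K" "\<forall>s\<in>carrier K. h (basis_vector A s) = s"
    using free_rmod_hom_exists[OF A K, of "carrier K" "\<lambda>x. x"] by auto
  let ?g = "restrict (\<lambda>x. h (restrict (inv_into (carrier ?F) j) (j ` carrier ?F) x)) (carrier (copy_rmod j ?F))"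
  have g: "?g \<in> rmod_hom A (copy_rmod j ?F) K" by (rule rmod_hom_compose[OF P(3) h(1) P(1)])
  have "y \<in> ?g ` carrier (copy_rmod j ?F)" if "y \<in> carrier K" for y
  proof (rule image_eqI)
    show "j (basis_vector A y) \<in> carrier (copy_rmod j ?F)"
      using basis_vector_closed[OF A that] by (simp add: copy_rmod_def Let_def)
    then show "y = ?g (j (basis_vector A y))"
      using basis_vector_closed[OF A that] h(2) that by (simp add: inv_into_f_f[OF j])
  qed
  then have "?g ` carrier (copy_rmod j ?F) = carrier K" using rmod_homD(1)[OF g] by blast
  then show ?thesis using g copy_free_projective[OF A j] by blast
qed

lemma kernel_right_module:
  assumes P: "right_module A P" and K: "right_module A K" and g: "g \<in> rmod_hom A P K"
  shows "right_module A (P\<lparr>carrier := a_kernel P K g\<rparr>)"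
proof -
  interpret P: right_module A P by fact
  interpret K: right_module A K by fact
  note g' = rmod_homD[OF g] and g0 = rmod_hom_zero[OF g P K]
  have ker: "x \<in> a_kernel P K g \<longleftrightarrow> x \<in> carrier P \<and> g x = \<zero>\<^bsub>K\<^esub>" for x
    by (auto simp: a_kernel_def kernel_def)
  have neg: "g (\<ominus>\<^bsub>P\<^esub> x) = \<zero>\<^bsub>K\<^esub>" if "x \<in> carrier P" "g x = \<zero>\<^bsub>K\<^esub>" for x
    using g'(2)[of "\<ominus>\<^bsub>P\<^esub> x" x] g'(1)[of "\<ominus>\<^bsub>P\<^esub> x"] that g0 by (simp add: P.M.l_neg)
  have "abelian_group (P\<lparr>carrier := a_kernel P K g\<rparr>)"
  proof (rule abelian_groupI)
    fix x assume "x \<in> carrier (P\<lparr>carrier := a_kernel P K g\<rparr>)"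
    then show "\<exists>y\<in>carrier (P\<lparr>carrier := a_kernel P K g\<rparr>).
        y \<oplus>\<^bsub>P\<lparr>carrier := a_kernel P K g\<rparr>\<^esub> x = \<zero>\<^bsub>P\<lparr>carrier := a_kernel P K g\<rparr>\<^esub>"
      using neg by (intro bexI[of _ "\<ominus>\<^bsub>P\<^esub> x"]) (simp_all add: ker P.M.l_neg)
  qed (simp_all add: ker g' g0 P.M.a_ac)
  then show ?thesis
    by (intro right_module.intro right_module_axioms.intro P.A.ring_axioms)
      (auto simp: ker g' P.act_closed P.act_add_ring P.act_add P.act_mult P.act_one)
qed

theorem projective_resolution_exists:
  fixes M :: "('x, 'm) module"
  assumes M: "right_module A M"
  shows "\<exists>(P :: nat \<Rightarrow> ('x, ('m, 'x) formal) module) d \<epsilon>. projective_resolution A M P d \<epsilon>"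
proof -
  define ok where "ok = (\<lambda>(K :: ('x, ('m, 'x) formal) module) (P :: ('x, ('m, 'x) formal) module) g.
    projective A P \<and> g \<in> rmod_hom A P K \<and> g ` carrier P = carrier K)"
  have "\<forall>K. \<exists>P g. right_module A K \<longrightarrow> ok K P g"
    unfolding ok_def using projective_cover_exists by blast
  then obtain PP gg where ok: "\<And>K. right_module A K \<Longrightarrow> ok K (PP K) (gg K)" by metis
  have inj: "inj_on Base (carrier M)" by (simp add: inj_on_def)
  note c = copy_rmod[OF M inj]
  define K where "K = rec_nat (copy_rmod Base M)
    (\<lambda>_ K. (PP K)\<lparr>carrier := a_kernel (PP K) K (gg K)\<rparr>)"
  have K0: "K 0 = copy_rmod Base M"
    and KS: "K (Suc n) = (PP (K n))\<lparr>carrier := a_kernel (PP (K n)) (K n) (gg (K n))\<rparr>" for n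
    by (simp_all add: K_def)
  have K: "right_module A (K n)" for n
  proof (induction n)
    case (Suc n)
    then show ?case unfolding KS
      using ok[OF Suc] by (intro kernel_right_module) (auto simp: ok_def projective_def)
  qed (simp add: K0 c)
  note ok' = ok[OF K, unfolded ok_def]
  have P: "right_module A (PP (K n))" for n using ok'[of n] by (simp add: projective_def)
  define d where "d n = gg (K (Suc n))" for n
  let ?i = "restrict (inv_into (carrier M) Base) (Base ` carrier M)"
  define \<epsilon> where "\<epsilon> = restrict (\<lambda>x. ?i (gg (K 0) x)) (carrier (PP (K 0)))"
  have car0: "carrier (K 0) = Base ` carrier M" by (simp add: K0 copy_rmod_def Let_def)
  have zero0: "\<zero>\<^bsub>K 0\<^esub> = Base \<zero>\<^bsub>M\<^esub>" by (simp add: K0 copy_rmod_def Let_def)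
  interpret M: right_module A M by fact
  have \<epsilon>_eq: "\<epsilon> x = m \<longleftrightarrow> gg (K 0) x = Base m" if "x \<in> carrier (PP (K 0))" "m \<in> carrier M" for x m
  proof -
    have "gg (K 0) x \<in> Base ` carrier M" using ok'[of 0] that car0 by auto
    then show ?thesis using that by (auto simp: \<epsilon>_def inv_into_f_f[OF inj])
  qed
  have im: "carrier (K (Suc n)) = a_kernel (PP (K n)) (K n) (gg (K n))" for n by (simp add: KS)
  have imd: "d n ` carrier (PP (K (Suc n))) = a_kernel (PP (K n)) (K n) (gg (K n))" for n
    using ok'[of "Suc n"] by (simp add: d_def im)
  have zeroS: "\<zero>\<^bsub>K (Suc n)\<^esub> = \<zero>\<^bsub>PP (K n)\<^esub>" for n by (simp add: KS)
  show ?thesis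
  proof (intro exI[of _ "\<lambda>n. PP (K n)"] exI[of _ d] exI[of _ \<epsilon>], unfold projective_resolution_def, intro conjI allI M)
    show "projective A (PP (K n))" for n using ok' by blast
    show e: "\<epsilon> \<in> rmod_hom A (PP (K 0)) M"
    proof -
      have g0: "gg (K 0) \<in> rmod_hom A (PP (K 0)) (copy_rmod Base M)"
        using ok'[of 0] by (simp add: K0)
      show ?thesis unfolding \<epsilon>_def by (rule rmod_hom_compose[OF g0 c(3) P])
    qed
    show "d n \<in> rmod_hom A (PP (K (Suc n))) (PP (K n))" for n
    proof -
      have "rmod_hom A L (K (Suc n)) \<subseteq> rmod_hom A L (PP (K n))" for L :: "('x, ('m, 'x) formal) module"
        by (auto simp: KS rmod_hom_def a_kernel_def kernel_def PiE_iff)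
      then show ?thesis using ok'[of "Suc n"] unfolding d_def by blast
    qed
    show "\<epsilon> ` carrier (PP (K 0)) = carrier M"
    proof (intro equalityI subsetI)
      fix m assume m: "m \<in> carrier M"
      then have "Base m \<in> gg (K 0) ` carrier (PP (K 0))" using ok'[of 0] car0 by auto
      then obtain x where x: "x \<in> carrier (PP (K 0))" "Base m = gg (K 0) x" by blast
      then have "\<epsilon> x = m" using \<epsilon>_eq[OF x(1) m] by simp
      then show "m \<in> \<epsilon> ` carrier (PP (K 0))" using x(1) by blast
    qed (use rmod_homD(1)[OF e] in auto)
    show "a_kernel (PP (K 0)) M \<epsilon> = d 0 ` carrier (PP (K 1))"
      using imd[of 0] \<epsilon>_eq zero0 by (auto simp: a_kernel_def kernel_def)
    show "a_kernel (PP (K (Suc n))) (PP (K n)) (d n) = d (Suc n) ` carrier (PP (K (Suc (Suc n))))" for n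
      unfolding imd by (auto simp: a_kernel_def kernel_def d_def zeroS)
  qed
qed


section \<open>Simple modules of the incidence algebra\<close>

text \<open>
  The class of a linear combination \<open>f\<close> of paths acts on the one-dimensional module at \<open>x\<close> as the
  coefficient of the trivial path at \<open>x\<close> in \<open>f\<close>.  In the absence of oriented cycles that coefficient
  vanishes on the parallel ideal, hence is constant on each coset.
\<close>

definition simple_module ::
    "'v \<Rightarrow> ((('v, 'e) path \<Rightarrow>\<^sub>0 'k::field) set, 'k) module" where
  "simple_module x =
     \<lparr>carrier = UNIV,
      monoid.mult = undefined,
      one = undefined,
      ring.zero = 0,
      add = (+),
      smult = (\<lambda>X t. t * the_elem ((\<lambda>f. Poly_Mapping.lookup f (x, [])) ` X))\<rparr>"


subsection \<open>Well-definedness of the incidence algebra and its simple modules\<close>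

lemma poly_mapping_sum_single: "f = (\<Sum>p\<in>Poly_Mapping.keys f. Poly_Mapping.single p (Poly_Mapping.lookup f p))" for f :: "'a \<Rightarrow>\<^sub>0 'k::field"
  by (rule poly_mapping_eqI) (simp add: lookup_sum lookup_single when_def in_keys_iff sum.delta')

lemma poly_mapping_single_induct:
  fixes f :: "'a \<Rightarrow>\<^sub>0 'k::field"
  assumes "Poly_Mapping.keys f \<subseteq> S" "P 0" "\<And>p c g. p \<in> S \<Longrightarrow> P g \<Longrightarrow> P (Poly_Mapping.single p c + g)"
  shows "P f"
proof -
  have "P (\<Sum>p\<in>K. Poly_Mapping.single p (Poly_Mapping.lookup f p))" if "finite K" "K \<subseteq> S" for K
    using that by (induction K) (auto intro: assms)
  then show ?thesis using poly_mapping_sum_single[of f] assms(1) by (metis finite_keys)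
qed

definition path_term where "path_term Q p q c = (if path_end Q q = path_start p then Poly_Mapping.single (fst q, snd q @ snd p) c else 0)"

lemma path_algebra_mult: "f \<otimes>\<^bsub>path_algebra Q\<^esub> g = (\<Sum>p\<in>Poly_Mapping.keys f. \<Sum>q\<in>Poly_Mapping.keys g. path_term Q p q (Poly_Mapping.lookup f p * Poly_Mapping.lookup g q))"
  by (simp add: path_algebra_def path_term_def)

lemma path_term_add: "path_term Q p q (c + d) = path_term Q p q c + path_term Q p q d" by (simp add: path_term_def single_add)
lemma path_term_zero [simp]: "path_term Q p q 0 = 0" by (simp add: path_term_def)

lemma path_algebra_l_distr: "(f + f') \<otimes>\<^bsub>path_algebra Q\<^esub> g = f \<otimes>\<^bsub>path_algebra Q\<^esub> g + f' \<otimes>\<^bsub>path_algebra Q\<^esub> g"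
  unfolding path_algebra_mult
  by (rule setsum_keys_plus_distrib) (simp_all add: distrib_right path_term_add sum.distrib)

lemma path_algebra_r_distr: "g \<otimes>\<^bsub>path_algebra Q\<^esub> (f + f') = g \<otimes>\<^bsub>path_algebra Q\<^esub> f + g \<otimes>\<^bsub>path_algebra Q\<^esub> f'"
  unfolding path_algebra_mult sum.distrib[symmetric]
  by (rule sum.cong[OF refl], rule setsum_keys_plus_distrib) (simp_all add: distrib_left path_term_add)

lemma path_algebra_mult_zero: "0 \<otimes>\<^bsub>path_algebra Q\<^esub> g = 0" "g \<otimes>\<^bsub>path_algebra Q\<^esub> 0 = 0"
  by (simp_all add: path_algebra_mult)

lemma path_algebra_mult_single: "Poly_Mapping.single p a \<otimes>\<^bsub>path_algebra Q\<^esub> Poly_Mapping.single q b = path_term Q p q (a * b)"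
  by (simp add: path_algebra_mult)

lemma paths_iff: "(x, p) \<in> paths Q \<longleftrightarrow> (\<exists>y. pre_digraph.awalk Q x p y)" by (simp add: paths_def)

context fin_digraph begin

lemma path_comp_closed: "\<lbrakk>p \<in> paths G; q \<in> paths G; path_end G q = path_start p\<rbrakk> \<Longrightarrow> (fst q, snd q @ snd p) \<in> paths G"
  by (cases p; cases q) (auto simp: paths_iff path_end_def path_start_def intro!: exI)

lemma path_end_comp: "path_end G q = path_start p \<Longrightarrow> path_end G (fst q, snd q @ snd p) = path_end G p"
  by (cases p) (simp add: path_end_def path_start_def awlast_append)

lemma path_end_in_verts: "q \<in> paths G \<Longrightarrow> path_end G q \<in> verts G"
  by (cases q) (auto simp: paths_iff path_end_def)

lemma path_algebra_carrier: "carrier (path_algebra G) = {f. Poly_Mapping.keys f \<subseteq> paths G}" 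
  and path_algebra_add_zero [simp]: "add (path_algebra G) = (+)" "\<zero>\<^bsub>path_algebra G\<^esub> = 0"
  and path_algebra_one: "\<one>\<^bsub>path_algebra G\<^esub> = (\<Sum>x\<in>verts G. Poly_Mapping.single (x, []) 1)"
  by (simp_all add: path_algebra_def)

lemma path_term_closed: "\<lbrakk>p \<in> paths G; q \<in> paths G\<rbrakk> \<Longrightarrow> Poly_Mapping.keys (path_term G p q c) \<subseteq> paths G"
  using path_comp_closed by (auto simp: path_term_def)

lemma path_term_assoc: "path_term G p q a \<otimes>\<^bsub>path_algebra G\<^esub> Poly_Mapping.single r b = Poly_Mapping.single p c \<otimes>\<^bsub>path_algebra G\<^esub> path_term G q r d"
   if "a * b = c * d"
  using that path_end_comp[of r q]
  by (auto simp: path_term_def path_algebra_mult_single path_algebra_mult_zero path_start_def path_end_comp)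

lemma path_algebra_l_one: "\<one>\<^bsub>path_algebra G\<^esub> \<otimes>\<^bsub>path_algebra G\<^esub> f = f" if "Poly_Mapping.keys f \<subseteq> paths G" for f :: "_ \<Rightarrow>\<^sub>0 'k::field"
  using that
proof (rule poly_mapping_single_induct)
  fix p and g :: "_ \<Rightarrow>\<^sub>0 'k" and c :: 'k assume p: "p \<in> paths G" and IH: "\<one>\<^bsub>path_algebra G\<^esub> \<otimes>\<^bsub>path_algebra G\<^esub> g = g"
  have "(\<Sum>x\<in>V. Poly_Mapping.single (x, []) 1) \<otimes>\<^bsub>path_algebra G\<^esub> Poly_Mapping.single p c = (if path_end G p \<in> V then Poly_Mapping.single p c else 0)"
    if "finite V" for V
    using that by (induction V) (auto simp: path_algebra_mult_zero path_algebra_l_distr path_algebra_mult_single path_term_def path_start_def)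
  from this[OF finite_verts] show "\<one>\<^bsub>path_algebra G\<^esub> \<otimes>\<^bsub>path_algebra G\<^esub> (Poly_Mapping.single p c + g) = Poly_Mapping.single p c + g"
    using IH path_end_in_verts[OF p] by (simp add: path_algebra_r_distr path_algebra_one)
qed (simp add: path_algebra_mult_zero)

lemma path_algebra_r_one: "f \<otimes>\<^bsub>path_algebra G\<^esub> \<one>\<^bsub>path_algebra G\<^esub> = f" if "Poly_Mapping.keys f \<subseteq> paths G" for f :: "_ \<Rightarrow>\<^sub>0 'k::field"
  using that
proof (rule poly_mapping_single_induct)
  fix p and g :: "_ \<Rightarrow>\<^sub>0 'k" and c :: 'k assume p: "p \<in> paths G" and IH: "g \<otimes>\<^bsub>path_algebra G\<^esub> \<one>\<^bsub>path_algebra G\<^esub> = g"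
  have "fst p \<in> verts G" using p by (cases p) (auto simp: paths_iff)
  have "Poly_Mapping.single p c \<otimes>\<^bsub>path_algebra G\<^esub> (\<Sum>x\<in>V. Poly_Mapping.single (x, []) 1) = (if fst p \<in> V then Poly_Mapping.single p c else 0)"
    if "finite V" for V
    using that by (induction V) (auto simp: path_algebra_mult_zero path_algebra_r_distr path_algebra_mult_single path_term_def path_start_def path_end_def)
  from this[OF finite_verts] show "(Poly_Mapping.single p c + g) \<otimes>\<^bsub>path_algebra G\<^esub> \<one>\<^bsub>path_algebra G\<^esub> = Poly_Mapping.single p c + g"
    using IH \<open>fst p \<in> verts G\<close> by (simp add: path_algebra_l_distr path_algebra_one)
qed (simp add: path_algebra_mult_zero)

lemma keys_sum_subset: "(\<And>i. i \<in> I \<Longrightarrow> Poly_Mapping.keys (b i) \<subseteq> S) \<Longrightarrow> Poly_Mapping.keys (sum b I) \<subseteq> S"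
  using keys_sum[of b I] by blast

lemma path_algebra_ring: "ring (path_algebra G :: ('k::field, _) module)"
proof (rule ringI)
  show "abelian_group (path_algebra G :: ('k::field, _) module)"
  proof (rule abelian_groupI)
    fix f :: "_ \<Rightarrow>\<^sub>0 'k" assume "f \<in> carrier (path_algebra G)"
    then show "\<exists>y\<in>carrier (path_algebra G). y \<oplus>\<^bsub>path_algebra G\<^esub> f = \<zero>\<^bsub>path_algebra G\<^esub>"
      by (intro bexI[of _ "- f"]) (auto simp: path_algebra_carrier)
  next
    fix f g :: "_ \<Rightarrow>\<^sub>0 'k" assume "f \<in> carrier (path_algebra G)" "g \<in> carrier (path_algebra G)"
    then show "f \<oplus>\<^bsub>path_algebra G\<^esub> g \<in> carrier (path_algebra G)" using keys_add[of f g] by (auto simp: path_algebra_carrier)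
  qed (auto simp: path_algebra_carrier algebra_simps)
  show "monoid (path_algebra G :: ('k::field, _) module)"
  proof (rule monoidI)
    fix f g :: "_ \<Rightarrow>\<^sub>0 'k" assume "f \<in> carrier (path_algebra G)" "g \<in> carrier (path_algebra G)"
    then show "f \<otimes>\<^bsub>path_algebra G\<^esub> g \<in> carrier (path_algebra G)"
      unfolding path_algebra_carrier path_algebra_mult by (intro CollectI keys_sum_subset path_term_closed) auto
  next
    show "\<one>\<^bsub>path_algebra G\<^esub> \<in> carrier (path_algebra G :: ('k::field, _) module)"
      unfolding path_algebra_one path_algebra_carrier by (auto intro!: keys_sum_subset simp: paths_iff awalk_Nil_iff)
  next
    fix f g h :: "_ \<Rightarrow>\<^sub>0 'k" assume *: "f \<in> carrier (path_algebra G)" "g \<in> carrier (path_algebra G)" "h \<in> carrier (path_algebra G)"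
    show "f \<otimes>\<^bsub>path_algebra G\<^esub> g \<otimes>\<^bsub>path_algebra G\<^esub> h = f \<otimes>\<^bsub>path_algebra G\<^esub> (g \<otimes>\<^bsub>path_algebra G\<^esub> h)"
    proof (rule poly_mapping_single_induct[of f UNIV], simp, simp add: path_algebra_mult_zero)
      fix p c and f' :: "_ \<Rightarrow>\<^sub>0 'k" assume f': "f' \<otimes>\<^bsub>path_algebra G\<^esub> g \<otimes>\<^bsub>path_algebra G\<^esub> h = f' \<otimes>\<^bsub>path_algebra G\<^esub> (g \<otimes>\<^bsub>path_algebra G\<^esub> h)"
      have "Poly_Mapping.single p c \<otimes>\<^bsub>path_algebra G\<^esub> g \<otimes>\<^bsub>path_algebra G\<^esub> h = Poly_Mapping.single p c \<otimes>\<^bsub>path_algebra G\<^esub> (g \<otimes>\<^bsub>path_algebra G\<^esub> h)"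
      proof (rule poly_mapping_single_induct[of g UNIV], simp, simp add: path_algebra_mult_zero)
        fix q d and g' :: "_ \<Rightarrow>\<^sub>0 'k" assume g': "Poly_Mapping.single p c \<otimes>\<^bsub>path_algebra G\<^esub> g' \<otimes>\<^bsub>path_algebra G\<^esub> h = Poly_Mapping.single p c \<otimes>\<^bsub>path_algebra G\<^esub> (g' \<otimes>\<^bsub>path_algebra G\<^esub> h)"
        have "Poly_Mapping.single p c \<otimes>\<^bsub>path_algebra G\<^esub> Poly_Mapping.single q d \<otimes>\<^bsub>path_algebra G\<^esub> h = Poly_Mapping.single p c \<otimes>\<^bsub>path_algebra G\<^esub> (Poly_Mapping.single q d \<otimes>\<^bsub>path_algebra G\<^esub> h)"
          by (rule poly_mapping_single_induct[of h UNIV], simp, simp add: path_algebra_mult_zero)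
            (simp add: path_algebra_r_distr path_algebra_mult_single, rule path_term_assoc, simp add: mult.assoc)
        with g' show "Poly_Mapping.single p c \<otimes>\<^bsub>path_algebra G\<^esub> (Poly_Mapping.single q d + g') \<otimes>\<^bsub>path_algebra G\<^esub> h = Poly_Mapping.single p c \<otimes>\<^bsub>path_algebra G\<^esub> ((Poly_Mapping.single q d + g') \<otimes>\<^bsub>path_algebra G\<^esub> h)"
          by (simp add: path_algebra_r_distr path_algebra_l_distr)
      qed
      with f' show "(Poly_Mapping.single p c + f') \<otimes>\<^bsub>path_algebra G\<^esub> g \<otimes>\<^bsub>path_algebra G\<^esub> h = (Poly_Mapping.single p c + f') \<otimes>\<^bsub>path_algebra G\<^esub> (g \<otimes>\<^bsub>path_algebra G\<^esub> h)"
        by (simp add: path_algebra_l_distr)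
    qed
  qed (auto simp: path_algebra_carrier path_algebra_l_one path_algebra_r_one)
qed (auto simp: path_algebra_l_distr path_algebra_r_distr)


definition trivial_coeff where "trivial_coeff x f = Poly_Mapping.lookup f (x, [])"

lemma trivial_coeff_add: "trivial_coeff x (f + g) = trivial_coeff x f + trivial_coeff x g" by (simp add: trivial_coeff_def lookup_add)
lemma trivial_coeff_single: "trivial_coeff x (Poly_Mapping.single p c) = (if p = (x, []) then c else 0)" by (simp add: trivial_coeff_def lookup_single when_def)

lemma trivial_coeff_mult: "trivial_coeff x (f \<otimes>\<^bsub>path_algebra G\<^esub> g) = trivial_coeff x f * trivial_coeff x g" for f :: "_ \<Rightarrow>\<^sub>0 'k::field"
proof (rule poly_mapping_single_induct[of f UNIV], simp, simp add: path_algebra_mult_zero trivial_coeff_def)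
  fix p c and f' :: "_ \<Rightarrow>\<^sub>0 'k" assume f': "trivial_coeff x (f' \<otimes>\<^bsub>path_algebra G\<^esub> g) = trivial_coeff x f' * trivial_coeff x g"
  have "trivial_coeff x (Poly_Mapping.single p c \<otimes>\<^bsub>path_algebra G\<^esub> g) = trivial_coeff x (Poly_Mapping.single p c) * trivial_coeff x g"
    by (rule poly_mapping_single_induct[of g UNIV], simp, simp add: path_algebra_mult_zero trivial_coeff_def)
      (cases p, auto simp: path_algebra_r_distr trivial_coeff_add path_algebra_mult_single path_term_def trivial_coeff_single path_end_def path_start_def distrib_left, auto simp: trivial_coeff_def)
  with f' show "trivial_coeff x ((Poly_Mapping.single p c + f') \<otimes>\<^bsub>path_algebra G\<^esub> g) = trivial_coeff x (Poly_Mapping.single p c + f') * trivial_coeff x g"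
    by (simp add: path_algebra_l_distr trivial_coeff_add distrib_right)
qed

abbreviation "gens \<equiv> {Poly_Mapping.single p 1 - Poly_Mapping.single q 1 | p q.
          p \<in> paths G \<and> q \<in> paths G \<and> path_start p = path_start q \<and> path_end G p = path_end G q}"

lemma parallel_ideal_ideal: "ideal (parallel_ideal G) (path_algebra G :: ('k::field, _) module)"
  unfolding parallel_ideal_def
  by (rule ring.genideal_ideal[OF path_algebra_ring])
    (auto simp: path_algebra_carrier dest!: set_mp[OF keys_diff])

lemma trivial_coeff_ideal: "ideal {f. Poly_Mapping.keys f \<subseteq> paths G \<and> trivial_coeff x f = 0} (path_algebra G :: ('k::field, _) module)" (is "ideal ?J ?R")
proof -
  interpret ring ?R by (rule path_algebra_ring)
  show ?thesis
  proof (rule idealI[OF path_algebra_ring])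
    show "subgroup ?J (add_monoid ?R)"
    proof (rule add.subgroupI)
      show "\<ominus>\<^bsub>?R\<^esub> f \<in> ?J" if f: "f \<in> ?J" for f
      proof -
        have "\<ominus>\<^bsub>?R\<^esub> f = - f" using f by (intro minus_equality) (auto simp: path_algebra_carrier)
        then show ?thesis using f by (auto simp: trivial_coeff_def)
      qed
    qed (auto simp: path_algebra_carrier trivial_coeff_add intro!: exI[of _ 0] dest!: set_mp[OF keys_add], auto simp: trivial_coeff_def)
  next
    fix a y assume "a \<in> ?J" "y \<in> carrier ?R"
    then show "y \<otimes>\<^bsub>?R\<^esub> a \<in> ?J" "a \<otimes>\<^bsub>?R\<^esub> y \<in> ?J"
      using m_closed[of y a] m_closed[of a y] by (auto simp: path_algebra_carrier trivial_coeff_mult)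
  qed
qed

lemma trivial_coeff_parallel_ideal:
  assumes "\<And>p. awalk x p x \<Longrightarrow> p = []"
  shows "f \<in> parallel_ideal G \<Longrightarrow> trivial_coeff x (f :: _ \<Rightarrow>\<^sub>0 'k::field) = 0"
proof -
  have *: "p = (x, [])" if "p \<in> paths G" "path_start p = x" "path_end G p = x" for p
    using that assms by (cases p) (auto simp: paths_iff path_end_def path_start_def)
  have e: "path_start (x, []) = x" "path_end G (x, []) = x" by (auto simp: path_start_def path_end_def)
  have "trivial_coeff x (Poly_Mapping.single p 1 - Poly_Mapping.single q 1 :: _ \<Rightarrow>\<^sub>0 'k) = 0"
    if "p \<in> paths G" "q \<in> paths G" "path_start p = path_start q" "path_end G p = path_end G q" for p q
  proof -
    have "p = (x, []) \<longleftrightarrow> q = (x, [])" using *[of p] *[of q] that e by metis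
    then show ?thesis by (simp add: trivial_coeff_def lookup_minus lookup_single when_def)
  qed
  then have "gens \<subseteq> {f. Poly_Mapping.keys f \<subseteq> paths G \<and> trivial_coeff x (f :: _ \<Rightarrow>\<^sub>0 'k) = 0}"
    by (auto dest!: set_mp[OF keys_diff])
  then have "parallel_ideal G \<subseteq> {f. Poly_Mapping.keys f \<subseteq> paths G \<and> trivial_coeff x (f :: _ \<Rightarrow>\<^sub>0 'k) = 0}"
    unfolding parallel_ideal_def by (rule ring.genideal_minimal[OF path_algebra_ring trivial_coeff_ideal])
  then show "f \<in> parallel_ideal G \<Longrightarrow> trivial_coeff x f = 0" by blast
qed

lemma incidence_algebra_ring: "ring (incidence_algebra G :: ('k::field, _) module)"
proof -
  let ?R = "path_algebra G :: ('k, _) module"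
  interpret I: ideal "parallel_ideal G" ?R by (rule parallel_ideal_ideal)
  have q: "ring (?R Quot parallel_ideal G)" by (rule I.quotient_is_ring)
  interpret Q: ring "?R Quot parallel_ideal G" by (rule q)
  show ?thesis
  proof (rule ringI)
    have e: "carrier (incidence_algebra G :: ('k, _) module) = carrier (?R Quot parallel_ideal G)"
       "\<zero>\<^bsub>incidence_algebra G :: ('k, _) module\<^esub> = \<zero>\<^bsub>?R Quot parallel_ideal G\<^esub>"
       "add (incidence_algebra G :: ('k, _) module) = add (?R Quot parallel_ideal G)" by (auto simp: incidence_algebra_def FactRing_def)
    show "abelian_group (incidence_algebra G :: ('k, _) module)"
      by (intro abelian_groupI; unfold e) (rule Q.a_closed Q.zero_closed Q.a_assoc Q.a_comm Q.l_zero | assumption | meson Q.a_inv_closed Q.l_neg)+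
    show "monoid (incidence_algebra G :: ('k, _) module)"
      by (intro monoidI)
       (use Q.m_closed Q.m_assoc Q.one_closed Q.l_one Q.r_one in \<open>auto simp: incidence_algebra_def FactRing_def\<close>)
  qed (use Q.l_distr Q.r_distr in \<open>auto simp: incidence_algebra_def FactRing_def\<close>)
qed

lemma simple_module_right_module:
  assumes "\<And>p. awalk x p x \<Longrightarrow> p = []" "x \<in> verts G"
  shows "right_module (incidence_algebra G :: ('k::field, _) module) (simple_module x)"
proof -
  let ?R = "path_algebra G :: ('k, _) module"
  let ?I = "parallel_ideal G :: (_ \<Rightarrow>\<^sub>0 'k) set"
  let ?S = "simple_module x :: ((('a, 'b) path \<Rightarrow>\<^sub>0 'k) set, 'k) module"
  let ?A = "incidence_algebra G :: ('k, _) module"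
  interpret I: ideal ?I ?R by (rule parallel_ideal_ideal)
  have act: "(?I +>\<^bsub>?R\<^esub> f) \<odot>\<^bsub>?S\<^esub> t = t * trivial_coeff x f" for f t
  proof -
    have "(\<lambda>f. Poly_Mapping.lookup f (x, [])) ` (?I +>\<^bsub>?R\<^esub> f) = {trivial_coeff x f}"
    proof -
      have "?I +>\<^bsub>?R\<^esub> f = (\<lambda>h. h + f) ` ?I" by (auto simp: a_r_coset_def')
      then have "(\<lambda>f. Poly_Mapping.lookup f (x, [])) ` (?I +>\<^bsub>?R\<^esub> f) = (\<lambda>h. trivial_coeff x h + trivial_coeff x f) ` ?I"
        by (simp add: image_image trivial_coeff_def lookup_add)
      also have "\<dots> = (\<lambda>_. trivial_coeff x f) ` ?I" by (rule image_cong) (simp_all add: trivial_coeff_parallel_ideal[OF assms(1)])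
      also have "\<dots> = {trivial_coeff x f}" using additive_subgroup.zero_closed[OF I.additive_subgroup_axioms] by auto
      finally show ?thesis .
    qed
    then show ?thesis by (simp add: simple_module_def)
  qed
  have one: "trivial_coeff x (\<one>\<^bsub>?R\<^esub>) = 1"
    using assms(2) by (simp add: path_algebra_one trivial_coeff_def lookup_sum lookup_single when_def sum.delta)
  have cosE: "\<exists>f. X = ?I +>\<^bsub>?R\<^esub> f \<and> f \<in> carrier ?R" if "X \<in> carrier ?A" for X
    using that by (auto simp: incidence_algebra_def A_RCOSETS_def')
  have S: "carrier ?S = UNIV" "add ?S = (+)" by (auto simp: simple_module_def)
  have ag: "abelian_group ?S"
    by (rule abelian_groupI) (auto simp: simple_module_def intro: exI[of _ "- _"])
  show ?thesis
  proof (intro right_module.intro incidence_algebra_ring ag right_module_axioms.intro)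
    fix X Y t assume "X \<in> carrier ?A" "Y \<in> carrier ?A"
    then obtain f g where fg: "X = ?I +>\<^bsub>?R\<^esub> f" "f \<in> carrier ?R" "Y = ?I +>\<^bsub>?R\<^esub> g" "g \<in> carrier ?R"
      using cosE by meson
    have 1: "X \<oplus>\<^bsub>?A\<^esub> Y = ?I +>\<^bsub>?R\<^esub> (f + g)"
      using fg I.a_rcos_sum by (simp add: incidence_algebra_def)
    have 2: "X \<otimes>\<^bsub>?A\<^esub> Y = ?I +>\<^bsub>?R\<^esub> (f \<otimes>\<^bsub>?R\<^esub> g)"
      using fg I.rcoset_mult_add by (simp add: incidence_algebra_def)
    show "(X \<oplus>\<^bsub>?A\<^esub> Y) \<odot>\<^bsub>?S\<^esub> t = X \<odot>\<^bsub>?S\<^esub> t \<oplus>\<^bsub>?S\<^esub> Y \<odot>\<^bsub>?S\<^esub> t"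
      unfolding 1 unfolding fg act by (simp add: S trivial_coeff_add distrib_left)
    show "(X \<otimes>\<^bsub>?A\<^esub> Y) \<odot>\<^bsub>?S\<^esub> t = Y \<odot>\<^bsub>?S\<^esub> (X \<odot>\<^bsub>?S\<^esub> t)"
      unfolding 2 unfolding fg act by (simp add: trivial_coeff_mult)
  next
    fix X s t assume "X \<in> carrier ?A"
    then obtain f where fg: "X = ?I +>\<^bsub>?R\<^esub> f" using cosE by meson
    show "X \<odot>\<^bsub>?S\<^esub> (s \<oplus>\<^bsub>?S\<^esub> t) = X \<odot>\<^bsub>?S\<^esub> s \<oplus>\<^bsub>?S\<^esub> X \<odot>\<^bsub>?S\<^esub> t"
      unfolding fg act by (simp add: S distrib_right)
  next
    fix t show "\<one>\<^bsub>?A\<^esub> \<odot>\<^bsub>?S\<^esub> t = t"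
      using act[of "\<one>\<^bsub>?R\<^esub>"] one by (simp add: incidence_algebra_def)
  qed (simp add: S)
qed

end

end

theory Submission
  imports Defs
begin

text \<open>
  Both sides of the isomorphism are the cohomology of the nerve of the poset \<open>Q\<^sub>0\<close>: cochains are the
  scalar functions on chains \<open>x\<^sub>0 \<le> \<dots> \<le> x\<^sub>n\<close> of vertices, repetitions allowed, and the coboundary is the
  alternating sum over the deletions of one entry.

  The class of a path depends only on its end points, so the incidence algebra has a basis
  \<open>e\<^sub>x\<^sub>y\<close> with \<open>x \<le> y\<close>, and these basis elements multiply like matrix units
  (\<open>incidence_algebra_coordinates\<close>).  A Hochschild cochain is determined by the coefficients of its
  values at lists of basis elements.  Lists that compose from \<open>u\<close> to \<open>v\<close>, with coefficient taken at
  \<open>(u, v)\<close>, are chains; to keep these coefficients only is a projection of the Hochschild complex onto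
  the complex of the nerve.  It is homotopic to the identity by the operator that inserts an idempotent
  after each composable initial segment (\<open>bar_contraction_homotopy\<close>).  This is the classical passage to
  cochains relative to the separable subalgebra spanned by the idempotents, and yields
  \<open>HH_isomorphic_chain_cohomology\<close>.

  In the extended quiver \<open>a\<close> lies below and \<open>b\<close> lies above all vertices of \<open>Q\<close>.  The simple module at \<open>a\<close>
  is resolved by direct sums of projectives \<open>e\<^sub>x A\<close> indexed by chains \<open>a < x\<^sub>1 \<le> \<dots> \<le> x\<^sub>m = x\<close> in which \<open>b\<close>
  occurs at most once (\<open>bar_resolution\<close>); repeating the vertex at which an element lives is a contraction.
  A homomorphism to the simple module at \<open>b\<close> is determined by its values at the chains that end in \<open>b\<close>.
  In degree \<open>n + 2\<close> their inner parts are the chains \<open>x\<^sub>1 \<le> \<dots> \<le> x\<^sub>n\<^sub>+\<^sub>1\<close> of \<open>Q\<close>, and the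
  coboundary is that of the nerve up to sign (\<open>chain_cohomology_isomorphic_Ext\<close>).  Since \<open>Ext\<close> is defined
  by an arbitrary projective resolution, the comparison theorem \<open>Ext_independent_of_resolution\<close> connects
  it with this one.  For \<open>n \<ge> 1\<close> all chains involved are nonempty, so no augmentation interferes.
\<close>

section \<open>Alternating sums over deletions and contractions\<close>

text \<open>
  The alternating sum of \<open>c\<close> over the lists obtained by deleting one entry, beginning with the first: the
  simplicial coboundary.  The recursion moves entries that are kept into \<open>c\<close>, which reduces all the
  simplicial identities to short inductions.
\<close>

fun deletions :: "('a list \<Rightarrow> 'k::comm_ring_1) \<Rightarrow> 'a list \<Rightarrow> 'k" where
  "deletions c [] = 0"
| "deletions c (x # xs) = c xs - deletions (\<lambda>ys. c (x # ys)) xs"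

text \<open>
  The inner part of the Hochschild coboundary in terms of matrix units: a pair \<open>(x, y)\<close> stands for the
  class of the paths from \<open>y\<close> to \<open>x\<close>, and the product of two adjacent pairs vanishes unless their inner
  vertices agree.  As in the Hochschild formula the first contraction carries the sign \<open>-1\<close>.
\<close>

fun contractions :: "(('v \<times> 'v) list \<Rightarrow> 'k::comm_ring_1) \<Rightarrow> ('v \<times> 'v) list \<Rightarrow> 'k" where
  "contractions G (p # q # ps) =
     - (if snd p = fst q then G ((fst p, snd q) # ps) else 0) - contractions (\<lambda>rs. G (p # rs)) (q # ps)"
| "contractions G _ = 0"

lemma deletions_cong:
  assumes "\<And>ys zs x. xs = ys @ x # zs \<Longrightarrow> c (ys @ zs) = c' (ys @ zs)"
  shows "deletions c xs = deletions c' xs"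
  using assms
proof (induction xs arbitrary: c c')
  case (Cons x xs)
  have "deletions (\<lambda>ys. c (x # ys)) xs = deletions (\<lambda>ys. c' (x # ys)) xs"
  proof (rule Cons.IH)
    fix ys zs y assume "xs = ys @ y # zs"
    then show "c (x # ys @ zs) = c' (x # ys @ zs)" using Cons.prems[of "x # ys" y zs] by simp
  qed
  moreover have "c xs = c' xs" using Cons.prems[of "[]" x xs] by simp
  ultimately show ?case by simp
qed simp

lemma deletions_zero [simp]: "deletions (\<lambda>_. 0) xs = 0"
  by (induction xs) auto

lemma deletions_diff: "deletions (\<lambda>ys. c ys - c' ys) xs = deletions c xs - deletions c' xs"
  by (induction xs arbitrary: c c') (auto simp: algebra_simps)

lemma deletions_add: "deletions (\<lambda>ys. c ys + c' ys) xs = deletions c xs + deletions c' xs"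
  by (induction xs arbitrary: c c') (auto simp: algebra_simps)

lemma deletions_scale: "deletions (\<lambda>ys. r * c ys) xs = r * deletions c xs"
  by (induction xs arbitrary: c) (auto simp: algebra_simps)

lemma deletions_sum: "deletions (\<lambda>ys. \<Sum>i\<in>I. c i ys) xs = (\<Sum>i\<in>I. deletions (c i) xs)"
  by (induction I rule: infinite_finite_induct) (auto simp: deletions_add)

lemma deletions_deletions: "deletions (deletions c) xs = 0"
proof (induction xs arbitrary: c)
  case (Cons x xs)
  show ?case by (simp add: deletions_diff Cons.IH)
qed simp

lemma deletions_snoc:
  "deletions c (xs @ [y]) = deletions (\<lambda>zs. c (zs @ [y])) xs + (- 1) ^ length xs * c xs"
  by (induction xs arbitrary: c) auto

text \<open>
  Reversal exchanges the order in which entries are deleted, hence only changes the sign.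
\<close>

lemma deletions_rev:
  fixes c :: "'a list \<Rightarrow> 'k::comm_ring_1"
  shows "deletions (\<lambda>ys. c (rev ys)) xs = - ((- 1) ^ length xs * deletions c (rev xs))"
proof (induction xs arbitrary: c)
  case (Cons x xs)
  have "deletions (\<lambda>ys. c (rev ys @ [x])) xs = - ((- 1) ^ length xs * deletions (\<lambda>zs. c (zs @ [x])) (rev xs))"
    using Cons.IH[of "\<lambda>zs. c (zs @ [x])"] by simp
  moreover have "(- 1) ^ length xs * (- 1) ^ length xs = (1 :: 'k)"
    by (simp flip: power_mult_distrib)
  ultimately show ?case by (simp add: deletions_snoc distrib_left mult.assoc[symmetric])
qed simp

lemma deletions_map: "deletions (\<lambda>ys. c (map f ys)) xs = deletions c (map f xs)"
proof (induction xs arbitrary: c)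
  case (Cons x xs)
  show ?case using Cons.IH[of "\<lambda>ys. c (f x # ys)"] by simp
qed simp

lemma contractions_cong:
  assumes "\<And>ys zs p q. ps = ys @ p # q # zs \<Longrightarrow> snd p = fst q \<Longrightarrow>
     G (ys @ (fst p, snd q) # zs) = G' (ys @ (fst p, snd q) # zs)"
  shows "contractions G ps = contractions G' ps"
  using assms
proof (induction G ps arbitrary: G' rule: contractions.induct)
  case (1 G p q ps)
  have "contractions (\<lambda>rs. G (p # rs)) (q # ps) = contractions (\<lambda>rs. G' (p # rs)) (q # ps)"
  proof (rule "1.IH")
    fix ys zs x y assume "q # ps = ys @ x # y # zs" "snd x = fst y"
    then show "G (p # ys @ (fst x, snd y) # zs) = G' (p # ys @ (fst x, snd y) # zs)" using "1.prems"[of "p # ys" x y zs] by simp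
  qed
  moreover have "snd p = fst q \<Longrightarrow> G ((fst p, snd q) # ps) = G' ((fst p, snd q) # ps)" using "1.prems"[of "[]" p q ps] by simp
  ultimately show ?case by simp
qed simp_all

lemma contractions_zero [simp]: "contractions (\<lambda>_. 0) ps = 0"
  by (induction ps rule: induct_list012) auto

lemma contractions_diff: "contractions (\<lambda>rs. G rs - G' rs) ps = contractions G ps - contractions G' ps"
  by (induction G ps arbitrary: G' rule: contractions.induct) (auto simp: algebra_simps)

lemma contractions_uminus: "contractions (\<lambda>rs. - G rs) ps = - contractions G ps"
  by (induction G ps rule: contractions.induct) (auto simp: algebra_simps)

lemma contractions_add: "contractions (\<lambda>rs. G rs + G' rs) ps = contractions G ps + contractions G' ps"
  using contractions_diff[of G "\<lambda>rs. - G' rs" ps] by (simp add: contractions_uminus)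

lemma contractions_if: "contractions (\<lambda>rs. if P then G rs else 0) ps = (if P then contractions G ps else 0)"
  by auto

text \<open>
  Associativity of the product of pairs: contracting the list and then \<open>p\<close> with its head is the same as
  contracting after \<open>p\<close> has been absorbed.
\<close>

lemma contractions_contract_head:
  "contractions (\<lambda>xs. case xs of [] \<Rightarrow> 0 | x # xs \<Rightarrow> if snd p = fst x then G ((fst p, snd x) # xs) else 0) (q # ps) =
   (if snd p = fst q then contractions G ((fst p, snd q) # ps) else 0)"
  by (cases ps) auto

text \<open>
  Contractions at disjoint places cancel in pairs; overlapping ones, at three successive entries, cancel by
  associativity.
\<close>

lemma contractions_contractions: "contractions (contractions G) ps = 0"
proof (induction ps arbitrary: G rule: length_induct)
  case (1 ps)
  consider "length ps < 2" | p q rs where "ps = p # q # rs" by (cases ps; cases "tl ps") auto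
  then show ?case
  proof cases
    case 1 then show ?thesis by (cases ps; cases "tl ps") auto
  next
    case (2 p q rs)
    define A where "A = (\<lambda>xs. case xs of [] \<Rightarrow> 0 | x # xs \<Rightarrow> if snd p = fst x then G ((fst p, snd x) # xs) else 0)"
    have *: "contractions (\<lambda>xs. contractions G (p # xs)) (q # rs) =
      contractions (\<lambda>xs. - A xs - contractions (\<lambda>xs. G (p # xs)) xs) (q # rs)"
    proof (rule contractions_cong)
      fix ys zs x y
      show "contractions G (p # ys @ (fst x, snd y) # zs) = - A (ys @ (fst x, snd y) # zs) - contractions (\<lambda>xs. G (p # xs)) (ys @ (fst x, snd y) # zs)"
        by (cases ys) (auto simp: A_def)
    qed
    have "contractions (contractions (\<lambda>xs. G (p # xs))) (q # rs) = 0" using 1 2 by simp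
    then have "contractions (\<lambda>xs. contractions G (p # xs)) (q # rs) = - contractions A (q # rs)"
      unfolding * contractions_diff contractions_uminus by simp
    then show ?thesis unfolding 2 by (simp add: A_def contractions_contract_head)
  qed
qed

text \<open>
  A coefficient function \<open>F ps u v\<close>, standing for the coefficient at \<open>(u, v)\<close> of the value of an
  \<open>n\<close>-cochain at the pairs \<open>ps\<close>, becomes a function of \<open>n + 2\<close> pairs: the outer two pairs play the role
  of the outer tensor factors of the bar construction, of which only the inner end points matter.  In
  this form the Hochschild coboundary consists of contractions alone.
\<close>

definition bar_extend :: "(('v \<times> 'v) list \<Rightarrow> 'v \<Rightarrow> 'v \<Rightarrow> 'k::comm_ring_1) \<Rightarrow> ('v \<times> 'v) list \<Rightarrow> 'k" where
  "bar_extend F qs = (if length qs < 2 then 0 else F (butlast (tl qs)) (snd (hd qs)) (fst (last qs)))"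

definition bar_coboundary ::
   "(('v \<times> 'v) list \<Rightarrow> 'v \<Rightarrow> 'v \<Rightarrow> 'k::comm_ring_1) \<Rightarrow> ('v \<times> 'v) list \<Rightarrow> 'v \<Rightarrow> 'v \<Rightarrow> 'k" where
  "bar_coboundary F ps u v = - contractions (bar_extend F) ((u, u) # ps @ [(v, v)])"

text \<open>
  The two faces of the Hochschild coboundary that multiply the value of the cochain by an argument, in
  terms of coefficients.
\<close>

definition left_face ::
   "(('v \<times> 'v) list \<Rightarrow> 'v \<Rightarrow> 'v \<Rightarrow> 'k::comm_ring_1) \<Rightarrow> ('v \<times> 'v) list \<Rightarrow> 'v \<Rightarrow> 'v \<Rightarrow> 'k" where
  "left_face F ps u v = (if ps \<noteq> [] \<and> fst (hd ps) = u then F (tl ps) (snd (hd ps)) v else 0)"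

definition right_face ::
   "(('v \<times> 'v) list \<Rightarrow> 'v \<Rightarrow> 'k::comm_ring_1) \<Rightarrow> ('v \<times> 'v) list \<Rightarrow> 'v \<Rightarrow> 'k" where
  "right_face G ps v = (if ps \<noteq> [] \<and> snd (last ps) = v then (- 1) ^ length ps * G (butlast ps) (fst (last ps)) else 0)"

lemma right_face_Cons:
  "ps \<noteq> [] \<Longrightarrow> right_face G (p # ps) v = - right_face (\<lambda>rs. G (p # rs)) ps v"
  by (auto simp: right_face_def)

lemma contractions_snoc:
  assumes "ps \<noteq> []"
  shows "contractions G (ps @ [(v, w)]) = contractions (\<lambda>rs. G (rs @ [(v, w)])) ps
     + right_face (\<lambda>rs x. G (rs @ [(x, w)])) ps v"
  using assms
proof (induction ps arbitrary: G rule: induct_list012)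
  case (2 p) then show ?case by (auto simp: right_face_def)
next
  case (3 p q ps)
  then have "contractions (\<lambda>rs. G (p # rs)) ((q # ps) @ [(v, w)]) =
     contractions (\<lambda>rs. G (p # rs @ [(v, w)])) (q # ps) + right_face (\<lambda>rs x. G (p # rs @ [(x, w)])) (q # ps) v"
    by simp
  then show ?case by (simp add: right_face_Cons)
qed simp

text \<open>
  Contracting at the left and right ends of the extended list gives the two outer faces, contracting
  elsewhere the inner ones.
\<close>

lemma bar_coboundary_split:
  assumes "ps \<noteq> []"
  shows "bar_coboundary F ps u v =
    left_face F ps u v + contractions (\<lambda>rs. F rs u v) ps + right_face (\<lambda>rs w. F rs u w) ps v"
proof -
  obtain p qs where ps: "ps = p # qs" using assms by (cases ps) auto
  have "contractions (\<lambda>rs. bar_extend F ((u, u) # rs)) (ps @ [(v, v)])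
     = contractions (\<lambda>rs. F rs u v) ps + right_face (\<lambda>rs w. F rs u w) ps v"
    by (subst contractions_snoc[OF assms]) (simp add: bar_extend_def butlast_append)
  then show ?thesis
    unfolding bar_coboundary_def ps by (simp add: left_face_def bar_extend_def)
qed

text \<open>
  Since the coboundary is a single family of contractions on extended lists, this is
  \<open>contractions_contractions\<close>.
\<close>

lemma bar_coboundary_bar_coboundary: "bar_coboundary (bar_coboundary F) ps u v = 0"
proof -
  have *: "bar_extend (bar_coboundary F) (p # rs @ [q]) = - contractions (bar_extend F) (p # rs @ [q])" for p q rs
  proof -
    have "contractions (bar_extend F) ((snd p, snd p) # rs @ [(fst q, fst q)]) = contractions (bar_extend F) (p # rs @ [q])"
    proof (cases rs)
      case Nil then show ?thesis by (simp add: bar_extend_def)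
    next
      case (Cons r rs')
      then have "rs \<noteq> []" by simp
      have 1: "contractions (\<lambda>xs. bar_extend F (p # xs)) (rs @ [q]) = contractions (\<lambda>rs. F rs (snd p) (fst q)) rs + right_face (\<lambda>rs w. F rs (snd p) w) rs (fst q)" for p q
        using contractions_snoc[OF \<open>rs \<noteq> []\<close>, of "\<lambda>xs. bar_extend F (p # xs)" "fst q" "snd q"]
        by (simp add: bar_extend_def butlast_append)
      show ?thesis using 1[of "(snd p, snd p)" "(fst q, fst q)"] 1[of p q] Cons by (simp add: bar_extend_def)
    qed
    then show ?thesis by (simp add: bar_extend_def bar_coboundary_def butlast_append)
  qed
  have "contractions (bar_extend (bar_coboundary F)) ((u, u) # ps @ [(v, v)]) =
     contractions (\<lambda>qs. - contractions (bar_extend F) qs) ((u, u) # ps @ [(v, v)])"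
  proof (rule contractions_cong)
    fix ys zs p q assume **: "(u, u) # ps @ [(v, v)] = ys @ p # q # zs"
    let ?qs = "ys @ (fst p, snd q) # zs"
    show "bar_extend (bar_coboundary F) ?qs = - contractions (bar_extend F) ?qs"
    proof (cases "length ?qs < 2")
      case True
      then have "ys = []" "zs = []" by auto
      then show ?thesis using ** by (auto simp: bar_extend_def bar_coboundary_def)
    next
      case False
      then obtain x rs y where "?qs = x # rs @ [y]" 
        by (cases ?qs rule: list.exhaust; cases "tl ?qs" rule: rev_exhaust) auto
      then show ?thesis using * by simp
    qed
  qed
  then show ?thesis unfolding bar_coboundary_def[of "bar_coboundary F"] by (simp add: contractions_uminus contractions_contractions)
qed

text \<open>
  The alternating sum, over the composable prefixes of the list that start at \<open>t\<close>, of the values at the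
  list with the identity pair of its end point inserted after the prefix.  The empty prefix always counts,
  and its end point is \<open>t\<close>.
\<close>

fun bar_homotopy :: "(('v \<times> 'v) list \<Rightarrow> 'k::comm_ring_1) \<Rightarrow> 'v \<Rightarrow> ('v \<times> 'v) list \<Rightarrow> 'k" where
  "bar_homotopy G t [] = G [(t, t)]"
| "bar_homotopy G t (q # qs) = G ((t, t) # q # qs) - (if fst q = t then bar_homotopy (\<lambda>rs. G (q # rs)) (snd q) qs else 0)"

fun composable :: "'v \<Rightarrow> ('v \<times> 'v) list \<Rightarrow> 'v \<Rightarrow> bool" where
  "composable u [] v \<longleftrightarrow> u = v"
| "composable u (p # ps) v \<longleftrightarrow> fst p = u \<and> composable (snd p) ps v"

lemma bar_homotopy_zero [simp]: "bar_homotopy (\<lambda>_. 0) t ps = 0"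
  by (induction ps arbitrary: t) auto

lemma bar_homotopy_add: "bar_homotopy (\<lambda>rs. G rs + G' rs) t ps = bar_homotopy G t ps + bar_homotopy G' t ps"
  by (induction ps arbitrary: t G G') (auto simp: algebra_simps)

lemma bar_homotopy_diff: "bar_homotopy (\<lambda>rs. G rs - G' rs) t ps = bar_homotopy G t ps - bar_homotopy G' t ps"
  by (induction ps arbitrary: t G G') (auto simp: algebra_simps)

lemma bar_homotopy_uminus: "bar_homotopy (\<lambda>rs. - G rs) t ps = - bar_homotopy G t ps"
  by (induction ps arbitrary: t G) (auto simp: algebra_simps)

lemma bar_homotopy_cong:
  assumes "\<And>ys zs x. ps = ys @ zs \<Longrightarrow> x = (if ys = [] then t else snd (last ys)) \<Longrightarrow> G (ys @ (x, x) # zs) = G' (ys @ (x, x) # zs)"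
  shows "bar_homotopy G t ps = bar_homotopy G' t ps"
  using assms
proof (induction ps arbitrary: G G' t)
  case Nil then show ?case using Nil[of "[]" "[]"] by simp
next
  case (Cons p ps)
  have "bar_homotopy (\<lambda>rs. G (p # rs)) (snd p) ps = bar_homotopy (\<lambda>rs. G' (p # rs)) (snd p) ps"
  proof (rule Cons.IH)
    fix ys zs x assume "ps = ys @ zs" "x = (if ys = [] then snd p else snd (last ys))"
    then show "G (p # ys @ (x, x) # zs) = G' (p # ys @ (x, x) # zs)" using Cons.prems[of "p # ys" zs x] by (auto split: if_splits)
  qed
  then show ?case using Cons.prems[of "[]" "p # ps" t] by simp
qed

text \<open>
  Contracting the inserted identity with a neighbour restores the list; the contraction on its left and
  the one on its right, for the next longer prefix, have opposite signs.  All other contractions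
  commute with the insertion up to the sign caused by the shift of the position.
\<close>

lemma bar_homotopy_contractions:
  "bar_homotopy (contractions G) t ps = - contractions (bar_homotopy G t) ps"
proof (induction ps arbitrary: G t rule: length_induct)
  case (1 ps)
  consider "ps = []" | p where "ps = [p]" | p q rs where "ps = p # q # rs" by (cases ps; cases "tl ps") auto
  then show ?case
  proof cases
    case (3 p q rs)
    have IH: "bar_homotopy (contractions (\<lambda>rs. G (p # rs))) (snd p) (q # rs) = - contractions (bar_homotopy (\<lambda>rs. G (p # rs)) (snd p)) (q # rs)"
      using 1 3 by (simp del: bar_homotopy.simps contractions.simps)
    define A where "A = (\<lambda>xs. case xs of [] \<Rightarrow> 0 | x # xs \<Rightarrow> if snd p = fst x then G ((fst p, snd x) # xs) else 0)"
    \<comment> \<open>\<open>A\<close> contracts \<open>p\<close> with the head of the list.\<close>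
    have "bar_homotopy (\<lambda>xs. contractions G (p # xs)) (snd p) (q # rs) =
       bar_homotopy (\<lambda>xs. - A xs - contractions (\<lambda>xs. G (p # xs)) xs) (snd p) (q # rs)"
    proof (rule bar_homotopy_cong)
      fix ys zs x
      show "contractions G (p # ys @ (x, x) # zs) = - A (ys @ (x, x) # zs) - contractions (\<lambda>xs. G (p # xs)) (ys @ (x, x) # zs)"
        by (cases ys) (auto simp: A_def)
    qed
    also have "\<dots> = - bar_homotopy A (snd p) (q # rs) + contractions (bar_homotopy (\<lambda>rs. G (p # rs)) (snd p)) (q # rs)"
      unfolding bar_homotopy_diff bar_homotopy_uminus IH by (simp del: bar_homotopy.simps contractions.simps)
    finally have 2: "bar_homotopy (\<lambda>xs. contractions G (p # xs)) (snd p) (q # rs) = \<dots>" .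
    have A: "bar_homotopy A (snd p) (q # rs) = G ((fst p, snd p) # q # rs) -
        (if fst q = snd p then bar_homotopy (\<lambda>xs. G ((fst p, snd q) # xs)) (snd q) rs else 0)"
      by (simp add: A_def)
    have c: "contractions (\<lambda>xs. bar_homotopy G t (p # xs)) (q # rs) =
       contractions (\<lambda>xs. G ((t, t) # p # xs)) (q # rs) - 
       (if fst p = t then contractions (bar_homotopy (\<lambda>rs. G (p # rs)) (snd p)) (q # rs) else 0)"
      unfolding bar_homotopy.simps contractions_diff contractions_if ..
    have "bar_homotopy (contractions G) t (p # q # rs) = contractions G ((t, t) # p # q # rs) -
        (if fst p = t then bar_homotopy (\<lambda>xs. contractions G (p # xs)) (snd p) (q # rs) else 0)"
      by (rule bar_homotopy.simps)
    moreover have "contractions G ((t, t) # p # q # rs) = - (if t = fst p then G ((t, snd p) # q # rs) else 0) +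
        (if snd p = fst q then G ((t, t) # (fst p, snd q) # rs) else 0) + contractions (\<lambda>xs. G ((t, t) # p # xs)) (q # rs)"
      by (simp del: contractions.simps add: contractions.simps(1)[of _ _ p] contractions.simps(1)[of _ p])
    moreover have "contractions (bar_homotopy G t) (p # q # rs) =
        - (if snd p = fst q then bar_homotopy G t ((fst p, snd q) # rs) else 0) - contractions (\<lambda>xs. bar_homotopy G t (p # xs)) (q # rs)"
      by (rule contractions.simps)
    moreover have "bar_homotopy G t ((fst p, snd q) # rs) = G ((t, t) # (fst p, snd q) # rs) -
        (if fst p = t then bar_homotopy (\<lambda>xs. G ((fst p, snd q) # xs)) (snd q) rs else 0)"
      by simp
    ultimately show ?thesis unfolding \<open>ps = _\<close> 2 A c
      by (auto simp del: contractions.simps bar_homotopy.simps)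
  qed auto
qed

text \<open>
  The outer left face sees the identity inserted after the empty prefix, and there returns \<open>F\<close> itself.
\<close>

lemma bar_homotopy_left_face:
  "bar_homotopy (\<lambda>rs. left_face F rs u v) u ps =
    F ps u v - left_face (\<lambda>rs w v. bar_homotopy (\<lambda>rs. F rs w v) w rs) ps u v"
  by (cases ps) (auto simp: left_face_def)

text \<open>
  The outer right face sees the identity only when it was inserted at the very end, which happens for
  lists that are composable as a whole.
\<close>

lemma bar_homotopy_right_face:
  "bar_homotopy (\<lambda>rs. right_face G rs v) t ps + right_face (\<lambda>rs w. bar_homotopy (\<lambda>xs. G xs w) t rs) ps v
    = - (if composable t ps v then G ps v else 0)"
proof (induction ps arbitrary: G t)
  case Nil then show ?case by (auto simp: right_face_def)
next
  case (Cons q qs)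
  have 1: "bar_homotopy (\<lambda>rs. right_face G (q # rs) v) (snd q) qs = bar_homotopy (\<lambda>rs. - right_face (\<lambda>xs. G (q # xs)) rs v) (snd q) qs"
    by (rule bar_homotopy_cong) (simp add: right_face_Cons)
  show ?case
  proof (cases "qs = []")
    case True then show ?thesis by (auto simp: right_face_def)
  next
    case False
    have 2: "right_face (\<lambda>rs w. bar_homotopy (\<lambda>xs. G xs w) t rs) (q # qs) v =
       - right_face (\<lambda>rs w. G ((t, t) # q # rs) w) qs v + (if fst q = t then right_face (\<lambda>rs w. bar_homotopy (\<lambda>xs. G (q # xs) w) (snd q) rs) qs v else 0)"
      by (simp add: right_face_Cons False) (auto simp: right_face_def algebra_simps)
    have 3: "bar_homotopy (\<lambda>rs. right_face (\<lambda>xs. G (q # xs)) rs v) (snd q) qs =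
       - (if composable (snd q) qs v then G (q # qs) v else 0) - right_face (\<lambda>rs w. bar_homotopy (\<lambda>xs. G (q # xs) w) (snd q) rs) qs v"
      using Cons.IH[of "\<lambda>xs. G (q # xs)" "snd q"] by (simp add: eq_diff_eq)
    show ?thesis using False
      by (simp add: 1 2 3 bar_homotopy_uminus right_face_Cons)
  qed
qed

text \<open>
  The projection onto coefficients at composable arguments.  In algebra terms, it turns a cochain
  into one relative to the subalgebra spanned by the idempotents \<open>e\<^sub>x\<close>.
\<close>

definition composable_part where
  "composable_part F ps u v = (if composable u ps v then F ps u v else 0)"

definition bar_contraction where
  "bar_contraction F ps u v = bar_homotopy (\<lambda>rs. F rs u v) u ps"

text \<open>
  The projection onto composable arguments is homotopic to the identity, because inserting identities is
  a contraction of everything else.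
\<close>

lemma bar_contraction_homotopy:
  assumes "ps \<noteq> []"
  shows "F ps u v - composable_part F ps u v = 
     bar_coboundary (bar_contraction F) ps u v + bar_contraction (bar_coboundary F) ps u v"
proof -
  have "bar_contraction (bar_coboundary F) ps u v =
     bar_homotopy (\<lambda>ps. left_face F ps u v + contractions (\<lambda>rs. F rs u v) ps + right_face (\<lambda>rs w. F rs u w) ps v) u ps"
    unfolding bar_contraction_def by (rule bar_homotopy_cong) (simp add: bar_coboundary_split)
  also have "\<dots> = F ps u v - left_face (bar_contraction F) ps u v - contractions (\<lambda>rs. bar_contraction F rs u v) ps
     - right_face (\<lambda>rs w. bar_contraction F rs u w) ps v - composable_part F ps u v"
    using bar_homotopy_right_face[of "\<lambda>rs w. F rs u w" v u ps]
    by (simp add: bar_homotopy_add bar_homotopy_left_face bar_homotopy_contractions composable_part_def bar_contraction_def[abs_def] algebra_simps)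
  finally show ?thesis by (simp add: bar_coboundary_split[OF assms])
qed

lemma composable_append: "composable u (ps @ qs) v \<longleftrightarrow> (\<exists>w. composable u ps w \<and> composable w qs v)"
  by (induction ps arbitrary: u) auto

text \<open>
  Contracting two adjacent pairs that match does not change whether the list is composable.
\<close>

lemma contractions_composable:
  "(if composable t ps v then contractions G ps else 0) = contractions (\<lambda>rs. if composable t rs v then G rs else 0) ps"
proof (induction ps arbitrary: G t rule: induct_list012)
  case (3 p q ps)
  have "contractions (\<lambda>rs. if composable t (p # rs) v then G (p # rs) else 0) (q # ps)
     = (if fst p = t then contractions (\<lambda>rs. if composable (snd p) rs v then G (p # rs) else 0) (q # ps) else 0)"
    by simp
  also have "\<dots> = (if composable t (p # q # ps) v then contractions (\<lambda>rs. G (p # rs)) (q # ps) else 0)"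
    by (subst 3(2)[symmetric]) simp
  finally show ?case by (simp del: contractions_if)
qed auto

lemma bar_coboundary_composable_part:
  assumes "ps \<noteq> []"
  shows "bar_coboundary (composable_part F) ps u v = composable_part (bar_coboundary F) ps u v"
proof -
  have l: "left_face (composable_part F) ps u v = composable_part (left_face F) ps u v"
    using assms by (cases ps) (auto simp: left_face_def composable_part_def)
  have c: "contractions (\<lambda>rs. composable_part F rs u v) ps = composable_part (\<lambda>ps u v. contractions (\<lambda>rs. F rs u v) ps) ps u v"
    unfolding composable_part_def by (rule contractions_composable[symmetric])
  have r: "right_face (\<lambda>rs w. composable_part F rs u w) ps v = composable_part (\<lambda>ps u v. right_face (\<lambda>rs w. F rs u w) ps v) ps u v"
    using assms by (cases ps rule: rev_cases) (auto simp: right_face_def composable_part_def composable_append)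
  show ?thesis unfolding bar_coboundary_split[OF assms] l c r by (simp add: composable_part_def bar_coboundary_split[OF assms])
qed

text \<open>
  A composable list of pairs from \<open>u\<close> to \<open>v\<close> is the same as the list of vertices that it passes through.
\<close>

definition chain_to_bar :: "('v list \<Rightarrow> 'k::comm_ring_1) \<Rightarrow> ('v \<times> 'v) list \<Rightarrow> 'v \<Rightarrow> 'v \<Rightarrow> 'k" where
  "chain_to_bar c ps u v = (if composable u ps v then c (u # map snd ps) else 0)"

text \<open>
  Contracting two consecutive steps deletes the vertex between them; the outer right face deletes the
  last vertex.  The deletion of the first vertex is the outer left face.
\<close>

lemma contractions_chain:
  assumes "ps \<noteq> []"
  shows "contractions (\<lambda>rs. if composable t rs v then G (map snd rs) else 0) ps
     + right_face (\<lambda>rs w. if composable t rs w then G (map snd rs) else 0) ps v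
    = - (if composable t ps v then deletions G (map snd ps) else 0)"
  using assms
proof (induction ps arbitrary: G t rule: induct_list012)
  case (2 p) then show ?case by (auto simp: right_face_def)
next
  case (3 p q ps)
  let ?G = "\<lambda>ys. G (snd p # ys)"
  have "contractions (\<lambda>rs. if composable t (p # rs) v then G (map snd (p # rs)) else 0) (q # ps)
     = (if fst p = t then contractions (\<lambda>rs. if composable (snd p) rs v then ?G (map snd rs) else 0) (q # ps) else 0)"
    by (cases "fst p = t") (simp_all del: contractions.simps cong: if_cong)
  moreover have "right_face (\<lambda>rs w. if composable t (p # rs) w then G (map snd (p # rs)) else 0) (q # ps) v
     = (if fst p = t then right_face (\<lambda>rs w. if composable (snd p) rs w then ?G (map snd rs) else 0) (q # ps) v else 0)"
    by (simp add: right_face_def)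
  ultimately show ?case using "3.IH"(2)[of "snd p" ?G] by (auto simp: right_face_Cons algebra_simps)
qed simp

lemma bar_coboundary_chain:
  assumes "ps \<noteq> []"
  shows "bar_coboundary (chain_to_bar c) ps u v = chain_to_bar (deletions c) ps u v"
proof -
  have "left_face (chain_to_bar c) ps u v = (if composable u ps v then c (map snd ps) else 0)"
    using assms by (cases ps) (auto simp: left_face_def chain_to_bar_def)
  then show ?thesis using contractions_chain[OF assms, of u v "\<lambda>ys. c (u # ys)"]
    by (simp add: bar_coboundary_split[OF assms] chain_to_bar_def add.assoc)
qed

lemma composable_eq_chain_to_bar:
  "composable_part F ps u v = chain_to_bar (\<lambda>xs. F (zip xs (tl xs)) (hd xs) (last xs)) ps u v"
proof -
  have "composable u ps v \<Longrightarrow> zip (u # map snd ps) (map snd ps) = ps \<and> last (u # map snd ps) = v"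
    by (induction ps arbitrary: u) auto
  then show ?thesis by (auto simp: composable_part_def chain_to_bar_def)
qed

lemma chain_to_bar_zip: "xs \<noteq> [] \<Longrightarrow> chain_to_bar c (zip xs (tl xs)) (hd xs) (last xs) = c xs"
proof (induction xs arbitrary: c)
  case (Cons x xs)
  then show ?case by (cases xs) (auto simp: chain_to_bar_def)
qed simp

section \<open>Cohomology of complexes of vector spaces\<close>

locale vector_space_record = abelian_group V for V :: "('k::field, 'x) module" (structure) +
  assumes smult_closed: "x \<in> carrier V \<Longrightarrow> c \<odot>\<^bsub>V\<^esub> x \<in> carrier V"
    and smult_add: "\<lbrakk>x \<in> carrier V; y \<in> carrier V\<rbrakk> \<Longrightarrow> c \<odot>\<^bsub>V\<^esub> (x \<oplus>\<^bsub>V\<^esub> y) = c \<odot>\<^bsub>V\<^esub> x \<oplus>\<^bsub>V\<^esub> c \<odot>\<^bsub>V\<^esub> y"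

definition linear_map :: "('k, 'x) module \<Rightarrow> ('k, 'y) module \<Rightarrow> ('x \<Rightarrow> 'y) \<Rightarrow> bool" where
  "linear_map V W \<phi> \<longleftrightarrow> \<phi> \<in> carrier V \<rightarrow> carrier W \<and>
     (\<forall>x\<in>carrier V. \<forall>y\<in>carrier V. \<phi> (x \<oplus>\<^bsub>V\<^esub> y) = \<phi> x \<oplus>\<^bsub>W\<^esub> \<phi> y) \<and>
     (\<forall>c. \<forall>x\<in>carrier V. \<phi> (c \<odot>\<^bsub>V\<^esub> x) = c \<odot>\<^bsub>W\<^esub> \<phi> x)"

lemma linear_mapD:
  assumes "linear_map V W \<phi>"
  shows "x \<in> carrier V \<Longrightarrow> \<phi> x \<in> carrier W"
    and "\<lbrakk>x \<in> carrier V; y \<in> carrier V\<rbrakk> \<Longrightarrow> \<phi> (x \<oplus>\<^bsub>V\<^esub> y) = \<phi> x \<oplus>\<^bsub>W\<^esub> \<phi> y"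
    and "x \<in> carrier V \<Longrightarrow> \<phi> (c \<odot>\<^bsub>V\<^esub> x) = c \<odot>\<^bsub>W\<^esub> \<phi> x"
  using assms by (auto simp: linear_map_def)

lemma (in vector_space_record) smult_zero: "c \<odot>\<^bsub>V\<^esub> \<zero>\<^bsub>V\<^esub> = \<zero>\<^bsub>V\<^esub>"
proof -
  have "c \<odot>\<^bsub>V\<^esub> \<zero>\<^bsub>V\<^esub> \<oplus>\<^bsub>V\<^esub> c \<odot>\<^bsub>V\<^esub> \<zero>\<^bsub>V\<^esub> = c \<odot>\<^bsub>V\<^esub> \<zero>\<^bsub>V\<^esub>"
    using smult_add[of "\<zero>\<^bsub>V\<^esub>" "\<zero>\<^bsub>V\<^esub>" c] by simp
  then show ?thesis using smult_closed[of "\<zero>\<^bsub>V\<^esub>" c] by simp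
qed

lemma linear_map_zero:
  assumes "vector_space_record V" "vector_space_record W" "linear_map V W \<phi>"
  shows "\<phi> \<zero>\<^bsub>V\<^esub> = \<zero>\<^bsub>W\<^esub>"
proof -
  interpret V: vector_space_record V by fact
  interpret W: vector_space_record W by fact
  have "\<phi> \<zero>\<^bsub>V\<^esub> \<oplus>\<^bsub>W\<^esub> \<phi> \<zero>\<^bsub>V\<^esub> = \<phi> \<zero>\<^bsub>V\<^esub>"
    using linear_mapD(2)[OF assms(3), of "\<zero>\<^bsub>V\<^esub>" "\<zero>\<^bsub>V\<^esub>"] by simp
  then show ?thesis using linear_mapD(1)[OF assms(3), of "\<zero>\<^bsub>V\<^esub>"] by simp
qed

lemma linear_map_minus:
  assumes "vector_space_record V" "vector_space_record W" "linear_map V W \<phi>" "x \<in> carrier V"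
  shows "\<phi> (\<ominus>\<^bsub>V\<^esub> x) = \<ominus>\<^bsub>W\<^esub> \<phi> x"
proof -
  interpret V: vector_space_record V by fact
  interpret W: vector_space_record W by fact
  have "\<phi> (\<ominus>\<^bsub>V\<^esub> x) \<oplus>\<^bsub>W\<^esub> \<phi> x = \<zero>\<^bsub>W\<^esub>"
    using linear_mapD(2)[OF assms(3), of "\<ominus>\<^bsub>V\<^esub> x" x] assms(4) linear_map_zero[OF assms(1-3)] by (simp add: V.l_neg)
  then show ?thesis using linear_mapD(1)[OF assms(3)] assms(4) by (simp add: W.minus_equality)
qed

lemma vector_space_record_subspace:
  assumes "vector_space_record V" "S \<subseteq> carrier V" "\<zero>\<^bsub>V\<^esub> \<in> S"
    "\<And>x y. x \<in> S \<Longrightarrow> y \<in> S \<Longrightarrow> x \<oplus>\<^bsub>V\<^esub> y \<in> S" "\<And>x. x \<in> S \<Longrightarrow> \<ominus>\<^bsub>V\<^esub> x \<in> S" "\<And>c x. x \<in> S \<Longrightarrow> c \<odot>\<^bsub>V\<^esub> x \<in> S"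
  shows "vector_space_record (V\<lparr>carrier := S\<rparr>)"
proof -
  interpret V: vector_space_record V by fact
  have S: "x \<in> S \<Longrightarrow> x \<in> carrier V" for x using assms(2) by blast
  have "abelian_group (V\<lparr>carrier := S\<rparr>)"
  proof (rule abelian_groupI)
    fix x assume "x \<in> carrier (V\<lparr>carrier := S\<rparr>)"
    then show "\<exists>y\<in>carrier (V\<lparr>carrier := S\<rparr>). y \<oplus>\<^bsub>V\<lparr>carrier := S\<rparr>\<^esub> x = \<zero>\<^bsub>V\<lparr>carrier := S\<rparr>\<^esub>"
      using assms(5) S by (intro bexI[of _ "\<ominus>\<^bsub>V\<^esub> x"]) (auto simp: V.l_neg)
  qed (use assms(3,4) S in \<open>auto simp: V.a_ac\<close>)
  then show ?thesis
    by (intro vector_space_record.intro vector_space_record_axioms.intro) (use assms(6) S V.smult_add in auto)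
qed

lemma additive_coset_eq:
  assumes "abelian_group V" "additive_subgroup U V" "x \<in> carrier V" "y \<in> U +>\<^bsub>V\<^esub> x"
  shows "U +>\<^bsub>V\<^esub> x = U +>\<^bsub>V\<^esub> y"
  using group.repr_independence[of "add_monoid V" y U x] assms
    abelian_group.a_group additive_subgroup.a_subgroup
  by (auto simp: a_r_coset_def)

lemma smult_coset:
  assumes "vector_space_record V" "abelian_subgroup U V" "\<And>c x. x \<in> U \<Longrightarrow> c \<odot>\<^bsub>V\<^esub> x \<in> U" "x \<in> carrier V"
  shows "U <+>\<^bsub>V\<^esub> ((\<lambda>x. c \<odot>\<^bsub>V\<^esub> x) ` (U +>\<^bsub>V\<^esub> x)) = U +>\<^bsub>V\<^esub> (c \<odot>\<^bsub>V\<^esub> x)"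
proof -
  interpret V: vector_space_record V by fact
  interpret U: abelian_subgroup U V by fact
  show ?thesis
  proof (intro equalityI subsetI)
    fix y assume "y \<in> U <+>\<^bsub>V\<^esub> ((\<lambda>x. c \<odot>\<^bsub>V\<^esub> x) ` (U +>\<^bsub>V\<^esub> x))"
    then obtain u' u where u: "u' \<in> U" "u \<in> U" "y = u' \<oplus>\<^bsub>V\<^esub> c \<odot>\<^bsub>V\<^esub> (u \<oplus>\<^bsub>V\<^esub> x)"
      unfolding set_add_def' a_r_coset_def' by auto
    have "y = (u' \<oplus>\<^bsub>V\<^esub> c \<odot>\<^bsub>V\<^esub> u) \<oplus>\<^bsub>V\<^esub> c \<odot>\<^bsub>V\<^esub> x"
      using u assms(4) U.a_subset by (auto simp: V.smult_add V.smult_closed V.a_assoc subset_iff)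
    moreover have "u' \<oplus>\<^bsub>V\<^esub> c \<odot>\<^bsub>V\<^esub> u \<in> U" using u assms(3) by (intro U.a_closed) auto
    ultimately show "y \<in> U +>\<^bsub>V\<^esub> (c \<odot>\<^bsub>V\<^esub> x)" unfolding a_r_coset_def' by auto
  next
    fix y assume "y \<in> U +>\<^bsub>V\<^esub> (c \<odot>\<^bsub>V\<^esub> x)"
    then obtain u where "u \<in> U" "y = u \<oplus>\<^bsub>V\<^esub> c \<odot>\<^bsub>V\<^esub> x" unfolding a_r_coset_def' by auto
    moreover have "x \<in> U +>\<^bsub>V\<^esub> x" using assms(4) by (rule U.a_rcos_self)
    ultimately show "y \<in> U <+>\<^bsub>V\<^esub> ((\<lambda>x. c \<odot>\<^bsub>V\<^esub> x) ` (U +>\<^bsub>V\<^esub> x))"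
      unfolding set_add_def' by blast
  qed
qed

text \<open>
  A linear map that reflects membership in the subspaces and is surjective modulo the target subspace
  induces an isomorphism of the quotients, sending the coset of \<open>x\<close> to the coset of \<open>\<phi> x\<close>.
\<close>

lemma isomorphic_quotients:
  assumes V: "vector_space_record V" and W: "vector_space_record W"
    and U: "additive_subgroup U V" and U': "additive_subgroup U' W"
    and cU: "\<And>c x. x \<in> U \<Longrightarrow> c \<odot>\<^bsub>V\<^esub> x \<in> U" and cU': "\<And>c x. x \<in> U' \<Longrightarrow> c \<odot>\<^bsub>W\<^esub> x \<in> U'"
    and \<phi>: "linear_map V W \<phi>"
    and inj: "\<And>x. x \<in> carrier V \<Longrightarrow> \<phi> x \<in> U' \<longleftrightarrow> x \<in> U"
    and surj: "\<And>y. y \<in> carrier W \<Longrightarrow> \<exists>x\<in>carrier V. \<exists>u\<in>U'. y = u \<oplus>\<^bsub>W\<^esub> \<phi> x"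
  shows "isomorphic_spaces (quotient V U) (quotient W U')"
proof -
  interpret V: vector_space_record V by fact
  interpret W: vector_space_record W by fact
  interpret U: abelian_subgroup U V by (rule abelian_subgroupI3[OF U V.abelian_group_axioms])
  interpret U': abelian_subgroup U' W by (rule abelian_subgroupI3[OF U' W.abelian_group_axioms])
  note \<phi>D = linear_mapD[OF \<phi>]
  define \<Phi> where "\<Phi> X = U' <+>\<^bsub>W\<^esub> \<phi> ` X" for X
  have coset: "\<Phi> (U +>\<^bsub>V\<^esub> x) = U' +>\<^bsub>W\<^esub> \<phi> x" if x: "x \<in> carrier V" for x
  proof (intro equalityI subsetI)
    fix y assume "y \<in> \<Phi> (U +>\<^bsub>V\<^esub> x)"
    then obtain u' u where u: "u' \<in> U'" "u \<in> U" "y = u' \<oplus>\<^bsub>W\<^esub> \<phi> (u \<oplus>\<^bsub>V\<^esub> x)"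
      unfolding \<Phi>_def set_add_def' a_r_coset_def' by auto
    have "y = (u' \<oplus>\<^bsub>W\<^esub> \<phi> u) \<oplus>\<^bsub>W\<^esub> \<phi> x"
      using u x U.a_subset U'.a_subset by (auto simp: \<phi>D W.a_assoc subset_iff)
    moreover have "u' \<oplus>\<^bsub>W\<^esub> \<phi> u \<in> U'" using u inj U.a_subset by (intro U'.a_closed) auto
    ultimately show "y \<in> U' +>\<^bsub>W\<^esub> \<phi> x" unfolding a_r_coset_def' by auto
  next
    fix y assume "y \<in> U' +>\<^bsub>W\<^esub> \<phi> x"
    then obtain u where "u \<in> U'" "y = u \<oplus>\<^bsub>W\<^esub> \<phi> x" unfolding a_r_coset_def' by auto
    moreover have "x \<in> U +>\<^bsub>V\<^esub> x" using x by (rule U.a_rcos_self)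
    ultimately show "y \<in> \<Phi> (U +>\<^bsub>V\<^esub> x)" unfolding \<Phi>_def set_add_def' by blast
  qed
  have rep: "\<exists>x\<in>carrier V. X = U +>\<^bsub>V\<^esub> x" if "X \<in> a_rcosets\<^bsub>V\<^esub> U" for X
    using that by (auto simp: A_RCOSETS_def')
  show ?thesis
    unfolding isomorphic_spaces_def quotient_simps
  proof (intro exI[of _ \<Phi>] conjI allI ballI)
    show "bij_betw \<Phi> (a_rcosets\<^bsub>V\<^esub> U) (a_rcosets\<^bsub>W\<^esub> U')"
      unfolding bij_betw_def
    proof (intro conjI inj_onI subset_antisym[of "\<Phi> ` _"] subsetI)
      fix X Y assume "X \<in> a_rcosets\<^bsub>V\<^esub> U" "Y \<in> a_rcosets\<^bsub>V\<^esub> U" "\<Phi> X = \<Phi> Y"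
      then obtain x y where x: "x \<in> carrier V" "X = U +>\<^bsub>V\<^esub> x" and y: "y \<in> carrier V" "Y = U +>\<^bsub>V\<^esub> y"
        and eq: "U' +>\<^bsub>W\<^esub> \<phi> x = U' +>\<^bsub>W\<^esub> \<phi> y" using rep coset by metis
      have "\<phi> y \<in> U' +>\<^bsub>W\<^esub> \<phi> x" unfolding eq using \<phi>D(1)[OF y(1)] by (rule U'.a_rcos_self)
      then obtain u' where u': "u' \<in> U'" "\<phi> y = u' \<oplus>\<^bsub>W\<^esub> \<phi> x" unfolding a_r_coset_def' by auto
      have "\<phi> (y \<oplus>\<^bsub>V\<^esub> \<ominus>\<^bsub>V\<^esub> x) = u'"
        using u' x y U'.a_subset by (auto simp: \<phi>D linear_map_minus[OF V W \<phi>] W.a_assoc W.r_neg subset_iff)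
      then have u: "y \<oplus>\<^bsub>V\<^esub> \<ominus>\<^bsub>V\<^esub> x \<in> U" using u' inj x y by auto
      have "y = (y \<oplus>\<^bsub>V\<^esub> \<ominus>\<^bsub>V\<^esub> x) \<oplus>\<^bsub>V\<^esub> x" using x y by (simp add: V.a_assoc V.l_neg)
      then have "y \<in> U +>\<^bsub>V\<^esub> x" using u unfolding a_r_coset_def' by auto
      then show "X = Y" using x y additive_coset_eq[OF V.abelian_group_axioms U] by metis
    next
      fix Y assume "Y \<in> \<Phi> ` (a_rcosets\<^bsub>V\<^esub> U)"
      then obtain x where "x \<in> carrier V" "Y = U' +>\<^bsub>W\<^esub> \<phi> x" using rep coset by (auto dest!: rep)
      then show "Y \<in> a_rcosets\<^bsub>W\<^esub> U'" using \<phi>D(1) by (auto simp: A_RCOSETS_def')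
    next
      fix Y assume "Y \<in> a_rcosets\<^bsub>W\<^esub> U'"
      then obtain y where y: "y \<in> carrier W" "Y = U' +>\<^bsub>W\<^esub> y" by (auto simp: A_RCOSETS_def')
      obtain x u where x: "x \<in> carrier V" "u \<in> U'" "y = u \<oplus>\<^bsub>W\<^esub> \<phi> x" using surj[OF y(1)] by blast
      then have "y \<in> U' +>\<^bsub>W\<^esub> \<phi> x" unfolding a_r_coset_def' by auto
      then have "Y = U' +>\<^bsub>W\<^esub> \<phi> x" using y additive_coset_eq[OF W.abelian_group_axioms U'] \<phi>D(1)[OF x(1)] by metis
      then have "Y = \<Phi> (U +>\<^bsub>V\<^esub> x)" using coset x by simp
      moreover have "U +>\<^bsub>V\<^esub> x \<in> a_rcosets\<^bsub>V\<^esub> U" using x by (auto simp: A_RCOSETS_def')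
      ultimately show "Y \<in> \<Phi> ` (a_rcosets\<^bsub>V\<^esub> U)" by blast
    qed
  next
    fix X Y assume "X \<in> a_rcosets\<^bsub>V\<^esub> U" "Y \<in> a_rcosets\<^bsub>V\<^esub> U"
    then obtain x y where x: "x \<in> carrier V" "X = U +>\<^bsub>V\<^esub> x" and y: "y \<in> carrier V" "Y = U +>\<^bsub>V\<^esub> y"
      using rep by metis
    show "\<Phi> (X <+>\<^bsub>V\<^esub> Y) = \<Phi> X <+>\<^bsub>W\<^esub> \<Phi> Y"
      unfolding x y using x(1) y(1) by (simp add: U.a_rcos_sum U'.a_rcos_sum coset \<phi>D)
  next
    fix c X assume "X \<in> a_rcosets\<^bsub>V\<^esub> U"
    then obtain x where x: "x \<in> carrier V" "X = U +>\<^bsub>V\<^esub> x" using rep by metis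
    show "\<Phi> (U <+>\<^bsub>V\<^esub> ((\<lambda>x. c \<odot>\<^bsub>V\<^esub> x) ` X)) = U' <+>\<^bsub>W\<^esub> ((\<lambda>x. c \<odot>\<^bsub>W\<^esub> x) ` \<Phi> X)"
      unfolding x using x(1)
      by (simp add: smult_coset[OF V U.abelian_subgroup_axioms cU] smult_coset[OF W U'.abelian_subgroup_axioms cU'] coset \<phi>D V.smult_closed)
  qed
qed

definition cochain_complex :: "(nat \<Rightarrow> ('k::field, 'c) module) \<Rightarrow> (nat \<Rightarrow> 'c \<Rightarrow> 'c) \<Rightarrow> bool" where
  "cochain_complex C \<delta> \<longleftrightarrow> (\<forall>n. vector_space_record (C n) \<and> linear_map (C n) (C (Suc n)) (\<delta> n) \<and>
     (\<forall>x\<in>carrier (C n). \<delta> (Suc n) (\<delta> n x) = \<zero>\<^bsub>C (Suc (Suc n))\<^esub>))"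

lemma cochain_complexD:
  assumes "cochain_complex C \<delta>"
  shows "vector_space_record (C n)" "linear_map (C n) (C (Suc n)) (\<delta> n)"
    "x \<in> carrier (C n) \<Longrightarrow> \<delta> (Suc n) (\<delta> n x) = \<zero>\<^bsub>C (Suc (Suc n))\<^esub>"
  using assms by (auto simp: cochain_complex_def)

abbreviation cocycles where
  "cocycles C \<delta> n \<equiv> C n\<lparr>carrier := {f \<in> carrier (C n). \<delta> n f = \<zero>\<^bsub>C (Suc n)\<^esub>}\<rparr>"

lemma cocycles_coboundaries:
  assumes "cochain_complex C \<delta>"
  shows "vector_space_record (cocycles C \<delta> n)"
    and "additive_subgroup (\<delta> n ` carrier (C n))
      (cocycles C \<delta> (Suc n))"
    and "y \<in> \<delta> n ` carrier (C n) \<Longrightarrow> c \<odot>\<^bsub>C (Suc n)\<^esub> y \<in> \<delta> n ` carrier (C n)"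
proof -
  note C = cochain_complexD[OF assms]
  interpret vector_space_record "C n" for n by (rule C)
  note d = linear_mapD[OF C(2)] linear_map_zero[OF C(1) C(1) C(2)] linear_map_minus[OF C(1) C(1) C(2)]
  show Z: "vector_space_record (cocycles C \<delta> n)" for n
    by (rule vector_space_record_subspace) (auto simp: C d smult_closed smult_zero)
  interpret Z: vector_space_record "cocycles C \<delta> (Suc n)" by (rule Z)
  show "additive_subgroup (\<delta> n ` carrier (C n))
      (cocycles C \<delta> (Suc n))"
  proof (rule additive_subgroupI, rule Z.add.subgroupI)
    have "\<delta> n \<zero>\<^bsub>C n\<^esub> \<in> \<delta> n ` carrier (C n)" by blast
    then show "\<delta> n ` carrier (C n) \<noteq> {}" by blast
  next
    fix y assume "y \<in> \<delta> n ` carrier (C n)"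
    then obtain x where x: "x \<in> carrier (C n)" "y = \<delta> n x" by blast
    have "\<ominus>\<^bsub>cocycles C \<delta> (Suc n)\<^esub> y = \<delta> n (\<ominus>\<^bsub>C n\<^esub> x)"
      unfolding x by (rule Z.minus_equality) (auto simp: x d C l_neg)
    then show "\<ominus>\<^bsub>cocycles C \<delta> (Suc n)\<^esub> y \<in> \<delta> n ` carrier (C n)"
      using x by simp
  next
    fix y z assume "y \<in> \<delta> n ` carrier (C n)" "z \<in> \<delta> n ` carrier (C n)"
    then obtain x w where "x \<in> carrier (C n)" "y = \<delta> n x" "w \<in> carrier (C n)" "z = \<delta> n w" by blast
    then show "y \<oplus>\<^bsub>cocycles C \<delta> (Suc n)\<^esub> z \<in> \<delta> n ` carrier (C n)"
      by (auto intro!: image_eqI[of _ _ "x \<oplus>\<^bsub>C n\<^esub> w"] simp: d)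
  qed (use d(1)[of _ n] C(3)[of _ n] in auto)
  show "c \<odot>\<^bsub>C (Suc n)\<^esub> y \<in> \<delta> n ` carrier (C n)" if "y \<in> \<delta> n ` carrier (C n)"
  proof -
    from that obtain x where x: "x \<in> carrier (C n)" "y = \<delta> n x" by (elim imageE)
    have "c \<odot>\<^bsub>C (Suc n)\<^esub> y = \<delta> n (c \<odot>\<^bsub>C n\<^esub> x)"
      unfolding x(2) by (rule d(3)[symmetric, OF x(1)])
    then show ?thesis using smult_closed[OF x(1)] by (rule image_eqI)
  qed
qed

text \<open>
  A criterion for a map in a single degree, which need not be part of a map of complexes.  This is
  convenient for maps that commute with the coboundaries only up to sign.
\<close>

lemma isomorphic_cohomology:
  assumes C: "cochain_complex C \<delta>" and D: "cochain_complex D \<delta>'"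
    and \<phi>: "linear_map (C (Suc n)) (D (Suc n)) \<phi>"
    and cocycle: "\<And>x. \<lbrakk>x \<in> carrier (C (Suc n)); \<delta> (Suc n) x = \<zero>\<^bsub>C (Suc (Suc n))\<^esub>\<rbrakk> \<Longrightarrow> \<delta>' (Suc n) (\<phi> x) = \<zero>\<^bsub>D (Suc (Suc n))\<^esub>"
    and coboundary: "\<And>x. x \<in> carrier (C n) \<Longrightarrow> \<phi> (\<delta> n x) \<in> \<delta>' n ` carrier (D n)"
    and inj: "\<And>x w. \<lbrakk>x \<in> carrier (C (Suc n)); \<delta> (Suc n) x = \<zero>\<^bsub>C (Suc (Suc n))\<^esub>; w \<in> carrier (D n); \<phi> x = \<delta>' n w\<rbrakk> \<Longrightarrow> x \<in> \<delta> n ` carrier (C n)"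
    and surj: "\<And>y. \<lbrakk>y \<in> carrier (D (Suc n)); \<delta>' (Suc n) y = \<zero>\<^bsub>D (Suc (Suc n))\<^esub>\<rbrakk> \<Longrightarrow>
       \<exists>x\<in>carrier (C (Suc n)). \<delta> (Suc n) x = \<zero>\<^bsub>C (Suc (Suc n))\<^esub> \<and> (\<exists>w\<in>carrier (D n). y = \<delta>' n w \<oplus>\<^bsub>D (Suc n)\<^esub> \<phi> x)"
  shows "isomorphic_spaces (cohomology C \<delta> (Suc n)) (cohomology D \<delta>' (Suc n))"
  unfolding cohomology_def nat.case
proof (rule isomorphic_quotients[where \<phi> = \<phi>])
  show "linear_map (cocycles C \<delta> (Suc n))
     (cocycles D \<delta>' (Suc n)) \<phi>"
    using \<phi> cocycle by (auto simp: linear_map_def)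
  fix y assume "y \<in> carrier (cocycles D \<delta>' (Suc n))"
  then show "\<exists>x\<in>carrier (cocycles C \<delta> (Suc n)).
     \<exists>u\<in>\<delta>' n ` carrier (D n). y = u \<oplus>\<^bsub>cocycles D \<delta>' (Suc n)\<^esub> \<phi> x"
    using surj[of y] by auto
qed (use cocycles_coboundaries[OF C] cocycles_coboundaries[OF D] coboundary inj in auto)

lemma isomorphic_spaces_trans:
  assumes "isomorphic_spaces U V" "isomorphic_spaces V W"
  shows "isomorphic_spaces U W"
proof -
  obtain \<phi> where \<phi>: "bij_betw \<phi> (carrier U) (carrier V)"
    "\<forall>x\<in>carrier U. \<forall>y\<in>carrier U. \<phi> (x \<oplus>\<^bsub>U\<^esub> y) = \<phi> x \<oplus>\<^bsub>V\<^esub> \<phi> y" "\<forall>c. \<forall>x\<in>carrier U. \<phi> (c \<odot>\<^bsub>U\<^esub> x) = c \<odot>\<^bsub>V\<^esub> \<phi> x"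
    using assms(1) by (auto simp: isomorphic_spaces_def)
  obtain \<psi> where \<psi>: "bij_betw \<psi> (carrier V) (carrier W)"
    "\<forall>x\<in>carrier V. \<forall>y\<in>carrier V. \<psi> (x \<oplus>\<^bsub>V\<^esub> y) = \<psi> x \<oplus>\<^bsub>W\<^esub> \<psi> y" "\<forall>c. \<forall>x\<in>carrier V. \<psi> (c \<odot>\<^bsub>V\<^esub> x) = c \<odot>\<^bsub>W\<^esub> \<psi> x"
    using assms(2) by (auto simp: isomorphic_spaces_def)
  have "\<phi> x \<in> carrier V" if "x \<in> carrier U" for x using \<phi>(1) that by (rule bij_betwE[rule_format])
  then show ?thesis
    unfolding isomorphic_spaces_def
    by (intro exI[of _ "\<psi> \<circ> \<phi>"]) (use \<phi> \<psi> in \<open>auto intro: bij_betw_trans\<close>)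
qed

text \<open>
  Entries may repeat: these are the simplices, degenerate ones included, of the nerve, just
  as the arguments of a Hochschild cochain include the idempotents \<open>e\<^sub>x\<close>.
\<close>

definition poset_chains :: "'v set \<Rightarrow> ('v \<Rightarrow> 'v \<Rightarrow> bool) \<Rightarrow> nat \<Rightarrow> 'v list set" where
  "poset_chains V R n = {xs. length xs = n \<and> set xs \<subseteq> V \<and> sorted_wrt R xs}"

definition chain_cochains :: "'v set \<Rightarrow> ('v \<Rightarrow> 'v \<Rightarrow> bool) \<Rightarrow> nat \<Rightarrow> ('k::field, 'v list \<Rightarrow> 'k) module" where
  "chain_cochains V R n =
    \<lparr>carrier = {c. \<forall>xs. xs \<notin> poset_chains V R (Suc n) \<longrightarrow> c xs = 0}, monoid.mult = undefined, one = undefined,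
     ring.zero = (\<lambda>_. 0), add = (\<lambda>c c' xs. c xs + c' xs), smult = (\<lambda>r c xs. r * c xs)\<rparr>"

definition chain_coboundary ::
    "'v set \<Rightarrow> ('v \<Rightarrow> 'v \<Rightarrow> bool) \<Rightarrow> nat \<Rightarrow> ('v list \<Rightarrow> 'k::field) \<Rightarrow> 'v list \<Rightarrow> 'k" where
  "chain_coboundary V R n c xs = (if xs \<in> poset_chains V R (Suc (Suc n)) then deletions c xs else 0)"

lemma poset_chains_delete: "ys @ x # zs \<in> poset_chains V R (Suc n) \<Longrightarrow> ys @ zs \<in> poset_chains V R n"
  by (auto simp: poset_chains_def sorted_wrt_append)

lemma chain_cochain_complex: "cochain_complex (chain_cochains V R) (chain_coboundary V R :: nat \<Rightarrow> ('v list \<Rightarrow> 'k::field) \<Rightarrow> _)"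
  unfolding cochain_complex_def
proof (intro allI conjI ballI)
  fix n
  have "abelian_group (chain_cochains V R n :: ('k, 'v list \<Rightarrow> 'k) module)"
  proof (rule abelian_groupI)
    fix c assume "c \<in> carrier (chain_cochains V R n :: ('k, 'v list \<Rightarrow> 'k) module)"
    then show "\<exists>c'\<in>carrier (chain_cochains V R n). c' \<oplus>\<^bsub>chain_cochains V R n\<^esub> c = \<zero>\<^bsub>chain_cochains V R n\<^esub>"
      by (intro bexI[of _ "\<lambda>xs. - c xs"]) (auto simp: chain_cochains_def)
  qed (auto simp: chain_cochains_def algebra_simps)
  then show "vector_space_record (chain_cochains V R n :: ('k, 'v list \<Rightarrow> 'k) module)"
    by (intro vector_space_record.intro vector_space_record_axioms.intro) (auto simp: chain_cochains_def algebra_simps)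
  show "linear_map (chain_cochains V R n :: ('k, 'v list \<Rightarrow> 'k) module) (chain_cochains V R (Suc n)) (chain_coboundary V R n)"
    by (auto simp: linear_map_def chain_cochains_def chain_coboundary_def deletions_add deletions_scale)
  fix c :: "'v list \<Rightarrow> 'k"
  have "deletions (chain_coboundary V R n c) xs = 0" if "xs \<in> poset_chains V R (Suc (Suc (Suc n)))" for xs
  proof -
    have "deletions (chain_coboundary V R n c) xs = deletions (deletions c) xs"
    proof (rule deletions_cong)
      fix ys zs x assume "xs = ys @ x # zs"
      then show "chain_coboundary V R n c (ys @ zs) = deletions c (ys @ zs)"
        using that poset_chains_delete[of ys x zs V R "Suc (Suc n)"] by (auto simp: chain_coboundary_def)
    qed
    then show ?thesis by (simp add: deletions_deletions)
  qed
  then show "chain_coboundary V R (Suc n) (chain_coboundary V R n c) = \<zero>\<^bsub>chain_cochains V R (Suc (Suc n))\<^esub>"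
    by (auto simp: chain_cochains_def chain_coboundary_def[of _ _ "Suc n"])
qed

section \<open>Incidence algebras in coordinates\<close>

text \<open>
  An algebra \<open>A\<close> with the structure of an incidence algebra: \<open>co X x y\<close> is the coefficient of \<open>X\<close> at the
  interval from \<open>x\<close> to \<open>y\<close>.  The Hochschild complex and the resolution are treated in these coordinates, so
  that paths and cosets do not appear there.
\<close>

locale incidence_coordinates =
  fixes A :: "('k::field, 'x) module" (structure) and V :: "'v set" and below :: "'v \<Rightarrow> 'v \<Rightarrow> bool"
    and co :: "'x \<Rightarrow> 'v \<Rightarrow> 'v \<Rightarrow> 'k"
  assumes finite_V: "finite V"
    and below_V: "below x y \<Longrightarrow> x \<in> V \<and> y \<in> V"
    and below_refl: "x \<in> V \<Longrightarrow> below x x"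
    and below_trans: "below x y \<Longrightarrow> below y z \<Longrightarrow> below x z"
    and ring_A: "ring A"
    and co_bij: "bij_betw co (carrier A) {\<phi>. \<forall>x y. \<phi> x y \<noteq> 0 \<longrightarrow> below x y}"
    and co_add: "\<lbrakk>X \<in> carrier A; Y \<in> carrier A\<rbrakk> \<Longrightarrow> co (X \<oplus> Y) x y = co X x y + co Y x y"
    and co_mult: "\<lbrakk>X \<in> carrier A; Y \<in> carrier A\<rbrakk> \<Longrightarrow> co (X \<otimes> Y) x y = (\<Sum>z\<in>V. co X x z * co Y z y)"
    and co_one: "co \<one> x y = (if x = y \<and> x \<in> V then 1 else 0)"
    and smult_A_closed: "X \<in> carrier A \<Longrightarrow> c \<odot> X \<in> carrier A"
    and co_smult: "X \<in> carrier A \<Longrightarrow> co (c \<odot> X) x y = c * co X x y"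
begin

sublocale A: ring A by (rule ring_A)

lemma co_below: "X \<in> carrier A \<Longrightarrow> co X x y \<noteq> 0 \<Longrightarrow> below x y"
  using bij_betwE[OF co_bij] by blast

lemma co_eqI: "\<lbrakk>X \<in> carrier A; Y \<in> carrier A; \<And>x y. co X x y = co Y x y\<rbrakk> \<Longrightarrow> X = Y"
  using inj_onD[OF bij_betw_imp_inj_on[OF co_bij]] by blast

lemma co_zero: "co \<zero> x y = 0"
  using co_add[of "\<zero>" "\<zero>" x y] by (metis A.r_zero A.zero_closed add_cancel_right_right)

lemma co_minus: "X \<in> carrier A \<Longrightarrow> co (\<ominus> X) x y = - co X x y"
  using co_add[of "\<ominus> X" X x y] by (simp add: A.l_neg co_zero eq_neg_iff_add_eq_0)

lemma co_finsum:
  "(\<And>i. i \<in> I \<Longrightarrow> f i \<in> carrier A) \<Longrightarrow> co (finsum A f I) x y = (\<Sum>i\<in>I. co (f i) x y)"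
  by (induction I rule: infinite_finite_induct) (simp_all add: co_zero co_add Pi_def)

definition of_coords :: "('v \<Rightarrow> 'v \<Rightarrow> 'k) \<Rightarrow> 'x" where
  "of_coords \<phi> = inv_into (carrier A) co \<phi>"

lemma of_coords: assumes "\<And>x y. \<phi> x y \<noteq> 0 \<Longrightarrow> below x y"
  shows of_coords_closed: "of_coords \<phi> \<in> carrier A" and co_of_coords: "co (of_coords \<phi>) x y = \<phi> x y"
proof -
  have "\<phi> \<in> co ` carrier A" using assms bij_betw_imp_surj_on[OF co_bij] by auto
  then show "of_coords \<phi> \<in> carrier A" "co (of_coords \<phi>) x y = \<phi> x y" unfolding of_coords_def by (auto simp: inv_into_into f_inv_into_f)
qed

text \<open>
  The matrix units, a basis of \<open>A\<close>: for a quiver, \<open>E (x, y)\<close> is the class of the paths from \<open>y\<close> to \<open>x\<close>.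
\<close>

definition E :: "'v \<times> 'v \<Rightarrow> 'x" where
  "E p = of_coords (\<lambda>x y. if x = fst p \<and> y = snd p then 1 else 0)"

definition pairs :: "('v \<times> 'v) set" where "pairs = {p. below (fst p) (snd p)}"

lemma finite_pairs: "finite pairs"
  by (rule finite_subset[of _ "V \<times> V"]) (use below_V finite_V in \<open>auto simp: pairs_def\<close>)

lemma E: assumes "p \<in> pairs"
  shows E_closed: "E p \<in> carrier A" and co_E: "co (E p) x y = (if x = fst p \<and> y = snd p then 1 else 0)"
proof -
  have *: "(if x = fst p \<and> y = snd p then 1 else 0 :: 'k) \<noteq> 0 \<Longrightarrow> below x y" for x y
    using assms by (auto simp: pairs_def split: if_splits)
  show "E p \<in> carrier A" "co (E p) x y = (if x = fst p \<and> y = snd p then 1 else 0)"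
    unfolding E_def by (rule of_coords_closed[OF *] co_of_coords[OF *]; assumption)+
qed

lemma co_E_mult:
  "\<lbrakk>p \<in> pairs; X \<in> carrier A\<rbrakk> \<Longrightarrow> co (E p \<otimes> X) u v = (if fst p = u then co X (snd p) v else 0)"
  using finite_V below_V by (auto simp: co_mult E_closed co_E pairs_def if_distrib[of "\<lambda>x. x * _"] cong: if_cong)

lemma co_mult_E:
  "\<lbrakk>p \<in> pairs; X \<in> carrier A\<rbrakk> \<Longrightarrow> co (X \<otimes> E p) u v = (if snd p = v then co X u (fst p) else 0)"
  using finite_V below_V by (auto simp: co_mult E_closed co_E pairs_def if_distrib[of "\<lambda>x. _ * x"] cong: if_cong)

lemma E_mult:
  assumes "p \<in> pairs" "q \<in> pairs"
  shows "E p \<otimes> E q = (if snd p = fst q then E (fst p, snd q) else \<zero>)"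
proof -
  have "snd p = fst q \<Longrightarrow> (fst p, snd q) \<in> pairs" using assms below_trans by (auto simp: pairs_def)
  then show ?thesis using assms by (intro co_eqI) (auto simp: E_closed co_E_mult co_E co_zero)
qed

lemma vector_space_A: "vector_space_record A"
  by (intro vector_space_record.intro vector_space_record_axioms.intro A.abelian_group_axioms smult_A_closed)
    (auto intro!: co_eqI simp: smult_A_closed co_smult co_add algebra_simps)

lemma linear_map_coI:
  assumes "\<And>x. x \<in> carrier A \<Longrightarrow> L x \<in> carrier A"
    and "\<And>x y u v. \<lbrakk>x \<in> carrier A; y \<in> carrier A\<rbrakk> \<Longrightarrow> co (L (x \<oplus> y)) u v = co (L x) u v + co (L y) u v"
    and "\<And>c x u v. x \<in> carrier A \<Longrightarrow> co (L (c \<odot> x)) u v = c * co (L x) u v"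
  shows "linear_map A A L"
  unfolding linear_map_def
  by (intro conjI allI ballI Pi_I co_eqI) (simp_all add: assms co_add co_smult smult_A_closed)

lemma linear_map_addI:
  assumes L: "linear_map A A L" and M: "linear_map A A M"
  shows "linear_map A A (\<lambda>x. L x \<oplus> M x)"
  by (rule linear_map_coI) (simp_all add: linear_mapD[OF L] linear_mapD[OF M] co_add co_smult smult_A_closed distrib_left)

lemma linear_map_smultI:
  assumes L: "linear_map A A L" shows "linear_map A A (\<lambda>x. c \<odot> L x)"
  by (rule linear_map_coI) (simp_all add: linear_mapD[OF L] co_add co_smult smult_A_closed distrib_left mult.left_commute)

lemma linear_map_zeroI: "linear_map A A (\<lambda>_. \<zero>)"
  by (rule linear_map_coI) (simp_all add: co_zero)

lemma linear_map_minusI: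
  assumes L: "linear_map A A L" shows "linear_map A A (\<lambda>x. \<ominus> L x)"
  by (rule linear_map_coI) (simp_all add: linear_mapD[OF L] co_add co_minus co_smult smult_A_closed)

lemma linear_map_finsumI:
  assumes "\<And>i. i \<in> I \<Longrightarrow> linear_map A A (\<lambda>x. L x i)"
  shows "linear_map A A (\<lambda>x. finsum A (L x) I)"
  using assms
proof (induction I rule: infinite_finite_induct)
  case (insert i I)
  have *: "finsum A (L x) (insert i I) = L x i \<oplus> finsum A (L x) I" if "x \<in> carrier A" for x
    using insert linear_mapD(1)[OF insert.prems] that by (subst A.finsum_insert) auto
  have l: "linear_map A A (\<lambda>x. L x i \<oplus> finsum A (L x) I)" by (rule linear_map_addI) (use insert in auto)
  then show ?case unfolding linear_map_def by (auto simp: * smult_A_closed Pi_def)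
qed (auto intro: linear_map_zeroI)

lemma linear_map_compI:
  assumes L: "linear_map A A L" and M: "linear_map A A M"
  shows "linear_map A A (\<lambda>x. L (M x))"
  by (rule linear_map_coI) (simp_all add: linear_mapD[OF L] linear_mapD[OF M] co_add co_smult)

lemma linear_map_leftI:
  assumes a: "a \<in> carrier A" and M: "linear_map A A M"
  shows "linear_map A A (\<lambda>x. a \<otimes> M x)"
  by (rule linear_map_coI)
    (simp_all add: a linear_mapD[OF M] co_add co_smult smult_A_closed co_mult distrib_left sum.distrib sum_distrib_left mult.left_commute)

lemma linear_map_rightI:
  assumes a: "a \<in> carrier A" and M: "linear_map A A M"
  shows "linear_map A A (\<lambda>x. M x \<otimes> a)"
  by (rule linear_map_coI)
    (simp_all add: a linear_mapD[OF M] co_add co_smult smult_A_closed co_mult distrib_right sum.distrib sum_distrib_left mult.assoc)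

lemma linear_map_idI: "linear_map A A (\<lambda>x. x)"
  by (auto simp: linear_map_def)

text \<open>
  Every element is a linear combination of matrix units, which are removed one after the other.
\<close>

lemma linear_map_ext:
  assumes L: "linear_map A A L" and M: "linear_map A A M"
    and LM: "\<And>p. p \<in> pairs \<Longrightarrow> L (E p) = M (E p)" and X: "X \<in> carrier A"
  shows "L X = M X"
proof -
  have "L X = M X" if "finite S" "S \<subseteq> pairs" "X \<in> carrier A" "\<And>x y. co X x y \<noteq> 0 \<Longrightarrow> (x, y) \<in> S" for S X
    using that
  proof (induction S arbitrary: X rule: finite_induct)
    case empty
    then have "X = \<zero>" by (intro co_eqI) (auto simp: co_zero)
    then show ?case using linear_map_zero[OF vector_space_A vector_space_A L] linear_map_zero[OF vector_space_A vector_space_A M] by simp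
  next
    case (insert p S)
    define \<phi> where "\<phi> x y = (if x = fst p \<and> y = snd p then 0 else co X x y)" for x y
    have \<phi>: "\<phi> x y \<noteq> 0 \<Longrightarrow> below x y" for x y using co_below[OF insert.prems(2)] by (auto simp: \<phi>_def split: if_splits)
    have of_coords\<phi>: "of_coords \<phi> \<in> carrier A" "co (of_coords \<phi>) x y = \<phi> x y" for x y
      by (rule of_coords_closed co_of_coords; erule \<phi>)+
    have p: "p \<in> pairs" using insert by simp
    have "L (of_coords \<phi>) = M (of_coords \<phi>)"
    proof (rule insert.IH)
      fix x y assume "co (of_coords \<phi>) x y \<noteq> 0"
      then show "(x, y) \<in> S" using insert.prems(3)[of x y] by (auto simp: of_coords\<phi> \<phi>_def split: if_splits)
    qed (use insert of_coords\<phi> in auto)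
    moreover have "X = of_coords \<phi> \<oplus> co X (fst p) (snd p) \<odot> E p"
      using p insert.prems of_coords\<phi>
      by (intro co_eqI) (auto simp: co_add co_smult smult_A_closed E_closed co_E of_coords\<phi> \<phi>_def)
    moreover have "L (of_coords \<phi> \<oplus> c \<odot> E p) = L (of_coords \<phi>) \<oplus> c \<odot> L (E p)"
       "M (of_coords \<phi> \<oplus> c \<odot> E p) = M (of_coords \<phi>) \<oplus> c \<odot> M (E p)" for c
      using p of_coords\<phi> by (simp_all add: linear_mapD[OF L] linear_mapD[OF M] smult_A_closed E_closed)
    ultimately show ?case using LM[OF p] by metis
  qed
  from this[OF finite_pairs _ X] show ?thesis using co_below[OF X] by (auto simp: pairs_def)
qed

section \<open>Hochschild cohomology is the cohomology of chains\<close>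

abbreviation "HC n \<equiv> hochschild_cochains A n"
abbreviation "\<delta> \<equiv> hochschild_coboundary A"

lemma tuples_update: "as \<in> tuples A n \<Longrightarrow> x \<in> carrier A \<Longrightarrow> as[i := x] \<in> tuples A n"
  by (auto simp: tuples_def dest: set_update_subset_insert[THEN set_mp])

lemma HC_iff: "f \<in> carrier (HC n) \<longleftrightarrow> f \<in> tuples A n \<rightarrow>\<^sub>E carrier A \<and>
    (\<forall>as\<in>tuples A n. \<forall>i<n. linear_map A A (\<lambda>x. f (as[i := x])))"
  unfolding linear_map_def by (auto simp: hochschild_cochains_def PiE_iff tuples_update)

lemma HC_closed: "f \<in> carrier (HC n) \<Longrightarrow> as \<in> tuples A n \<Longrightarrow> f as \<in> carrier A"
  by (auto simp: HC_iff)

lemma HC_linear: "f \<in> carrier (HC n) \<Longrightarrow> as \<in> tuples A n \<Longrightarrow> i < n \<Longrightarrow> linear_map A A (\<lambda>x. f (as[i := x]))"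
  by (auto simp: HC_iff)

lemma HC_eqI:
  assumes "f \<in> carrier (HC n)" "g \<in> carrier (HC n)" "\<And>as. as \<in> tuples A n \<Longrightarrow> f as = g as"
  shows "f = g"
  using assms by (auto simp: HC_iff intro: PiE_ext)

lemma HC_ops:
  "\<zero>\<^bsub>HC n\<^esub> = (\<lambda>as\<in>tuples A n. \<zero>)"
  "f \<oplus>\<^bsub>HC n\<^esub> g = (\<lambda>as\<in>tuples A n. f as \<oplus> g as)"
  "c \<odot>\<^bsub>HC n\<^esub> f = (\<lambda>as\<in>tuples A n. c \<odot> f as)"
  by (simp_all add: hochschild_cochains_def)

lemma linear_map_cong:
  "(\<And>x. x \<in> carrier A \<Longrightarrow> L x = M x) \<Longrightarrow> linear_map A A L \<longleftrightarrow> linear_map A A M"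
  unfolding linear_map_def by (auto simp: smult_A_closed Pi_def)

lemma HC_restrictI:
  assumes "\<And>as. as \<in> tuples A n \<Longrightarrow> f as \<in> carrier A"
    "\<And>as i. as \<in> tuples A n \<Longrightarrow> i < n \<Longrightarrow> linear_map A A (\<lambda>x. f (as[i := x]))"
  shows "restrict f (tuples A n) \<in> carrier (HC n)"
  unfolding HC_iff
proof (intro conjI ballI allI impI)
  fix as i assume "as \<in> tuples A n" "i < n"
  then show "linear_map A A (\<lambda>x. restrict f (tuples A n) (as[i := x]))"
    using assms(2) by (subst linear_map_cong[of _ "\<lambda>x. f (as[i := x])"]) (auto simp: tuples_update)
qed (use assms(1) in auto)

lemma HC_vector_space: "vector_space_record (HC n)"
proof -
  have add: "f \<oplus>\<^bsub>HC n\<^esub> g \<in> carrier (HC n)" if "f \<in> carrier (HC n)" "g \<in> carrier (HC n)" for f g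
    unfolding HC_ops by (rule HC_restrictI) (auto intro!: linear_map_addI simp: HC_closed[OF that(1)] HC_closed[OF that(2)] HC_linear[OF that(1)] HC_linear[OF that(2)])
  have smult: "c \<odot>\<^bsub>HC n\<^esub> f \<in> carrier (HC n)" if "f \<in> carrier (HC n)" for f c
    unfolding HC_ops by (rule HC_restrictI) (auto intro!: linear_map_smultI smult_A_closed simp: HC_closed[OF that(1)] HC_linear[OF that(1)])
  have zero: "\<zero>\<^bsub>HC n\<^esub> \<in> carrier (HC n)"
    unfolding HC_ops by (rule HC_restrictI) (auto intro!: linear_map_zeroI)
  have "abelian_group (HC n)"
  proof (rule abelian_groupI)
    fix f assume f: "f \<in> carrier (HC n)"
    have "(\<lambda>as\<in>tuples A n. \<ominus> f as) \<in> carrier (HC n)"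
      by (rule HC_restrictI) (auto intro!: linear_map_minusI simp: HC_closed[OF f] HC_linear[OF f])
    then show "\<exists>g\<in>carrier (HC n). g \<oplus>\<^bsub>HC n\<^esub> f = \<zero>\<^bsub>HC n\<^esub>"
      using f by (intro bexI) (auto simp: HC_ops HC_closed A.l_neg intro!: restrict_ext)
  next
    fix f assume f: "f \<in> carrier (HC n)"
    then show "\<zero>\<^bsub>HC n\<^esub> \<oplus>\<^bsub>HC n\<^esub> f = f"
      by (intro HC_eqI[OF add f] zero) (auto simp: HC_ops HC_closed)
  next
    fix f g assume "f \<in> carrier (HC n)" "g \<in> carrier (HC n)"
    then show "f \<oplus>\<^bsub>HC n\<^esub> g = g \<oplus>\<^bsub>HC n\<^esub> f"
      unfolding HC_ops by (intro restrict_ext) (simp add: HC_closed A.a_comm)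
  next
    fix f g h assume "f \<in> carrier (HC n)" "g \<in> carrier (HC n)" "h \<in> carrier (HC n)"
    then show "f \<oplus>\<^bsub>HC n\<^esub> g \<oplus>\<^bsub>HC n\<^esub> h = f \<oplus>\<^bsub>HC n\<^esub> (g \<oplus>\<^bsub>HC n\<^esub> h)"
      unfolding HC_ops by (intro restrict_ext) (simp add: HC_closed A.a_assoc)
  qed (rule add zero | assumption)+
  then show ?thesis
    by (intro vector_space_record.intro vector_space_record_axioms.intro smult)
      (auto intro!: restrict_ext simp: HC_ops HC_closed vector_space_record.smult_add[OF vector_space_A])
qed

text \<open>
  The arguments of the inner terms of the Hochschild coboundary.
\<close>

definition mult_at :: "nat \<Rightarrow> 'x list \<Rightarrow> 'x list" where
  "mult_at i as = take (i - 1) as @ [as ! (i - 1) \<otimes> as ! i] @ drop (Suc i) as"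

lemma mult_at_closed: "\<lbrakk>as \<in> tuples A (Suc n); 1 \<le> i; i \<le> n\<rbrakk> \<Longrightarrow> mult_at i as \<in> tuples A n"
  by (auto simp: tuples_def mult_at_def subset_iff dest: in_set_takeD in_set_dropD)

text \<open>
  Replacing one argument changes exactly one argument after multiplication, linearly; hence the inner
  terms of the coboundary are multilinear.
\<close>

lemma mult_at_update:
  assumes "length as = Suc n" "1 \<le> i" "i \<le> n" "j < Suc n"
  shows "mult_at i (as[j := x]) =
    (if j < i - 1 then (mult_at i as)[j := x] else if j = i - 1 then (mult_at i as)[i - 1 := x \<otimes> as ! i]
     else if j = i then (mult_at i as)[i - 1 := as ! (i - 1) \<otimes> x] else (mult_at i as)[j - 1 := x])"
proof (rule nth_equalityI)
  fix k assume "k < length (mult_at i (as[j := x]))"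
  then have k: "k < n" using assms by (simp add: mult_at_def)
  show "mult_at i (as[j := x]) ! k = (if j < i - 1 then (mult_at i as)[j := x] else if j = i - 1 then (mult_at i as)[i - 1 := x \<otimes> as ! i]
     else if j = i then (mult_at i as)[i - 1 := as ! (i - 1) \<otimes> x] else (mult_at i as)[j - 1 := x]) ! k"
    using assms k unfolding mult_at_def
    by (cases "k < i - 1"; cases "k = i - 1")
       (auto simp: nth_append nth_list_update nth_Cons split: nat.splits)
qed (use assms in \<open>auto simp: mult_at_def\<close>)

lemma \<delta>_def: "\<delta> n f = (\<lambda>as\<in>tuples A (Suc n).
     hd as \<otimes> f (tl as) \<oplus> (\<Oplus>i\<in>{1..n}. (- 1) ^ i \<odot> f (mult_at i as)) \<oplus>
     (- 1) ^ Suc n \<odot> (f (butlast as) \<otimes> last as))"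
  by (simp add: hochschild_coboundary_def mult_at_def)

lemma tuples_Suc_parts:
  assumes "as \<in> tuples A (Suc n)"
  shows "hd as \<in> carrier A" "tl as \<in> tuples A n" "last as \<in> carrier A" "butlast as \<in> tuples A n"
  using assms by (cases as; auto simp: tuples_def dest: in_set_butlastD last_in_set)+

lemma \<delta>_closed:
  assumes f: "f \<in> carrier (HC n)"
  shows "\<delta> n f \<in> carrier (HC (Suc n))"
  unfolding \<delta>_def
proof (rule HC_restrictI)
  fix as assume as: "as \<in> tuples A (Suc n)"
  note p = tuples_Suc_parts[OF as] HC_closed[OF f]
  show "hd as \<otimes> f (tl as) \<oplus> (\<Oplus>i\<in>{1..n}. (- 1) ^ i \<odot> f (mult_at i as)) \<oplus>
     (- 1) ^ Suc n \<odot> (f (butlast as) \<otimes> last as) \<in> carrier A"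
    by (intro A.a_closed A.m_closed A.finsum_closed Pi_I smult_A_closed p) (rule mult_at_closed[OF as], auto)
  fix j assume j: "j < Suc n"
  have len: "length as = Suc n" using as by (simp add: tuples_def)
  have 1: "linear_map A A (\<lambda>x. hd (as[j := x]) \<otimes> f (tl (as[j := x])))"
  proof (cases j)
    case 0
    then have "hd (as[j := x]) = x" "tl (as[j := x]) = tl as" for x using len by (cases as; simp)+
    then show ?thesis using p by (simp add: linear_map_rightI linear_map_idI)
  next
    case (Suc i)
    then have "hd (as[j := x]) = hd as" "tl (as[j := x]) = (tl as)[i := x]" for x using len by (cases as; simp)+
    then show ?thesis using p Suc j by (simp add: linear_map_leftI HC_linear[OF f])
  qed
  have 2: "linear_map A A (\<lambda>x. f (butlast (as[j := x])) \<otimes> last (as[j := x]))"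
  proof (cases "j = n")
    case True
    then have "last (as[j := x]) = x" "butlast (as[j := x]) = butlast as" for x using len
      by (cases as rule: rev_cases; auto simp: list_update_append)+
    then show ?thesis using p by (simp add: linear_map_leftI linear_map_idI)
  next
    case False
    then have "last (as[j := x]) = last as" "butlast (as[j := x]) = (butlast as)[j := x]" for x using len j
      by (cases as rule: rev_cases; auto simp: list_update_append)+
    then show ?thesis using p j False by (simp add: linear_map_rightI HC_linear[OF f])
  qed
  have 3: "linear_map A A (\<lambda>x. f (mult_at i (as[j := x])))" if i: "i \<in> {1..n}" for i
  proof -
    have m: "mult_at i as \<in> tuples A n" using mult_at_closed[OF as] i by simp
    have "as ! i \<in> carrier A" "as ! (i - 1) \<in> carrier A" using as i by (auto simp: tuples_def subset_iff)
    then show ?thesis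
      using i j mult_at_update[OF len _ _ j] HC_linear[OF f m]
        linear_map_compI[OF HC_linear[OF f m] linear_map_leftI[OF _ linear_map_idI], of "i - 1" "as ! (i - 1)"]
        linear_map_compI[OF HC_linear[OF f m] linear_map_rightI[OF _ linear_map_idI], of "i - 1" "as ! i"]
      by (cases "j < i - 1"; cases "j = i - 1"; cases "j = i") auto
  qed
  show "linear_map A A (\<lambda>x. hd (as[j := x]) \<otimes> f (tl (as[j := x])) \<oplus> (\<Oplus>i\<in>{1..n}. (- 1) ^ i \<odot> f (mult_at i (as[j := x]))) \<oplus>
     (- 1) ^ Suc n \<odot> (f (butlast (as[j := x])) \<otimes> last (as[j := x])))"
    by (intro linear_map_addI linear_map_finsumI linear_map_smultI 1 2 3)
qed

lemma co_\<delta>: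
  assumes f: "f \<in> carrier (HC n)" and as: "as \<in> tuples A (Suc n)"
  shows "co (\<delta> n f as) u v = co (hd as \<otimes> f (tl as)) u v +
     (\<Sum>i\<in>{1..n}. (- 1) ^ i * co (f (mult_at i as)) u v) + (- 1) ^ Suc n * co (f (butlast as) \<otimes> last as) u v"
proof -
  note p = tuples_Suc_parts[OF as] HC_closed[OF f]
  have c: "(- 1) ^ i \<odot> f (mult_at i as) \<in> carrier A" "f (mult_at i as) \<in> carrier A" if "i \<in> {1..n}" for i
    using that mult_at_closed[OF as] p by (auto intro!: smult_A_closed)
  have "co (\<Oplus>i\<in>{1..n}. (- 1) ^ i \<odot> f (mult_at i as)) u v = (\<Sum>i\<in>{1..n}. (- 1) ^ i * co (f (mult_at i as)) u v)"
    by (subst co_finsum) (use c in \<open>simp_all add: co_smult\<close>)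
  moreover have "(\<Oplus>i\<in>{1..n}. (- 1) ^ i \<odot> f (mult_at i as)) \<in> carrier A"
    using c by (intro A.finsum_closed) auto
  ultimately show ?thesis using as p
    by (simp add: \<delta>_def co_add co_smult smult_A_closed del: power_Suc)
qed

lemma \<delta>_linear: "linear_map (HC n) (HC (Suc n)) (\<delta> n)"
  unfolding linear_map_def
proof (intro conjI ballI allI Pi_I \<delta>_closed)
  interpret H: vector_space_record "HC n" for n by (rule HC_vector_space)
  fix f assume f: "f \<in> carrier (HC n)"
  show "\<delta> n (c \<odot>\<^bsub>HC n\<^esub> f) = c \<odot>\<^bsub>HC (Suc n)\<^esub> \<delta> n f" for c
  proof (rule HC_eqI)
    fix as assume as: "as \<in> tuples A (Suc n)"
    note p = tuples_Suc_parts[OF as] HC_closed[OF f] as mult_at_closed[OF as]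
    show "\<delta> n (c \<odot>\<^bsub>HC n\<^esub> f) as = (c \<odot>\<^bsub>HC (Suc n)\<^esub> \<delta> n f) as"
    proof (rule co_eqI)
      fix u v
      have "(\<Sum>i\<in>{1..n}. (- 1) ^ i * co ((c \<odot>\<^bsub>HC n\<^esub> f) (mult_at i as)) u v) = c * (\<Sum>i\<in>{1..n}. (- 1) ^ i * co (f (mult_at i as)) u v)"
        unfolding sum_distrib_left by (rule sum.cong) (auto simp: HC_ops p co_smult mult.left_commute)
      moreover have "co ((c \<odot>\<^bsub>HC (Suc n)\<^esub> \<delta> n f) as) u v = c * co (\<delta> n f as) u v"
        using as \<delta>_closed[OF f] HC_closed by (auto simp: HC_ops co_smult)
      moreover have "co (hd as \<otimes> (c \<odot>\<^bsub>HC n\<^esub> f) (tl as)) u v = c * co (hd as \<otimes> f (tl as)) u v"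
         "co ((c \<odot>\<^bsub>HC n\<^esub> f) (butlast as) \<otimes> last as) u v = c * co (f (butlast as) \<otimes> last as) u v"
        by (simp_all add: HC_ops p co_mult co_smult smult_A_closed sum_distrib_left mult_ac)
      ultimately show "co (\<delta> n (c \<odot>\<^bsub>HC n\<^esub> f) as) u v = co ((c \<odot>\<^bsub>HC (Suc n)\<^esub> \<delta> n f) as) u v"
        by (simp add: co_\<delta>[OF _ as] f H.smult_closed algebra_simps)
    qed (use as f in \<open>auto intro!: HC_closed H.smult_closed \<delta>_closed\<close>)
  qed (use f in \<open>auto intro!: H.smult_closed \<delta>_closed\<close>)
  fix g assume g: "g \<in> carrier (HC n)"
  show "\<delta> n (f \<oplus>\<^bsub>HC n\<^esub> g) = \<delta> n f \<oplus>\<^bsub>HC (Suc n)\<^esub> \<delta> n g"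
  proof (rule HC_eqI)
    fix as assume as: "as \<in> tuples A (Suc n)"
    note p = tuples_Suc_parts[OF as] HC_closed[OF f] HC_closed[OF g] as mult_at_closed[OF as]
    show "\<delta> n (f \<oplus>\<^bsub>HC n\<^esub> g) as = (\<delta> n f \<oplus>\<^bsub>HC (Suc n)\<^esub> \<delta> n g) as"
    proof (rule co_eqI)
      fix u v
      have "(\<Sum>i\<in>{1..n}. (- 1) ^ i * co ((f \<oplus>\<^bsub>HC n\<^esub> g) (mult_at i as)) u v) = (\<Sum>i\<in>{1..n}. (- 1) ^ i * co (f (mult_at i as)) u v) + (\<Sum>i\<in>{1..n}. (- 1) ^ i * co (g (mult_at i as)) u v)"
        unfolding sum.distrib[symmetric] by (rule sum.cong) (auto simp: HC_ops p co_add distrib_left)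
      moreover have "co ((\<delta> n f \<oplus>\<^bsub>HC (Suc n)\<^esub> \<delta> n g) as) u v = co (\<delta> n f as) u v + co (\<delta> n g as) u v"
        using as \<delta>_closed[OF f] \<delta>_closed[OF g] HC_closed by (auto simp: HC_ops co_add)
      moreover have "co (hd as \<otimes> (f \<oplus>\<^bsub>HC n\<^esub> g) (tl as)) u v = co (hd as \<otimes> f (tl as)) u v + co (hd as \<otimes> g (tl as)) u v"
         "co ((f \<oplus>\<^bsub>HC n\<^esub> g) (butlast as) \<otimes> last as) u v = co (f (butlast as) \<otimes> last as) u v + co (g (butlast as) \<otimes> last as) u v"
        by (simp_all add: HC_ops p A.r_distr A.l_distr co_add)
      ultimately show "co (\<delta> n (f \<oplus>\<^bsub>HC n\<^esub> g) as) u v = co ((\<delta> n f \<oplus>\<^bsub>HC (Suc n)\<^esub> \<delta> n g) as) u v"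
        by (simp add: co_\<delta>[OF _ as] f g algebra_simps)
    qed (use as f g in \<open>auto intro!: HC_closed H.a_closed \<delta>_closed\<close>)
  qed (use f g in \<open>auto intro!: H.a_closed \<delta>_closed\<close>)
qed

end

text \<open>
  The recursion agrees with the indexed sum in the definition of the Hochschild coboundary.
\<close>

lemma contractions_eq_sum:
  "contractions G ps = (\<Sum>i\<in>{1..<length ps}. (- 1) ^ i *
     (if snd (ps ! (i - 1)) = fst (ps ! i) then G (take (i - 1) ps @ (fst (ps ! (i - 1)), snd (ps ! i)) # drop (Suc i) ps) else 0))"
proof (induction ps arbitrary: G rule: induct_list012)
  case (3 p q ps)
  let ?t = "\<lambda>G ps i. (- 1) ^ i * (if snd (ps ! (i - 1)) = fst (ps ! i) then G (take (i - 1) ps @ (fst (ps ! (i - 1)), snd (ps ! i)) # drop (Suc i) ps) else 0)"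
  have "(\<Sum>i\<in>{1..<length (p # q # ps)}. ?t G (p # q # ps) i) = ?t G (p # q # ps) 1 + (\<Sum>i\<in>{1..<length (q # ps)}. ?t G (p # q # ps) (Suc i))"
    by (subst sum.atLeast_Suc_lessThan) (auto simp: sum.shift_bounds_Suc_ivl simp del: sum.op_ivl_Suc)
  also have "(\<Sum>i\<in>{1..<length (q # ps)}. ?t G (p # q # ps) (Suc i)) = (\<Sum>i\<in>{1..<length (q # ps)}. - ?t (\<lambda>rs. G (p # rs)) (q # ps) i)"
  proof (rule sum.cong[OF refl])
    fix i assume "i \<in> {1..<length (q # ps)}"
    then obtain j where "i = Suc j" by (cases i) auto
    then show "?t G (p # q # ps) (Suc i) = - ?t (\<lambda>rs. G (p # rs)) (q # ps) i" by simp
  qed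
  finally show ?case using "3.IH"(2)[of "\<lambda>rs. G (p # rs)"]
    by (simp add: sum_negf del: sum.op_ivl_Suc)
qed auto

lemma bar_coboundary_add:
  assumes "ps \<noteq> []"
  shows "bar_coboundary (\<lambda>ps u v. F ps u v + F' ps u v) ps u v = bar_coboundary F ps u v + bar_coboundary F' ps u v"
  by (simp add: bar_coboundary_split[OF assms] left_face_def right_face_def contractions_add distrib_left)

context incidence_coordinates begin

lemma HC_zero_closed: "\<zero>\<^bsub>HC n\<^esub> \<in> carrier (HC n)"
proof -
  interpret vector_space_record "HC n" by (rule HC_vector_space)
  show ?thesis by (rule zero_closed)
qed

definition bar_tuples :: "nat \<Rightarrow> ('v \<times> 'v) list set" where
  "bar_tuples n = {ps. length ps = n \<and> set ps \<subseteq> pairs}"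

lemma finite_bar_tuples: "finite (bar_tuples n)"
  using finite_lists_length_eq[OF finite_pairs, of n] by (simp add: bar_tuples_def conj_commute)

lemma bar_tuples_map: "ps \<in> bar_tuples n \<Longrightarrow> map E ps \<in> tuples A n"
  by (auto simp: bar_tuples_def tuples_def E_closed subset_iff)

definition coeffs :: "nat \<Rightarrow> ('x list \<Rightarrow> 'x) \<Rightarrow> ('v \<times> 'v) list \<Rightarrow> 'v \<Rightarrow> 'v \<Rightarrow> 'k" where
  "coeffs n f ps u v = (if ps \<in> bar_tuples n then co (f (map E ps)) u v else 0)"

lemma coeffs_below: "f \<in> carrier (HC n) \<Longrightarrow> coeffs n f ps u v \<noteq> 0 \<Longrightarrow> below u v"
  using co_below[OF HC_closed[OF _ bar_tuples_map]] by (auto simp: coeffs_def split: if_splits)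

text \<open>
  Multilinear maps that agree on matrix units are equal: the entries of an arbitrary tuple are replaced
  by matrix units one at a time.
\<close>

lemma HC_ext:
  assumes f: "f \<in> carrier (HC n)" and g: "g \<in> carrier (HC n)"
    and fg: "\<And>ps u v. ps \<in> bar_tuples n \<Longrightarrow> below u v \<Longrightarrow> coeffs n f ps u v = coeffs n g ps u v"
  shows "f = g"
proof -
  have "f as = g as" if "as \<in> tuples A n" "k \<le> n" "\<And>i. k \<le> i \<Longrightarrow> i < n \<Longrightarrow> as ! i \<in> E ` pairs" for as k
    using that
  proof (induction k arbitrary: as)
    case 0
    have "\<forall>i<n. \<exists>p. p \<in> pairs \<and> as ! i = E p" using "0.prems"(3) by blast
    then obtain h where h: "\<And>i. i < n \<Longrightarrow> h i \<in> pairs \<and> as ! i = E (h i)" by metis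
    have len: "length as = n" using 0 by (simp add: tuples_def)
    have as: "as = map E (map h [0..<n])" using h len by (auto intro!: nth_equalityI)
    have ps: "map h [0..<n] \<in> bar_tuples n" using h by (auto simp: bar_tuples_def)
    have c: "f as \<in> carrier A" "g as \<in> carrier A" using 0 f g HC_closed by auto
    show ?case
    proof (rule co_eqI[OF c])
      fix u v
      show "co (f as) u v = co (g as) u v"
      proof (cases "below u v")
        case True
        then show ?thesis using fg[OF ps, of u v] ps unfolding as coeffs_def by simp
      next
        case False
        then show ?thesis using co_below[OF c(1)] co_below[OF c(2)] by metis
      qed
    qed
  next
    case (Suc k)
    have k: "k < n" "length as = n" using Suc.prems by (auto simp: tuples_def)
    have "f (as[k := as ! k]) = g (as[k := as ! k])"
    proof (rule linear_map_ext[OF HC_linear[OF f] HC_linear[OF g]])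
      fix p assume p: "p \<in> pairs"
      show "f (as[k := E p]) = g (as[k := E p])"
      proof (rule Suc.IH)
        fix i assume "k \<le> i" "i < n"
        then show "as[k := E p] ! i \<in> E ` pairs" using p k Suc.prems(3)[of i] by (cases "i = k") auto
      qed (use Suc.prems p in \<open>auto simp: tuples_update E_closed\<close>)
    next
      show "as ! k \<in> carrier A" using k Suc.prems(1) by (auto simp: tuples_def subset_iff)
    qed (use Suc.prems k in auto)
    then show ?case by simp
  qed
  from this[OF _ order_refl] show ?thesis by (intro HC_eqI[OF f g]) auto
qed

definition multilinear_extension :: "nat \<Rightarrow> (('v \<times> 'v) list \<Rightarrow> 'v \<Rightarrow> 'v \<Rightarrow> 'k) \<Rightarrow> 'x list \<Rightarrow> 'x" where
  "multilinear_extension n F = (\<lambda>as\<in>tuples A n. of_coords (\<lambda>u v. if below u v then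
     (\<Sum>ps\<in>bar_tuples n. (\<Prod>i<n. co (as ! i) (fst (ps ! i)) (snd (ps ! i))) * F ps u v) else 0))"

lemma multilinear_extension:
  shows multilinear_extension_closed: "multilinear_extension n F \<in> carrier (HC n)" (is ?C)
    and coeffs_multilinear_extension: "ps \<in> bar_tuples n \<Longrightarrow> below u v \<Longrightarrow> coeffs n (multilinear_extension n F) ps u v = F ps u v"
proof -
  let ?f = "\<lambda>as u v. if below u v then
     (\<Sum>ps\<in>bar_tuples n. (\<Prod>i<n. co (as ! i) (fst (ps ! i)) (snd (ps ! i))) * F ps u v) else 0"
  have of_coords: "of_coords (?f as) \<in> carrier A" "co (of_coords (?f as)) u v = ?f as u v" for as u v
    by (rule of_coords_closed co_of_coords; metis)+
  show ?C
    unfolding multilinear_extension_def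
  proof (rule HC_restrictI)
    fix as i assume as: "as \<in> tuples A n" and i: "i < n"
    have pr: "(\<Prod>j<n. co (as[i := x] ! j) (fst (ps ! j)) (snd (ps ! j))) =
       co x (fst (ps ! i)) (snd (ps ! i)) * (\<Prod>j\<in>{..<n} - {i}. co (as ! j) (fst (ps ! j)) (snd (ps ! j)))" for x ps
      using i as by (subst prod.remove[of _ i]) (auto simp: tuples_def)
    show "linear_map A A (\<lambda>x. of_coords (?f (as[i := x])))"
      by (rule linear_map_coI)
        (auto simp: of_coords pr co_add co_smult distrib_right sum.distrib sum_distrib_left mult.assoc simp del: if_split split: if_split)
  qed (rule of_coords)
  assume ps: "ps \<in> bar_tuples n" and uv: "below u v"
  have "(\<Prod>i<n. co (map E ps ! i) (fst (qs ! i)) (snd (qs ! i))) = (if qs = ps then 1 else 0)" if qs: "qs \<in> bar_tuples n" for qs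
  proof -
    have "co (map E ps ! i) (fst (qs ! i)) (snd (qs ! i)) = (if qs ! i = ps ! i then 1 else 0)" if "i < n" for i
    proof -
      have "ps ! i \<in> pairs" using ps that nth_mem[of i ps] by (auto simp: bar_tuples_def)
      then show ?thesis using ps that by (auto simp: bar_tuples_def co_E prod_eq_iff)
    qed
    then have "(\<Prod>i<n. co (map E ps ! i) (fst (qs ! i)) (snd (qs ! i))) = (\<Prod>i<n. if qs ! i = ps ! i then 1 else 0)" by simp
    also have "\<dots> = (if qs = ps then 1 else 0)"
      using ps qs by (auto simp: bar_tuples_def list_eq_iff_nth_eq)
    finally show ?thesis .
  qed
  then have "(\<Sum>qs\<in>bar_tuples n. (\<Prod>i<n. co (map E ps ! i) (fst (qs ! i)) (snd (qs ! i))) * F qs u v) = (\<Sum>qs\<in>bar_tuples n. if qs = ps then F qs u v else 0)"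
    by (intro sum.cong) auto
  also have "\<dots> = F ps u v" using ps finite_bar_tuples by simp
  finally show "coeffs n (multilinear_extension n F) ps u v = F ps u v"
    using ps uv bar_tuples_map[OF ps] of_coords[of "map E ps"] by (simp add: coeffs_def multilinear_extension_def)
qed

text \<open>
  Coefficients outside the incidence relation carry no information, so a function supported there is
  recovered completely.
\<close>

lemma coeffs_multilinear_extension':
  assumes ps: "ps \<in> bar_tuples n" and F: "F ps u v \<noteq> 0 \<Longrightarrow> below u v"
  shows "coeffs n (multilinear_extension n F) ps u v = F ps u v"
  using coeffs_multilinear_extension[OF ps, of u v F] F coeffs_below[OF multilinear_extension_closed, of n F ps u v] by metis

lemma bar_coboundary_cong_tuples:
  assumes ps: "ps \<in> bar_tuples (Suc n)"
    and FF': "\<And>qs u v. qs \<in> bar_tuples n \<Longrightarrow> F qs u v = F' qs u v"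
  shows "bar_coboundary F ps u v = bar_coboundary F' ps u v"
proof -
  have ne: "ps \<noteq> []" using ps by (auto simp: bar_tuples_def)
  have tb: "tl ps \<in> bar_tuples n" "butlast ps \<in> bar_tuples n"
    using ps ne by (cases ps; auto simp: bar_tuples_def dest: in_set_butlastD)+
  have "contractions (\<lambda>rs. F rs u v) ps = contractions (\<lambda>rs. F' rs u v) ps"
  proof (rule contractions_cong)
    fix ys zs p q assume *: "ps = ys @ p # q # zs" "snd p = fst q"
    then have "(fst p, snd q) \<in> pairs" using ps below_trans by (auto simp: bar_tuples_def pairs_def)
    then show "F (ys @ (fst p, snd q) # zs) u v = F' (ys @ (fst p, snd q) # zs) u v"
      using * ps by (intro FF') (auto simp: bar_tuples_def)
  qed
  then show ?thesis using FF'[OF tb(1)] FF'[OF tb(2)]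
    by (simp add: bar_coboundary_split[OF ne] left_face_def right_face_def)
qed

lemma bar_contraction_cong_tuples:
  assumes ps: "ps \<in> bar_tuples n" and u: "u \<in> V"
    and FF': "\<And>qs. qs \<in> bar_tuples (Suc n) \<Longrightarrow> F qs u v = F' qs u v"
  shows "bar_contraction F ps u v = bar_contraction F' ps u v"
  unfolding bar_contraction_def
proof (rule bar_homotopy_cong)
  fix ys zs x assume *: "ps = ys @ zs" "x = (if ys = [] then u else snd (last ys))"
  have "x \<in> V"
  proof (cases "ys = []")
    case False
    then have "last ys \<in> pairs" using * ps by (auto simp: bar_tuples_def)
    then show ?thesis using * False below_V by (auto simp: pairs_def)
  qed (use * u in auto)
  then show "F (ys @ (x, x) # zs) u v = F' (ys @ (x, x) # zs) u v"
    using * ps by (intro FF') (auto simp: bar_tuples_def pairs_def below_refl)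
qed

text \<open>
  In coordinates the Hochschild coboundary no longer involves sums over vertices: multiplication by a
  matrix unit moves one end point of the coefficient.
\<close>

lemma coeffs_\<delta>:
  assumes f: "f \<in> carrier (HC n)" and ps: "ps \<in> bar_tuples (Suc n)"
  shows "coeffs (Suc n) (\<delta> n f) ps u v = bar_coboundary (coeffs n f) ps u v"
proof -
  have ne: "ps \<noteq> []" and len: "length ps = Suc n" using ps by (auto simp: bar_tuples_def)
  have tb: "tl ps \<in> bar_tuples n" "butlast ps \<in> bar_tuples n" "hd ps \<in> pairs" "last ps \<in> pairs"
    using ps ne by (cases ps; auto simp: bar_tuples_def dest: in_set_butlastD)+
  note t = bar_tuples_map[OF ps]
  have l: "co (hd (map E ps) \<otimes> f (tl (map E ps))) u v = left_face (coeffs n f) ps u v"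
    using tb ne HC_closed[OF f bar_tuples_map[OF tb(1)]]
    by (simp add: hd_map map_tl[symmetric] co_E_mult left_face_def coeffs_def)
  have r: "(- 1) ^ Suc n * co (f (butlast (map E ps)) \<otimes> last (map E ps)) u v = right_face (\<lambda>rs w. coeffs n f rs u w) ps v"
    using tb ne len HC_closed[OF f bar_tuples_map[OF tb(2)]]
    by (simp add: last_map map_butlast[symmetric] co_mult_E right_face_def coeffs_def)
  have m: "co (f (mult_at i (map E ps))) u v = (if snd (ps ! (i - 1)) = fst (ps ! i) then coeffs n f (take (i - 1) ps @ (fst (ps ! (i - 1)), snd (ps ! i)) # drop (Suc i) ps) u v else 0)"
    if i: "i \<in> {1..n}" for i
  proof -
    let ?qs = "take (i - 1) ps @ (fst (ps ! (i - 1)), snd (ps ! i)) # drop (Suc i) ps"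
    have p: "ps ! (i - 1) \<in> pairs" "ps ! i \<in> pairs" using i len ps nth_mem[of "i - 1" ps] nth_mem[of i ps] by (auto simp: bar_tuples_def)
    have "i - 1 < length ps" "i < length ps" using i len by auto
    then have mm: "mult_at i (map E ps) = take (i - 1) (map E ps) @ (E (ps ! (i - 1)) \<otimes> E (ps ! i)) # drop (Suc i) (map E ps)"
      by (simp add: mult_at_def)
    show ?thesis
    proof (cases "snd (ps ! (i - 1)) = fst (ps ! i)")
      case True
      have "(fst (ps ! (i - 1)), snd (ps ! i)) \<in> pairs" using p True below_trans by (auto simp: pairs_def)
      then have "?qs \<in> bar_tuples n" using i len ps
        by (auto simp: bar_tuples_def dest: in_set_takeD in_set_dropD)
      then show ?thesis using True p by (simp add: mm E_mult coeffs_def take_map drop_map)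
    next
      case False
      have "mult_at i (map E ps) = (mult_at i (map E ps))[i - 1 := \<zero>]"
        unfolding mm using p i len False by (auto simp: E_mult list_update_append nth_list_update intro!: nth_equalityI simp: nth_append nth_Cons split: nat.splits)
      moreover have "f ((mult_at i (map E ps))[i - 1 := \<zero>]) = \<zero>"
        by (rule linear_map_zero[OF vector_space_A vector_space_A HC_linear[OF f mult_at_closed[OF t]]]) (use i in auto)
      ultimately show ?thesis using False by (simp add: co_zero)
    qed
  qed
  have "(\<Sum>i\<in>{1..n}. (- 1) ^ i * co (f (mult_at i (map E ps))) u v) = contractions (\<lambda>rs. coeffs n f rs u v) ps"
    unfolding contractions_eq_sum len atLeastLessThanSuc_atLeastAtMost by (rule sum.cong) (auto simp: m)
  then show ?thesis using ps unfolding bar_coboundary_split[OF ne] l[symmetric] r[symmetric]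
    by (simp add: coeffs_def co_\<delta>[OF f t])
qed

lemma HC_complex: "cochain_complex (hochschild_cochains A) (hochschild_coboundary A)"
  unfolding cochain_complex_def
proof (intro allI conjI ballI HC_vector_space \<delta>_linear)
  fix n f assume f: "f \<in> carrier (HC n)"
  note f1 = \<delta>_closed[OF f]
  show "\<delta> (Suc n) (\<delta> n f) = \<zero>\<^bsub>HC (Suc (Suc n))\<^esub>"
  proof (rule HC_ext)
    show "\<delta> (Suc n) (\<delta> n f) \<in> carrier (HC (Suc (Suc n)))" by (rule \<delta>_closed[OF f1])
    show "\<zero>\<^bsub>HC (Suc (Suc n))\<^esub> \<in> carrier (HC (Suc (Suc n)))" by (rule HC_zero_closed)
    fix ps u v assume ps: "ps \<in> bar_tuples (Suc (Suc n))"
    have "coeffs (Suc (Suc n)) (\<delta> (Suc n) (\<delta> n f)) ps u v = bar_coboundary (bar_coboundary (coeffs n f)) ps u v"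
      unfolding coeffs_\<delta>[OF f1 ps] by (rule bar_coboundary_cong_tuples[OF ps coeffs_\<delta>[OF f]])
    then show "coeffs (Suc (Suc n)) (\<delta> (Suc n) (\<delta> n f)) ps u v = coeffs (Suc (Suc n)) \<zero>\<^bsub>HC (Suc (Suc n))\<^esub> ps u v"
      using ps bar_tuples_map[OF ps] by (simp add: bar_coboundary_bar_coboundary coeffs_def HC_ops co_zero)
  qed
qed

abbreviation "CC \<equiv> chain_cochains V below :: nat \<Rightarrow> ('k, 'v list \<Rightarrow> 'k) module"
abbreviation "dC \<equiv> chain_coboundary V below :: nat \<Rightarrow> ('v list \<Rightarrow> 'k) \<Rightarrow> 'v list \<Rightarrow> 'k"

definition restrict_to_chains :: "nat \<Rightarrow> ('x list \<Rightarrow> 'x) \<Rightarrow> 'v list \<Rightarrow> 'k" where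
  "restrict_to_chains n f xs = (if xs \<in> poset_chains V below (Suc n) then coeffs n f (zip xs (tl xs)) (hd xs) (last xs) else 0)"

text \<open>
  By transitivity the vertices that such a list passes through are pairwise comparable.
\<close>

lemma chain_iff_composable:
  "ps \<in> bar_tuples n \<Longrightarrow> u \<in> V \<Longrightarrow> composable u ps v \<Longrightarrow> u # map snd ps \<in> poset_chains V below (Suc n)"
proof (induction ps arbitrary: n u)
  case (Cons p ps)
  then obtain m where n: "n = Suc m" by (auto simp: bar_tuples_def)
  have ps: "ps \<in> bar_tuples m" and p: "p \<in> pairs" using Cons.prems n by (auto simp: bar_tuples_def)
  have "snd p \<in> V" using p below_V by (auto simp: pairs_def)
  then have "snd p # map snd ps \<in> poset_chains V below (Suc m)" using Cons.IH[OF ps] Cons.prems by simp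
  moreover have "below u (snd p)" using Cons.prems p by (auto simp: pairs_def)
  ultimately show ?case using Cons.prems(2) n below_trans by (auto simp: poset_chains_def)
qed (auto simp: bar_tuples_def poset_chains_def)

lemma chain_bar_tuple:
  "xs \<in> poset_chains V below (Suc n) \<Longrightarrow> zip xs (tl xs) \<in> bar_tuples n"
proof (induction xs arbitrary: n)
  case (Cons x xs)
  show ?case
  proof (cases xs)
    case (Cons y ys)
    then obtain m where "n = Suc m" using Cons.prems by (auto simp: poset_chains_def)
    then show ?thesis using Cons Cons.IH[of m] Cons.prems by (auto simp: poset_chains_def bar_tuples_def pairs_def)
  qed (use Cons.prems in \<open>auto simp: poset_chains_def bar_tuples_def\<close>)
qed (auto simp: poset_chains_def)

lemma chain_below: "xs \<in> poset_chains V below (Suc n) \<Longrightarrow> below (hd xs) (last xs)"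
  by (cases xs; cases "tl xs" rule: rev_cases) (auto simp: poset_chains_def below_refl)

lemma chain_to_bar_below:
  assumes c: "c \<in> carrier (CC n)" and F: "chain_to_bar c ps u v \<noteq> 0"
  shows "below u v"
proof -
  have "u # map snd ps \<in> poset_chains V below (Suc n)" "composable u ps v"
    using assms by (auto simp: chain_to_bar_def chain_cochains_def split: if_splits)
  moreover have "composable u ps v \<Longrightarrow> last (u # map snd ps) = v" by (induction ps arbitrary: u) auto
  ultimately show ?thesis using chain_below[of "u # map snd ps"] by simp
qed

lemma chain_to_bar_cong:
  assumes "ps \<in> bar_tuples n" "below u v" "\<And>xs. xs \<in> poset_chains V below (Suc n) \<Longrightarrow> c xs = c' xs"
  shows "chain_to_bar c ps u v = chain_to_bar c' ps u v"
  using assms chain_iff_composable below_V by (auto simp: chain_to_bar_def)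

lemma restrict_to_chains_linear: "linear_map (HC n) (CC n) (restrict_to_chains n)"
  by (auto simp: linear_map_def chain_cochains_def restrict_to_chains_def coeffs_def HC_ops bar_tuples_map HC_closed co_add co_smult)

lemma composable_part_coeffs:
  assumes "ps \<in> bar_tuples n" "below u v"
  shows "composable_part (coeffs n f) ps u v = chain_to_bar (restrict_to_chains n f) ps u v"
  unfolding composable_eq_chain_to_bar
  by (rule chain_to_bar_cong[OF assms]) (simp add: restrict_to_chains_def)

text \<open>
  Restriction to chains is a map of complexes because the projection onto composable arguments is one.
\<close>

lemma restrict_to_chains_\<delta>:
  assumes f: "f \<in> carrier (HC n)"
  shows "restrict_to_chains (Suc n) (\<delta> n f) = dC n (restrict_to_chains n f)"
proof
  fix xs
  show "restrict_to_chains (Suc n) (\<delta> n f) xs = dC n (restrict_to_chains n f) xs"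
  proof (cases "xs \<in> poset_chains V below (Suc (Suc n))")
    case True
    let ?ps = "zip xs (tl xs)" and ?u = "hd xs" and ?v = "last xs"
    let ?c = "\<lambda>xs. coeffs n f (zip xs (tl xs)) (hd xs) (last xs)"
    note ps = chain_bar_tuple[OF True]
    have "length ?ps = Suc n" using ps unfolding bar_tuples_def by blast
    then have ne: "?ps \<noteq> []" "xs \<noteq> []" by force+
    have comp: "composable ?u ?ps ?v" using chain_to_bar_zip[OF ne(2), of "\<lambda>_. 1 :: 'k"] by (auto simp: chain_to_bar_def split: if_splits)
    have "restrict_to_chains (Suc n) (\<delta> n f) xs = bar_coboundary (coeffs n f) ?ps ?u ?v"
      using True by (simp add: restrict_to_chains_def coeffs_\<delta>[OF f ps])
    also have "\<dots> = composable_part (bar_coboundary (coeffs n f)) ?ps ?u ?v" using comp by (simp add: composable_part_def)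
    also have "\<dots> = bar_coboundary (composable_part (coeffs n f)) ?ps ?u ?v" by (rule bar_coboundary_composable_part[OF ne(1), symmetric])
    also have "composable_part (coeffs n f) = chain_to_bar ?c" by (intro ext composable_eq_chain_to_bar)
    also have "bar_coboundary (chain_to_bar ?c) ?ps ?u ?v = deletions ?c xs"
      using ne by (simp add: bar_coboundary_chain chain_to_bar_zip)
    also have "\<dots> = deletions (restrict_to_chains n f) xs"
    proof (rule deletions_cong)
      fix ys zs x assume "xs = ys @ x # zs"
      then show "?c (ys @ zs) = restrict_to_chains n f (ys @ zs)"
        using True poset_chains_delete[of ys x zs V below "Suc n"] by (simp add: restrict_to_chains_def)
    qed
    finally show ?thesis using True by (simp add: chain_coboundary_def)
  qed (simp add: restrict_to_chains_def chain_coboundary_def)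
qed

text \<open>
  Hochschild cohomology of an incidence algebra is the cohomology of the nerve of the underlying
  (pre)order.  A cocycle differs from its composable part by the coboundary of its contraction, so
  passing to the values on chains loses nothing; conversely every cochain on chains extends by zero.
\<close>

theorem HH_isomorphic_chain_cohomology:
  "isomorphic_spaces (HH A (Suc n)) (cohomology CC dC (Suc n))"
  unfolding HH_def
proof (rule isomorphic_cohomology[OF HC_complex chain_cochain_complex restrict_to_chains_linear])
  fix f assume f: "f \<in> carrier (HC (Suc n))" and df: "\<delta> (Suc n) f = \<zero>\<^bsub>HC (Suc (Suc n))\<^esub>"
  show "dC (Suc n) (restrict_to_chains (Suc n) f) = \<zero>\<^bsub>CC (Suc (Suc n))\<^esub>"
    unfolding restrict_to_chains_\<delta>[OF f, symmetric] df
    by (rule linear_map_zero[OF HC_vector_space _ restrict_to_chains_linear]) (rule cochain_complexD[OF chain_cochain_complex])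
next
  fix f assume f: "f \<in> carrier (HC n)"
  show "restrict_to_chains (Suc n) (\<delta> n f) \<in> dC n ` carrier (CC n)"
    unfolding restrict_to_chains_\<delta>[OF f] by (rule imageI, rule linear_mapD(1)[OF restrict_to_chains_linear f])
next
  fix f c assume f: "f \<in> carrier (HC (Suc n))" and df: "\<delta> (Suc n) f = \<zero>\<^bsub>HC (Suc (Suc n))\<^esub>"
    and c0: "c \<in> carrier (CC n)" and c: "restrict_to_chains (Suc n) f = dC n c"
  let ?h = "bar_contraction (coeffs (Suc n) f)"
  \<comment> \<open>A primitive of the composable part plus the contraction is a primitive of the cocycle.\<close>
  let ?F = "\<lambda>ps u v. chain_to_bar c ps u v + ?h ps u v"
  define g where "g = multilinear_extension n (\<lambda>ps u v. ?F ps u v)"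
  have g: "g \<in> carrier (HC n)" unfolding g_def by (rule multilinear_extension_closed)
  have df0: "bar_coboundary (coeffs (Suc n) f) ps u v = 0" if "ps \<in> bar_tuples (Suc (Suc n))" for ps u v
    using coeffs_\<delta>[OF f that, of u v] that bar_tuples_map[OF that] by (simp add: df coeffs_def HC_ops co_zero)
  have "f = \<delta> n g"
  proof (rule HC_ext[OF f \<delta>_closed[OF g]])
    fix ps u v assume ps: "ps \<in> bar_tuples (Suc n)" and uv: "below u v"
    have ne: "ps \<noteq> []" using ps by (auto simp: bar_tuples_def)
    have u: "u \<in> V" using uv below_V by blast
    have "bar_contraction (bar_coboundary (coeffs (Suc n) f)) ps u v = bar_contraction (\<lambda>_ _ _. 0) ps u v"
      by (rule bar_contraction_cong_tuples[OF ps u]) (rule df0)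
    then have "coeffs (Suc n) f ps u v = chain_to_bar (restrict_to_chains (Suc n) f) ps u v + bar_coboundary ?h ps u v"
      using bar_contraction_homotopy[OF ne, of "coeffs (Suc n) f" u v] composable_part_coeffs[OF ps uv, of f]
      by (simp add: bar_contraction_def diff_eq_eq add.commute)
    also have "chain_to_bar (restrict_to_chains (Suc n) f) ps u v = bar_coboundary (chain_to_bar c) ps u v"
      unfolding c bar_coboundary_chain[OF ne] by (rule chain_to_bar_cong[OF ps uv]) (simp add: chain_coboundary_def)
    also have "\<dots> + bar_coboundary ?h ps u v = bar_coboundary ?F ps u v" by (rule bar_coboundary_add[OF ne, symmetric])
    also have "\<dots> = bar_coboundary (coeffs n g) ps u v"
    proof (rule bar_coboundary_cong_tuples[OF ps])
      fix qs u v assume qs: "qs \<in> bar_tuples n"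
      have "below u v" if "?F qs u v \<noteq> 0"
      proof (rule ccontr)
        assume *: "\<not> below u v"
        then have "coeffs (Suc n) f rs u v = 0" for rs using coeffs_below[OF f] by blast
        then have "?h qs u v = 0" by (simp add: bar_contraction_def)
        then show False using that * chain_to_bar_below[OF c0] by auto
      qed
      then show "?F qs u v = coeffs n g qs u v"
        unfolding g_def by (rule coeffs_multilinear_extension'[OF qs, symmetric])
    qed
    also have "\<dots> = coeffs (Suc n) (\<delta> n g) ps u v" by (rule coeffs_\<delta>[OF g ps, symmetric])
    finally show "coeffs (Suc n) f ps u v = coeffs (Suc n) (\<delta> n g) ps u v" .
  qed
  then show "f \<in> \<delta> n ` carrier (HC n)" using g by blast
next
  fix c assume c: "c \<in> carrier (CC (Suc n))" and dc: "dC (Suc n) c = \<zero>\<^bsub>CC (Suc (Suc n))\<^esub>"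
  define f where "f = multilinear_extension (Suc n) (chain_to_bar c)"
  have f: "f \<in> carrier (HC (Suc n))" unfolding f_def by (rule multilinear_extension_closed)
  have Tf: "coeffs (Suc n) f ps u v = chain_to_bar c ps u v" if "ps \<in> bar_tuples (Suc n)" for ps u v
    unfolding f_def by (rule coeffs_multilinear_extension'[OF that chain_to_bar_below[OF c]])
  show "\<exists>f\<in>carrier (HC (Suc n)). \<delta> (Suc n) f = \<zero>\<^bsub>HC (Suc (Suc n))\<^esub> \<and>
      (\<exists>w\<in>carrier (CC n). c = dC n w \<oplus>\<^bsub>CC (Suc n)\<^esub> restrict_to_chains (Suc n) f)"
  proof (intro bexI[OF _ f] bexI[of _ "\<zero>\<^bsub>CC n\<^esub>"] conjI)
    show "\<delta> (Suc n) f = \<zero>\<^bsub>HC (Suc (Suc n))\<^esub>"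
    proof (rule HC_ext[OF \<delta>_closed[OF f] HC_zero_closed])
      fix ps u v assume ps: "ps \<in> bar_tuples (Suc (Suc n))" and uv: "below u v"
      have ne: "ps \<noteq> []" using ps by (auto simp: bar_tuples_def)
      have "coeffs (Suc (Suc n)) (\<delta> (Suc n) f) ps u v = bar_coboundary (chain_to_bar c) ps u v"
        unfolding coeffs_\<delta>[OF f ps] by (rule bar_coboundary_cong_tuples[OF ps Tf])
      also have "\<dots> = chain_to_bar (dC (Suc n) c) ps u v"
        unfolding bar_coboundary_chain[OF ne] by (rule chain_to_bar_cong[OF ps uv]) (simp add: chain_coboundary_def)
      also have "\<dots> = 0" unfolding dc by (simp add: chain_to_bar_def chain_cochains_def)
      finally show "coeffs (Suc (Suc n)) (\<delta> (Suc n) f) ps u v = coeffs (Suc (Suc n)) \<zero>\<^bsub>HC (Suc (Suc n))\<^esub> ps u v"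
        using ps bar_tuples_map[OF ps] by (simp add: coeffs_def HC_ops co_zero)
    qed
    have "restrict_to_chains (Suc n) f = c"
    proof
      fix xs
      show "restrict_to_chains (Suc n) f xs = c xs"
      proof (cases "xs \<in> poset_chains V below (Suc (Suc n))")
        case True
        then have "xs \<noteq> []" by (auto simp: poset_chains_def)
        then show ?thesis using True chain_bar_tuple[OF True] by (simp add: restrict_to_chains_def Tf chain_to_bar_zip)
      qed (use c in \<open>auto simp: restrict_to_chains_def chain_cochains_def\<close>)
    qed
    moreover have "dC n \<zero>\<^bsub>CC n\<^esub> = \<zero>\<^bsub>CC (Suc n)\<^esub>"
      by (rule linear_map_zero[OF cochain_complexD(1)[OF chain_cochain_complex] cochain_complexD(1)[OF chain_cochain_complex] cochain_complexD(2)[OF chain_cochain_complex]])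
    ultimately show "c = dC n \<zero>\<^bsub>CC n\<^esub> \<oplus>\<^bsub>CC (Suc n)\<^esub> restrict_to_chains (Suc n) f" using c by (simp add: chain_cochains_def)
  qed (simp add: chain_cochains_def)
qed

end

section \<open>Comparison of projective resolutions\<close>

lemma rmod_hom_uminus:
  assumes f: "f \<in> rmod_hom A M N" and M: "right_module A M" and N: "right_module A N" and x: "x \<in> carrier M"
  shows "f (\<ominus>\<^bsub>M\<^esub> x) = \<ominus>\<^bsub>N\<^esub> f x"
proof -
  interpret M: right_module A M by fact
  interpret N: right_module A N by fact
  have "f (\<ominus>\<^bsub>M\<^esub> x) \<oplus>\<^bsub>N\<^esub> f x = \<zero>\<^bsub>N\<^esub>"
    using rmod_homD(2)[OF f, of "\<ominus>\<^bsub>M\<^esub> x" x] x rmod_hom_zero[OF f M N] by (simp add: M.M.l_neg)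
  then show ?thesis using rmod_homD(1)[OF f] x by (simp add: N.M.minus_equality)
qed

lemma (in right_module) act_minus:
  assumes "a \<in> carrier A" "x \<in> carrier M" shows "a \<odot>\<^bsub>M\<^esub> (\<ominus>\<^bsub>M\<^esub> x) = \<ominus>\<^bsub>M\<^esub> (a \<odot>\<^bsub>M\<^esub> x)"
proof -
  have "a \<odot>\<^bsub>M\<^esub> (\<ominus>\<^bsub>M\<^esub> x) \<oplus>\<^bsub>M\<^esub> a \<odot>\<^bsub>M\<^esub> x = \<zero>\<^bsub>M\<^esub>"
    using assms by (simp add: act_add[symmetric] M.l_neg)
  then show ?thesis using assms by (simp add: M.minus_equality act_closed)
qed

lemma free_rmod_lift:
  assumes A: "ring A" and X: "right_module A X" and Y: "right_module A Y"
    and g: "g \<in> rmod_hom A X Y" and surj: "g ` carrier X = carrier Y"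
    and f: "f \<in> rmod_hom A (free_rmod A S) Y"
  shows "\<exists>h \<in> rmod_hom A (free_rmod A S) X. \<forall>x\<in>carrier (free_rmod A S). g (h x) = f x"
proof -
  let ?F = "free_rmod A S"
  have F: "right_module A ?F" by (rule free_rmod_right_module[OF A])
  have "\<forall>s\<in>S. \<exists>x. x \<in> carrier X \<and> g x = f (basis_vector A s)"
    using rmod_homD(1)[OF f basis_vector_closed[OF A]] surj by (metis imageE)
  then obtain \<phi> where \<phi>: "\<And>s. s \<in> S \<Longrightarrow> \<phi> s \<in> carrier X \<and> g (\<phi> s) = f (basis_vector A s)" by metis
  obtain h where h: "h \<in> rmod_hom A ?F X" "\<forall>s\<in>S. h (basis_vector A s) = \<phi> s"
    using free_rmod_hom_exists[OF A X, of S \<phi>] \<phi> by auto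
  have gh: "restrict (\<lambda>x. g (h x)) (carrier ?F) \<in> rmod_hom A ?F Y" by (rule rmod_hom_compose[OF h(1) g F])
  have "g (h x) = f x" if "x \<in> carrier ?F" for x
    using free_rmod_hom_eq[OF A Y gh f _ that] \<phi> h(2) that basis_vector_closed[OF A, of _ S] by simp
  then show ?thesis using h(1) by blast
qed

text \<open>
  The definition of projectivity speaks of modules on fixed types only.  It shows that \<open>P\<close> is a direct
  summand of the free module on its carrier, and free modules lift against surjections on all types.
\<close>

lemma projective_lift:
  fixes P :: "('x, 'p) module" and X :: "('x, 'q) module" and Y :: "('x, 'r) module"
  assumes P: "projective A P" and X: "right_module A X" and Y: "right_module A Y"
    and g: "g \<in> rmod_hom A X Y" and surj: "g ` carrier X = carrier Y" and f: "f \<in> rmod_hom A P Y"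
  shows "\<exists>h \<in> rmod_hom A P X. \<forall>x\<in>carrier P. g (h x) = f x"
proof -
  have P': "right_module A P" using P by (simp add: projective_def)
  interpret P: right_module A P by fact
  have A: "ring A" by (rule P.A.ring_axioms)
  let ?F = "free_rmod A (carrier P)"
  have F: "right_module A ?F" by (rule free_rmod_right_module[OF A])
  obtain \<pi> where \<pi>: "\<pi> \<in> rmod_hom A ?F P" "\<forall>s\<in>carrier P. \<pi> (basis_vector A s) = s"
    using free_rmod_hom_exists[OF A P', of "carrier P" "\<lambda>x. x"] by auto
  have "\<pi> ` carrier ?F = carrier P"
  proof (intro equalityI subsetI)
    fix x assume x: "x \<in> carrier P"
    show "x \<in> \<pi> ` carrier ?F"
      by (rule image_eqI[where f = \<pi>, OF bspec[OF \<pi>(2) x, symmetric]]) (rule basis_vector_closed[OF A x])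
  qed (use rmod_homD(1)[OF \<pi>(1)] in blast)
  moreover have "restrict (\<lambda>x. x) (carrier P) \<in> rmod_hom A P P"
    by (rule rmod_homI[OF _ _ _ P']) auto
  ultimately have "\<exists>s\<in>rmod_hom A P ?F. \<forall>x\<in>carrier P. \<pi> (s x) = restrict (\<lambda>x. x) (carrier P) x"
    using P[unfolded projective_def, THEN conjunct2, rule_format, of ?F P \<pi>] F P' \<pi>(1) by blast
  then obtain s where s: "s \<in> rmod_hom A P ?F" "\<forall>x\<in>carrier P. \<pi> (s x) = x"
    by auto
  have "restrict (\<lambda>x. f (\<pi> x)) (carrier ?F) \<in> rmod_hom A ?F Y" by (rule rmod_hom_compose[OF \<pi>(1) f F])
  from free_rmod_lift[OF A X Y g surj this]
  obtain h where h: "h \<in> rmod_hom A ?F X" "\<forall>x\<in>carrier ?F. g (h x) = f (\<pi> x)" by auto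
  have "restrict (\<lambda>x. h (s x)) (carrier P) \<in> rmod_hom A P X" by (rule rmod_hom_compose[OF s(1) h(1) P'])
  moreover have "g (h (s x)) = f x" if "x \<in> carrier P" for x
    using h(2) s rmod_homD(1)[OF s(1) that] that by simp
  ultimately show ?thesis by (intro bexI[of _ "restrict (\<lambda>x. h (s x)) (carrier P)"]) auto
qed

lemma projective_retract_of_free:
  fixes P :: "('x, 'p) module"
  assumes A: "ring A" and P: "right_module A P"
    and i: "i \<in> rmod_hom A P (free_rmod A S)" and r: "r \<in> rmod_hom A (free_rmod A S) P"
    and ri: "\<And>x. x \<in> carrier P \<Longrightarrow> r (i x) = x"
  shows "projective A P"
  unfolding projective_def
proof (intro conjI allI impI P, elim conjE)
  fix X :: "('x, 'p \<Rightarrow> 'x) module" and Y :: "('x, 'p) module" and g f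
  assume X: "right_module A X" and Y: "right_module A Y" and g: "g \<in> rmod_hom A X Y"
    and surj: "g ` carrier X = carrier Y" and f: "f \<in> rmod_hom A P Y"
  let ?F = "free_rmod A S"
  have F: "right_module A ?F" by (rule free_rmod_right_module[OF A])
  have "restrict (\<lambda>x. f (r x)) (carrier ?F) \<in> rmod_hom A ?F Y" by (rule rmod_hom_compose[OF r f F])
  from free_rmod_lift[OF A X Y g surj this]
  obtain h where h: "h \<in> rmod_hom A ?F X" "\<forall>x\<in>carrier ?F. g (h x) = f (r x)" by auto
  have "restrict (\<lambda>x. h (i x)) (carrier P) \<in> rmod_hom A P X" by (rule rmod_hom_compose[OF i h(1) P])
  moreover have "g (h (i x)) = f x" if "x \<in> carrier P" for x
    using h(2) ri[OF that] rmod_homD(1)[OF i that] by simp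
  ultimately show "\<exists>h\<in>rmod_hom A P X. \<forall>x\<in>carrier P. g (h x) = f x"
    by (intro bexI[of _ "restrict (\<lambda>x. h (i x)) (carrier P)"]) auto
qed

lemma projective_lift_exact:
  assumes P: "projective A P" and X: "right_module A X" and Y: "right_module A Y" and Z: "right_module A Z"
    and g: "g \<in> rmod_hom A X Y" and k: "k \<in> rmod_hom A Y Z" and exact: "a_kernel Y Z k = g ` carrier X"
    and f: "f \<in> rmod_hom A P Y" and kf: "\<And>x. x \<in> carrier P \<Longrightarrow> k (f x) = \<zero>\<^bsub>Z\<^esub>"
  shows "\<exists>h \<in> rmod_hom A P X. \<forall>x\<in>carrier P. g (h x) = f x"
proof (rule projective_lift[OF P X kernel_right_module[OF Y Z k]])
  have ker: "a_kernel Y Z k = {y \<in> carrier Y. k y = \<zero>\<^bsub>Z\<^esub>}" by (auto simp: a_kernel_def kernel_def)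
  have "g x \<in> a_kernel Y Z k" if "x \<in> carrier X" for x using exact that by blast
  then show "g \<in> rmod_hom A X (Y\<lparr>carrier := a_kernel Y Z k\<rparr>)"
    using g by (auto simp: rmod_hom_def PiE_iff)
  show "f \<in> rmod_hom A P (Y\<lparr>carrier := a_kernel Y Z k\<rparr>)"
    using f kf by (auto simp: rmod_hom_def PiE_iff ker)
qed (simp add: exact)

locale resolution =
  fixes A :: "('x, 'r) ring_scheme" and M :: "('x, 'm) module" and P :: "nat \<Rightarrow> ('x, 'p) module" and d \<epsilon>
  assumes res: "projective_resolution A M P d \<epsilon>"
begin

lemma M_module: "right_module A M"
  and P_projective: "projective A (P n)"
  and aug_hom: "\<epsilon> \<in> rmod_hom A (P 0) M"
  and diff_hom: "d n \<in> rmod_hom A (P (Suc n)) (P n)"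
  and aug_surj: "\<epsilon> ` carrier (P 0) = carrier M"
  and aug_kernel: "a_kernel (P 0) M \<epsilon> = d 0 ` carrier (P 1)"
  and diff_kernel: "a_kernel (P (Suc n)) (P n) (d n) = d (Suc n) ` carrier (P (Suc (Suc n)))"
  using res by (simp_all add: projective_resolution_def)

lemma P_module: "right_module A (P n)"
  using P_projective by (simp add: projective_def)

text \<open>
  The kernel of the outgoing map of the augmented complex, uniformly in the degree.
\<close>

definition boundary_zero :: "nat \<Rightarrow> 'p \<Rightarrow> bool" where
  "boundary_zero n x = (case n of 0 \<Rightarrow> \<epsilon> x = \<zero>\<^bsub>M\<^esub> | Suc m \<Rightarrow> d m x = \<zero>\<^bsub>P m\<^esub>)"

lemma boundary_zero_diff: "x \<in> carrier (P (Suc n)) \<Longrightarrow> boundary_zero n (d n x)"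
proof (cases n)
  case 0
  assume "x \<in> carrier (P (Suc n))"
  then have "d 0 x \<in> a_kernel (P 0) M \<epsilon>" using aug_kernel 0 by auto
  then show ?thesis using 0 by (simp add: boundary_zero_def a_kernel_def kernel_def)
next
  case (Suc m)
  assume "x \<in> carrier (P (Suc n))"
  then have "d n x \<in> a_kernel (P n) (P m) (d m)" using diff_kernel[of m] Suc by auto
  then show ?thesis using Suc by (simp add: boundary_zero_def a_kernel_def kernel_def)
qed

lemma diff_diff: "x \<in> carrier (P (Suc (Suc n))) \<Longrightarrow> d n (d (Suc n) x) = \<zero>\<^bsub>P n\<^esub>"
  using boundary_zero_diff[of x "Suc n"] by (simp add: boundary_zero_def)

lemma lift:
  assumes R: "projective A R" and f: "f \<in> rmod_hom A R (P n)"
    and z: "\<And>x. x \<in> carrier R \<Longrightarrow> boundary_zero n (f x)"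
  shows "\<exists>h \<in> rmod_hom A R (P (Suc n)). \<forall>x\<in>carrier R. d n (h x) = f x"
proof (cases n)
  case 0
  show ?thesis unfolding 0
    by (rule projective_lift_exact[OF R P_module P_module M_module diff_hom aug_hom])
      (use aug_kernel f z 0 in \<open>auto simp: boundary_zero_def\<close>)
next
  case (Suc m)
  show ?thesis unfolding Suc
    by (rule projective_lift_exact[OF R P_module P_module P_module diff_hom diff_hom])
      (use diff_kernel f z Suc in \<open>auto simp: boundary_zero_def\<close>)
qed

end

lemma rmod_hom_diff:
  assumes f: "f \<in> rmod_hom A M N" and g: "g \<in> rmod_hom A M N" and M: "right_module A M" and N: "right_module A N"
  shows "restrict (\<lambda>x. f x \<oplus>\<^bsub>N\<^esub> \<ominus>\<^bsub>N\<^esub> g x) (carrier M) \<in> rmod_hom A M N"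
proof -
  interpret N: right_module A N by fact
  note fg = rmod_homD[OF f] rmod_homD[OF g]
  show ?thesis
    by (rule rmod_homI[OF _ _ _ M]) (simp_all add: fg N.M.minus_add N.M.a_ac N.act_add N.act_minus N.act_closed)
qed

locale two_resolutions = P: resolution A M P d \<epsilon> + P': resolution A M P' d' \<epsilon>'
  for A :: "('x, 'r) ring_scheme" and M :: "('x, 'm) module"
    and P :: "nat \<Rightarrow> ('x, 'p) module" and d \<epsilon> and P' :: "nat \<Rightarrow> ('x, 'q) module" and d' \<epsilon>'
begin

definition chain_map :: "(nat \<Rightarrow> 'p \<Rightarrow> 'q) \<Rightarrow> bool" where
  "chain_map F \<longleftrightarrow> (\<forall>n. F n \<in> rmod_hom A (P n) (P' n)) \<and> (\<forall>x\<in>carrier (P 0). \<epsilon>' (F 0 x) = \<epsilon> x) \<and>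
     (\<forall>n. \<forall>x\<in>carrier (P (Suc n)). d' n (F (Suc n) x) = F n (d n x))"

lemma chain_mapD:
  assumes "chain_map F"
  shows "F n \<in> rmod_hom A (P n) (P' n)" "x \<in> carrier (P 0) \<Longrightarrow> \<epsilon>' (F 0 x) = \<epsilon> x"
    "x \<in> carrier (P (Suc n)) \<Longrightarrow> d' n (F (Suc n) x) = F n (d n x)"
  using assms by (auto simp: chain_map_def)

text \<open>
  The comparison theorem: degree by degree, the composite of the previous map with the differential
  takes values in a kernel, which is an image by exactness, and lifts.  The invariant says that each map
  preserves kernels, which is all that the next step uses.
\<close>

lemma chain_map_exists: "\<exists>F. chain_map F"
proof -
  define I where "I n F \<longleftrightarrow> F \<in> rmod_hom A (P n) (P' n) \<and> (n = 0 \<longrightarrow> (\<forall>x\<in>carrier (P 0). \<epsilon>' (F x) = \<epsilon> x)) \<and>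
    (\<forall>x\<in>carrier (P n). P.boundary_zero n x \<longrightarrow> P'.boundary_zero n (F x))" for n F
  obtain F0 where F0: "F0 \<in> rmod_hom A (P 0) (P' 0)" "\<forall>x\<in>carrier (P 0). \<epsilon>' (F0 x) = \<epsilon> x"
    using projective_lift[OF P.P_projective P'.P_module P.M_module P'.aug_hom P'.aug_surj P.aug_hom] by blast
  have "\<exists>F. \<forall>n. I n (F n) \<and> (\<forall>x\<in>carrier (P (Suc n)). d' n (F (Suc n) x) = F n (d n x))"
  proof (rule dependent_nat_choice)
    show "\<exists>F. I 0 F" using F0 by (auto simp: I_def P.boundary_zero_def P'.boundary_zero_def)
  next
    fix F n assume F: "I n F"
    have Fh: "F \<in> rmod_hom A (P n) (P' n)" using F by (simp add: I_def)
    have "restrict (\<lambda>x. F (d n x)) (carrier (P (Suc n))) \<in> rmod_hom A (P (Suc n)) (P' n)"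
      by (rule rmod_hom_compose[OF P.diff_hom Fh P.P_module])
    moreover have "P'.boundary_zero n (F (d n x))" if "x \<in> carrier (P (Suc n))" for x
      using F that P.boundary_zero_diff[OF that] rmod_homD(1)[OF P.diff_hom that] by (simp add: I_def)
    ultimately obtain G where G: "G \<in> rmod_hom A (P (Suc n)) (P' (Suc n))" "\<forall>x\<in>carrier (P (Suc n)). d' n (G x) = F (d n x)"
      using P'.lift[OF P.P_projective, of "restrict (\<lambda>x. F (d n x)) (carrier (P (Suc n)))" "Suc n" n] by auto
    have "I (Suc n) G"
      using G rmod_hom_zero[OF Fh P.P_module P'.P_module] by (auto simp: I_def P.boundary_zero_def P'.boundary_zero_def)
    then show "\<exists>G. I (Suc n) G \<and> (\<forall>x\<in>carrier (P (Suc n)). d' n (G x) = F (d n x))" using G by blast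
  qed
  then obtain F where "\<And>n. I n (F n)" "\<And>n. \<forall>x\<in>carrier (P (Suc n)). d' n (F (Suc n) x) = F n (d n x)" by blast
  then show ?thesis by (auto simp: chain_map_def I_def)
qed

text \<open>
  Two lifts of the identity are homotopic.  The invariant on \<open>s\<close> is the homotopy formula restricted to
  the kernel, where its second summand vanishes; at elements \<open>d n x\<close> it shows that the next obstruction
  is again in a kernel.
\<close>

lemma chain_homotopy_exists:
  assumes U: "chain_map U" and V: "chain_map V"
  shows "\<exists>s. (\<forall>n. s n \<in> rmod_hom A (P n) (P' (Suc n))) \<and>
    (\<forall>n. \<forall>x\<in>carrier (P (Suc n)). U (Suc n) x = V (Suc n) x \<oplus>\<^bsub>P' (Suc n)\<^esub> (d' (Suc n) (s (Suc n) x) \<oplus>\<^bsub>P' (Suc n)\<^esub> s n (d n x)))"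
proof -
  note U = chain_mapD[OF U] and V = chain_mapD[OF V]
  let ?D = "\<lambda>n x. U n x \<oplus>\<^bsub>P' n\<^esub> \<ominus>\<^bsub>P' n\<^esub> V n x"
  have UV: "restrict (?D n) (carrier (P n)) \<in> rmod_hom A (P n) (P' n)" for n
    by (rule rmod_hom_diff[OF U(1) V(1) P.P_module P'.P_module])
  interpret M: right_module A M by (rule P.M_module)
  interpret Q: right_module A "P' n" for n by (rule P'.P_module)
  define I where "I n s \<longleftrightarrow> s \<in> rmod_hom A (P n) (P' (Suc n)) \<and>
    (\<forall>x\<in>carrier (P n). P.boundary_zero n x \<longrightarrow> d' n (s x) = ?D n x)" for n s
  have "\<exists>s. \<forall>n. I n (s n) \<and> (\<forall>x\<in>carrier (P (Suc n)). d' (Suc n) (s (Suc n) x) = ?D (Suc n) x \<oplus>\<^bsub>P' (Suc n)\<^esub> \<ominus>\<^bsub>P' (Suc n)\<^esub> s n (d n x))"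
  proof (rule dependent_nat_choice)
    have "P'.boundary_zero 0 (?D 0 x)" if x: "x \<in> carrier (P 0)" for x
      using x rmod_homD(1)[OF U(1) x] rmod_homD(1)[OF V(1) x] rmod_homD(1)[OF P.aug_hom x]
      by (simp add: P'.boundary_zero_def rmod_homD(2)[OF P'.aug_hom] rmod_hom_uminus[OF P'.aug_hom P'.P_module P.M_module] U V M.M.r_neg)
    then have "\<exists>h \<in> rmod_hom A (P 0) (P' (Suc 0)). \<forall>x\<in>carrier (P 0). d' 0 (h x) = restrict (?D 0) (carrier (P 0)) x"
      by (intro P'.lift[OF P.P_projective UV]) simp
    then show "\<exists>s. I 0 s" by (auto simp: I_def)
  next
    fix s n assume s: "I n s"
    then have sh: "s \<in> rmod_hom A (P n) (P' (Suc n))" by (simp add: I_def)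
    have sd: "restrict (\<lambda>x. s (d n x)) (carrier (P (Suc n))) \<in> rmod_hom A (P (Suc n)) (P' (Suc n))"
      by (rule rmod_hom_compose[OF P.diff_hom sh P.P_module])
    let ?f = "\<lambda>x. ?D (Suc n) x \<oplus>\<^bsub>P' (Suc n)\<^esub> \<ominus>\<^bsub>P' (Suc n)\<^esub> s (d n x)"
    have f: "restrict ?f (carrier (P (Suc n))) \<in> rmod_hom A (P (Suc n)) (P' (Suc n))"
      using rmod_hom_diff[OF UV[of "Suc n"] sd P.P_module P'.P_module] by (simp cong: restrict_cong)
    have "P'.boundary_zero (Suc n) (?f x)" if x: "x \<in> carrier (P (Suc n))" for x
    proof -
      have c: "U (Suc n) x \<in> carrier (P' (Suc n))" "V (Suc n) x \<in> carrier (P' (Suc n))" "d n x \<in> carrier (P n)"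
        using rmod_homD(1)[OF U(1) x] rmod_homD(1)[OF V(1) x] rmod_homD(1)[OF P.diff_hom x] by auto
      have c': "s (d n x) \<in> carrier (P' (Suc n))" "U n (d n x) \<in> carrier (P' n)" "V n (d n x) \<in> carrier (P' n)"
        using rmod_homD(1)[OF sh c(3)] rmod_homD(1)[OF U(1) c(3)] rmod_homD(1)[OF V(1) c(3)] by auto
      have "d' n (s (d n x)) = ?D n (d n x)"
        using s c(3) P.boundary_zero_diff[OF x] by (simp add: I_def)
      then have "d' n (?f x) = ?D n (d n x) \<oplus>\<^bsub>P' n\<^esub> \<ominus>\<^bsub>P' n\<^esub> ?D n (d n x)"
        using c c' x by (simp add: rmod_homD(2)[OF P'.diff_hom] rmod_hom_uminus[OF P'.diff_hom P'.P_module P'.P_module] U V)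
      also have "\<dots> = \<zero>\<^bsub>P' n\<^esub>" using c' by (intro Q.M.r_neg) simp
      finally show ?thesis by (simp add: P'.boundary_zero_def)
    qed
    then have "\<exists>h \<in> rmod_hom A (P (Suc n)) (P' (Suc (Suc n))). \<forall>x\<in>carrier (P (Suc n)). d' (Suc n) (h x) = restrict ?f (carrier (P (Suc n))) x"
      by (intro P'.lift[OF P.P_projective f]) simp
    then obtain h where h: "h \<in> rmod_hom A (P (Suc n)) (P' (Suc (Suc n)))" "\<forall>x\<in>carrier (P (Suc n)). d' (Suc n) (h x) = ?f x" by auto
    have "I (Suc n) h"
      using h rmod_hom_zero[OF sh P.P_module P'.P_module] rmod_homD(1)[OF U(1)] rmod_homD(1)[OF V(1)]
      by (auto simp: I_def P.boundary_zero_def)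
    then show "\<exists>h. I (Suc n) h \<and> (\<forall>x\<in>carrier (P (Suc n)). d' (Suc n) (h x) = ?f x)" using h by blast
  qed
  then obtain s where s: "\<And>n. s n \<in> rmod_hom A (P n) (P' (Suc n))"
    "\<And>n x. x \<in> carrier (P (Suc n)) \<Longrightarrow> d' (Suc n) (s (Suc n) x) = ?D (Suc n) x \<oplus>\<^bsub>P' (Suc n)\<^esub> \<ominus>\<^bsub>P' (Suc n)\<^esub> s n (d n x)"
    unfolding I_def by blast
  have "U (Suc n) x = V (Suc n) x \<oplus>\<^bsub>P' (Suc n)\<^esub> (d' (Suc n) (s (Suc n) x) \<oplus>\<^bsub>P' (Suc n)\<^esub> s n (d n x))"
    if x: "x \<in> carrier (P (Suc n))" for n x
  proof -
    have c: "U (Suc n) x \<in> carrier (P' (Suc n))" "V (Suc n) x \<in> carrier (P' (Suc n))" "s n (d n x) \<in> carrier (P' (Suc n))"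
      using rmod_homD(1)[OF U(1) x] rmod_homD(1)[OF V(1) x] rmod_homD(1)[OF s(1) rmod_homD(1)[OF P.diff_hom x]] by auto
    have "d' (Suc n) (s (Suc n) x) \<oplus>\<^bsub>P' (Suc n)\<^esub> s n (d n x) = ?D (Suc n) x"
      using c by (simp add: s(2)[OF x] Q.M.a_assoc Q.M.l_neg)
    moreover have "V (Suc n) x \<oplus>\<^bsub>P' (Suc n)\<^esub> ?D (Suc n) x = U (Suc n) x"
      using c by (simp add: Q.M.a_lcomm[of "V (Suc n) x"] Q.M.r_neg)
    ultimately show ?thesis by simp
  qed
  then show ?thesis using s(1) by blast
qed

end

lemma rmod_hom_eqI:
  "\<lbrakk>f \<in> rmod_hom A M N; g \<in> rmod_hom A M N; \<And>x. x \<in> carrier M \<Longrightarrow> f x = g x\<rbrakk> \<Longrightarrow> f = g"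
  by (auto simp: rmod_hom_def intro: PiE_ext)

lemma rmod_hom_ext_eq: "f \<in> rmod_hom A M N \<Longrightarrow> restrict f (carrier M) = f"
  by (auto simp: rmod_hom_def PiE_iff extensional_restrict)

lemma rmod_hom_minus:
  assumes f: "f \<in> rmod_hom A M N" and M: "right_module A M" and N: "right_module A N"
  shows "restrict (\<lambda>x. \<ominus>\<^bsub>N\<^esub> f x) (carrier M) \<in> rmod_hom A M N"
proof -
  interpret N: right_module A N by fact
  show ?thesis
    by (rule rmod_homI[OF _ _ _ M]) (simp_all add: rmod_homD[OF f] N.M.minus_add N.act_minus)
qed

lemma rmod_hom_add:
  assumes f: "f \<in> rmod_hom A M N" and g: "g \<in> rmod_hom A M N" and M: "right_module A M" and N: "right_module A N"
  shows "restrict (\<lambda>x. f x \<oplus>\<^bsub>N\<^esub> g x) (carrier M) \<in> rmod_hom A M N"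
proof -
  interpret N: right_module A N by fact
  show ?thesis
    by (rule rmod_homI[OF _ _ _ M]) (simp_all add: rmod_homD[OF f] rmod_homD[OF g] N.M.a_ac N.act_add)
qed

text \<open>
  The scalars act on homomorphisms through the algebra.  Centrality makes the result a homomorphism.
\<close>

definition central_scalars :: "('k::field, 'x) module \<Rightarrow> bool" where
  "central_scalars A \<longleftrightarrow> (\<forall>c. c \<odot>\<^bsub>A\<^esub> \<one>\<^bsub>A\<^esub> \<in> carrier A \<and>
     (\<forall>a\<in>carrier A. (c \<odot>\<^bsub>A\<^esub> \<one>\<^bsub>A\<^esub>) \<otimes>\<^bsub>A\<^esub> a = a \<otimes>\<^bsub>A\<^esub> (c \<odot>\<^bsub>A\<^esub> \<one>\<^bsub>A\<^esub>)))"

lemma hom_space_simps: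
  "carrier (hom_space A M N) = rmod_hom A M N"
  "\<zero>\<^bsub>hom_space A M N\<^esub> = (\<lambda>x\<in>carrier M. \<zero>\<^bsub>N\<^esub>)"
  "f \<oplus>\<^bsub>hom_space A M N\<^esub> g = (\<lambda>x\<in>carrier M. f x \<oplus>\<^bsub>N\<^esub> g x)"
  "c \<odot>\<^bsub>hom_space A M N\<^esub> f = (\<lambda>x\<in>carrier M. (c \<odot>\<^bsub>A\<^esub> \<one>\<^bsub>A\<^esub>) \<odot>\<^bsub>N\<^esub> f x)"
  by (simp_all add: hom_space_def)

lemma hom_space_vector_space:
  fixes A :: "('k::field, 'x) module"
  assumes A: "central_scalars A" and M: "right_module A M" and N: "right_module A N"
  shows "vector_space_record (hom_space A M N)"
proof -
  interpret M: right_module A M by fact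
  interpret N: right_module A N by fact
  have c: "c \<odot>\<^bsub>A\<^esub> \<one>\<^bsub>A\<^esub> \<in> carrier A" and comm: "a \<in> carrier A \<Longrightarrow> (c \<odot>\<^bsub>A\<^esub> \<one>\<^bsub>A\<^esub>) \<otimes>\<^bsub>A\<^esub> a = a \<otimes>\<^bsub>A\<^esub> (c \<odot>\<^bsub>A\<^esub> \<one>\<^bsub>A\<^esub>)" for c a
    using A by (auto simp: central_scalars_def)
  have zero: "(\<lambda>x\<in>carrier M. \<zero>\<^bsub>N\<^esub>) \<in> rmod_hom A M N"
    by (rule rmod_homI[OF _ _ _ M]) simp_all
  have sm: "(\<lambda>x\<in>carrier M. (c \<odot>\<^bsub>A\<^esub> \<one>\<^bsub>A\<^esub>) \<odot>\<^bsub>N\<^esub> f x) \<in> rmod_hom A M N" if f: "f \<in> rmod_hom A M N" for f c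
  proof (rule rmod_homI[OF _ _ _ M])
    fix a x assume ax: "a \<in> carrier A" "x \<in> carrier M"
    have "(c \<odot>\<^bsub>A\<^esub> \<one>\<^bsub>A\<^esub>) \<odot>\<^bsub>N\<^esub> (a \<odot>\<^bsub>N\<^esub> f x) = a \<odot>\<^bsub>N\<^esub> ((c \<odot>\<^bsub>A\<^esub> \<one>\<^bsub>A\<^esub>) \<odot>\<^bsub>N\<^esub> f x)"
      using N.act_mult[OF ax(1) c, of "f x" c] N.act_mult[OF c ax(1), of "f x" c] comm[OF ax(1), of c] rmod_homD(1)[OF f ax(2)] by simp
    then show "(c \<odot>\<^bsub>A\<^esub> \<one>\<^bsub>A\<^esub>) \<odot>\<^bsub>N\<^esub> f (a \<odot>\<^bsub>M\<^esub> x) = a \<odot>\<^bsub>N\<^esub> ((c \<odot>\<^bsub>A\<^esub> \<one>\<^bsub>A\<^esub>) \<odot>\<^bsub>N\<^esub> f x)"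
      using ax by (simp add: rmod_homD[OF f])
  qed (simp_all add: rmod_homD[OF f] c N.act_closed N.act_add)
  have "abelian_group (hom_space A M N)"
  proof (rule abelian_groupI; unfold hom_space_simps)
    fix f g assume f: "f \<in> rmod_hom A M N" and g: "g \<in> rmod_hom A M N"
    show "(\<lambda>x\<in>carrier M. f x \<oplus>\<^bsub>N\<^esub> g x) \<in> rmod_hom A M N" by (rule rmod_hom_add[OF f g M N])
    show "(\<lambda>x\<in>carrier M. f x \<oplus>\<^bsub>N\<^esub> g x) = (\<lambda>x\<in>carrier M. g x \<oplus>\<^bsub>N\<^esub> f x)"
      by (rule restrict_ext) (simp add: rmod_homD[OF f] rmod_homD[OF g] N.M.a_comm)
    fix h assume h: "h \<in> rmod_hom A M N"
    show "(\<lambda>x\<in>carrier M. (\<lambda>x\<in>carrier M. f x \<oplus>\<^bsub>N\<^esub> g x) x \<oplus>\<^bsub>N\<^esub> h x) = (\<lambda>x\<in>carrier M. f x \<oplus>\<^bsub>N\<^esub> (\<lambda>x\<in>carrier M. g x \<oplus>\<^bsub>N\<^esub> h x) x)"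
      by (rule restrict_ext) (simp add: rmod_homD[OF f] rmod_homD[OF g] rmod_homD[OF h] N.M.a_assoc)
  next
    fix f assume f: "f \<in> rmod_hom A M N"
    have "(\<lambda>x\<in>carrier M. (\<lambda>x\<in>carrier M. \<zero>\<^bsub>N\<^esub>) x \<oplus>\<^bsub>N\<^esub> f x) = restrict f (carrier M)"
      by (rule restrict_ext) (simp add: rmod_homD[OF f])
    then show "(\<lambda>x\<in>carrier M. (\<lambda>x\<in>carrier M. \<zero>\<^bsub>N\<^esub>) x \<oplus>\<^bsub>N\<^esub> f x) = f"
      using rmod_hom_ext_eq[OF f] by simp
    show "\<exists>y\<in>rmod_hom A M N. (\<lambda>x\<in>carrier M. y x \<oplus>\<^bsub>N\<^esub> f x) = (\<lambda>x\<in>carrier M. \<zero>\<^bsub>N\<^esub>)"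
      by (rule bexI[OF _ rmod_hom_minus[OF f M N]], rule restrict_ext) (simp add: rmod_homD[OF f] N.M.l_neg)
  qed (rule zero)
  note ag = this
  show ?thesis
  proof (rule vector_space_record.intro[OF ag], rule vector_space_record_axioms.intro; unfold hom_space_simps)
    fix f g c assume f: "f \<in> rmod_hom A M N" and g: "g \<in> rmod_hom A M N"
    show "(\<lambda>x\<in>carrier M. (c \<odot>\<^bsub>A\<^esub> \<one>\<^bsub>A\<^esub>) \<odot>\<^bsub>N\<^esub> (\<lambda>x\<in>carrier M. f x \<oplus>\<^bsub>N\<^esub> g x) x) =
       (\<lambda>x\<in>carrier M. (\<lambda>x\<in>carrier M. (c \<odot>\<^bsub>A\<^esub> \<one>\<^bsub>A\<^esub>) \<odot>\<^bsub>N\<^esub> f x) x \<oplus>\<^bsub>N\<^esub> (\<lambda>x\<in>carrier M. (c \<odot>\<^bsub>A\<^esub> \<one>\<^bsub>A\<^esub>) \<odot>\<^bsub>N\<^esub> g x) x)"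
      by (rule restrict_ext) (simp add: rmod_homD[OF f] rmod_homD[OF g] c N.act_add)
  qed (rule sm)
qed

lemma precompose_hom:
  assumes "g \<in> rmod_hom A L M" "f \<in> rmod_hom A M N" "right_module A L"
  shows "compose (carrier L) f g \<in> rmod_hom A L N"
  using rmod_hom_compose[OF assms] by (simp add: compose_def)

lemma precompose_linear:
  fixes A :: "('k::field, 'x) module"
  assumes A: "central_scalars A" and g: "g \<in> rmod_hom A L M" and L: "right_module A L"
  shows "linear_map (hom_space A M N) (hom_space A L N) (\<lambda>f. compose (carrier L) f g)"
  unfolding linear_map_def hom_space_simps
  by (auto simp: compose_def rmod_homD[OF g] intro!: restrict_ext rmod_hom_compose[OF g _ L])

lemma (in resolution) hom_complex:
  fixes N :: "('x, 'n) module"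
  assumes N: "right_module A N" and vs: "\<And>n. vector_space_record (C n)"
    and lin: "\<And>n. linear_map (C n) (C (Suc n)) (\<lambda>f. compose (carrier (P (Suc n))) f (d n))"
    and C: "\<And>n. carrier (C n) = rmod_hom A (P n) N" "\<And>n. \<zero>\<^bsub>C n\<^esub> = (\<lambda>x\<in>carrier (P n). \<zero>\<^bsub>N\<^esub>)"
  shows "cochain_complex C (\<lambda>n f. compose (carrier (P (Suc n))) f (d n))"
  unfolding cochain_complex_def
proof (intro allI conjI vs lin ballI)
  fix n f assume "f \<in> carrier (C n)"
  then have f: "f \<in> rmod_hom A (P n) N" by (simp add: C)
  show "compose (carrier (P (Suc (Suc n)))) (compose (carrier (P (Suc n))) f (d n)) (d (Suc n)) = \<zero>\<^bsub>C (Suc (Suc n))\<^esub>"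
    unfolding C compose_def
    by (rule restrict_ext) (simp add: rmod_homD(1)[OF diff_hom] diff_diff rmod_hom_zero[OF f P_module N])
qed

lemma Ext_complex:
  fixes A :: "('k::field, 'x) module"
  assumes A: "central_scalars A" and P: "projective_resolution A M P d \<epsilon>" and N: "right_module A N"
  shows "cochain_complex (\<lambda>i. hom_space A (P i) N) (\<lambda>i f. compose (carrier (P (Suc i))) f (d i))"
proof -
  interpret resolution A M P d \<epsilon> by (rule resolution.intro[OF P])
  show ?thesis
    by (rule hom_complex[OF N])
      (auto simp: hom_space_simps intro!: hom_space_vector_space[OF A P_module N] precompose_linear[OF A diff_hom P_module])
qed

text \<open>
  Chain maps in both directions exist, and their composites are homotopic to the identity.  The
  homotopies give injectivity and surjectivity on cohomology.
\<close>

theorem Ext_independent_of_resolution: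
  fixes A :: "('k::field, 'x) module"
  assumes A: "central_scalars A" and N: "right_module A N"
    and P: "projective_resolution A M P d \<epsilon>" and P': "projective_resolution A M P' d' \<epsilon>'"
  shows "isomorphic_spaces (Ext_via A P' d' N (Suc n)) (Ext_via A P d N (Suc n))"
proof -
  interpret PP: two_resolutions A M P d \<epsilon> P' d' \<epsilon>' by (intro two_resolutions.intro resolution.intro P P')
  interpret PP': two_resolutions A M P' d' \<epsilon>' P d \<epsilon> by (intro two_resolutions.intro resolution.intro P P')
  interpret P0: two_resolutions A M P d \<epsilon> P d \<epsilon> by (intro two_resolutions.intro resolution.intro P P')
  interpret P1: two_resolutions A M P' d' \<epsilon>' P' d' \<epsilon>' by (intro two_resolutions.intro resolution.intro P P')
  interpret N: right_module A N by fact
  obtain F where F0: "PP.chain_map F" using PP.chain_map_exists by blast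
  obtain G where G0: "PP'.chain_map G" using PP'.chain_map_exists by blast
  note F = PP.chain_mapD[OF F0] and G = PP'.chain_mapD[OF G0]
  note Fc = rmod_homD(1)[OF F(1)] and Gc = rmod_homD(1)[OF G(1)]
  have id: "P0.chain_map (\<lambda>n. restrict (\<lambda>x. x) (carrier (P n)))"
    by (auto simp: P0.chain_map_def rmod_homD(1)[OF PP.P.diff_hom] intro!: rmod_homI PP.P.P_module)
  have id': "P1.chain_map (\<lambda>n. restrict (\<lambda>x. x) (carrier (P' n)))"
    by (auto simp: P1.chain_map_def rmod_homD(1)[OF PP.P'.diff_hom] intro!: rmod_homI PP.P'.P_module)
  have GF: "P0.chain_map (\<lambda>n. restrict (\<lambda>x. G n (F n x)) (carrier (P n)))"
    by (auto simp: P0.chain_map_def rmod_homD(1)[OF PP.P.diff_hom] F(2,3) G(2,3) Fc intro!: rmod_hom_compose[OF F(1) G(1)] PP.P.P_module)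
  have FG: "P1.chain_map (\<lambda>n. restrict (\<lambda>x. F n (G n x)) (carrier (P' n)))"
    by (auto simp: P1.chain_map_def rmod_homD(1)[OF PP.P'.diff_hom] F(2,3) G(2,3) Gc intro!: rmod_hom_compose[OF G(1) F(1)] PP.P'.P_module)
  obtain s where s: "\<And>n. s n \<in> rmod_hom A (P n) (P (Suc n))"
    "\<And>n x. x \<in> carrier (P (Suc n)) \<Longrightarrow> G (Suc n) (F (Suc n) x) = x \<oplus>\<^bsub>P (Suc n)\<^esub> (d (Suc n) (s (Suc n) x) \<oplus>\<^bsub>P (Suc n)\<^esub> s n (d n x))"
    using P0.chain_homotopy_exists[OF GF id] by auto
  obtain t where t: "\<And>n. t n \<in> rmod_hom A (P' n) (P' (Suc n))"
    "\<And>n x. x \<in> carrier (P' (Suc n)) \<Longrightarrow> F (Suc n) (G (Suc n) x) = x \<oplus>\<^bsub>P' (Suc n)\<^esub> (d' (Suc n) (t (Suc n) x) \<oplus>\<^bsub>P' (Suc n)\<^esub> t n (d' n x))"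
    using P1.chain_homotopy_exists[OF FG id'] by auto
  \<comment> \<open>A cocycle kills the first summand of the homotopy, as that one factors through the next differential.\<close>
  have homotopic: "f (v x) = f x \<oplus>\<^bsub>N\<^esub> f (s n (d n x))"
    if "resolution A M P d \<epsilon>" "\<And>n. s n \<in> rmod_hom A (P n) (P (Suc n))" 
      "v x = x \<oplus>\<^bsub>P (Suc n)\<^esub> (d (Suc n) (s (Suc n) x) \<oplus>\<^bsub>P (Suc n)\<^esub> s n (d n x))"
      "x \<in> carrier (P (Suc n))" "f \<in> rmod_hom A (P (Suc n)) N"
      "compose (carrier (P (Suc (Suc n)))) f (d (Suc n)) = (\<lambda>x\<in>carrier (P (Suc (Suc n))). \<zero>\<^bsub>N\<^esub>)"
    for P :: "nat \<Rightarrow> ('x, 'z) module" and d \<epsilon> f v s x n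
  proof -
    interpret resolution A M P d \<epsilon> by fact
    interpret Q: right_module A "P i" for i by (rule P_module)
    have c: "d (Suc n) (s (Suc n) x) \<in> carrier (P (Suc n))" "s n (d n x) \<in> carrier (P (Suc n))" "s (Suc n) x \<in> carrier (P (Suc (Suc n)))"
      using that(4) by (auto intro!: rmod_homD(1)[OF diff_hom] rmod_homD(1)[OF that(2)])
    have "f (d (Suc n) (s (Suc n) x)) = \<zero>\<^bsub>N\<^esub>"
      using fun_cong[OF that(6), of "s (Suc n) x"] c(3) by (simp add: compose_def)
    then show ?thesis
      unfolding that(3) using c that(4) rmod_homD(1)[OF that(5)] by (simp add: rmod_homD(2)[OF that(5)])
  qed
  let ?C = "\<lambda>i. hom_space A (P' i) N" and ?dC = "\<lambda>i f. compose (carrier (P' (Suc i))) f (d' i)"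
  let ?D = "\<lambda>i. hom_space A (P i) N" and ?dD = "\<lambda>i f. compose (carrier (P (Suc i))) f (d i)"
  let ?\<phi> = "\<lambda>i f. compose (carrier (P i)) f (F i)"
  note dc = rmod_homD(1)[OF PP.P.diff_hom] rmod_homD(1)[OF PP.P'.diff_hom]
  have comm: "?dD i (?\<phi> i f) = ?\<phi> (Suc i) (?dC i f)" for i f
    by (auto simp: compose_def dc Fc F(3) intro!: restrict_ext)
  show ?thesis unfolding Ext_via_def
  proof (rule isomorphic_cohomology[OF Ext_complex[OF A P' N] Ext_complex[OF A P N] precompose_linear[OF A F(1) PP.P.P_module]]; unfold hom_space_simps)
    fix f assume f: "f \<in> rmod_hom A (P' (Suc n)) N" and z: "?dC (Suc n) f = (\<lambda>x\<in>carrier (P' (Suc (Suc n))). \<zero>\<^bsub>N\<^esub>)"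
    show "?dD (Suc n) (?\<phi> (Suc n) f) = (\<lambda>x\<in>carrier (P (Suc (Suc n))). \<zero>\<^bsub>N\<^esub>)"
      unfolding comm z by (auto simp: compose_def Fc)
  next
    fix f assume f: "f \<in> rmod_hom A (P' n) N"
    show "?\<phi> (Suc n) (?dC n f) \<in> ?dD n ` rmod_hom A (P n) N"
      unfolding comm[symmetric] by (rule imageI, rule precompose_hom[OF F(1) f PP.P.P_module])
  next
    fix f w assume f: "f \<in> rmod_hom A (P' (Suc n)) N" and z: "?dC (Suc n) f = (\<lambda>x\<in>carrier (P' (Suc (Suc n))). \<zero>\<^bsub>N\<^esub>)"
      and w: "w \<in> rmod_hom A (P n) N" and fw: "?\<phi> (Suc n) f = ?dD n w"
    \<comment> \<open>The homotopy formula on \<open>P'\<close>, solved for \<open>f\<close>, exhibits \<open>f\<close> as the coboundary of \<open>g\<close>.\<close>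
    define g where "g = restrict (\<lambda>x. restrict (\<lambda>x. w (G n x)) (carrier (P' n)) x \<oplus>\<^bsub>N\<^esub> \<ominus>\<^bsub>N\<^esub> restrict (\<lambda>x. f (t n x)) (carrier (P' n)) x) (carrier (P' n))"
    have g: "g \<in> rmod_hom A (P' n) N"
      unfolding g_def by (intro rmod_hom_diff rmod_hom_compose[OF G(1) w] rmod_hom_compose[OF t(1) f] PP.P'.P_module N)
    have "f = ?dC n g"
    proof (rule rmod_hom_eqI[OF f precompose_hom[OF PP.P'.diff_hom g PP.P'.P_module]])
      fix x assume x: "x \<in> carrier (P' (Suc n))"
      have c: "f x \<in> carrier N" "f (t n (d' n x)) \<in> carrier N"
        using x by (auto intro!: rmod_homD(1)[OF f] rmod_homD(1)[OF t(1)] dc)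
      have "f (F (Suc n) (G (Suc n) x)) = w (d n (G (Suc n) x))"
        using fun_cong[OF fw, of "G (Suc n) x"] Gc[OF x] by (simp add: compose_def)
      then have "w (G n (d' n x)) = f x \<oplus>\<^bsub>N\<^esub> f (t n (d' n x))"
        using homotopic[of P' d' \<epsilon>' t "\<lambda>x. F (Suc n) (G (Suc n) x)" x n f, OF PP.P'.resolution_axioms t(1) t(2)[OF x] x f z] G(3)[OF x] by simp
      then show "f x = ?dC n g x"
        using x c by (simp add: compose_def g_def dc N.M.a_assoc N.M.r_neg)
    qed
    then show "f \<in> ?dC n ` rmod_hom A (P' n) N" using g by blast
  next
    fix y assume y: "y \<in> rmod_hom A (P (Suc n)) N" and z: "?dD (Suc n) y = (\<lambda>x\<in>carrier (P (Suc (Suc n))). \<zero>\<^bsub>N\<^esub>)"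
    let ?f = "compose (carrier (P' (Suc n))) y (G (Suc n))"
    \<comment> \<open>The homotopy formula on \<open>P\<close> shows that \<open>y\<close> and \<open>y \<circ> G \<circ> F\<close> differ by the coboundary of \<open>w\<close>.\<close>
    define w where "w = restrict (\<lambda>x. \<ominus>\<^bsub>N\<^esub> restrict (\<lambda>x. y (s n x)) (carrier (P n)) x) (carrier (P n))"
    have w: "w \<in> rmod_hom A (P n) N"
      unfolding w_def by (intro rmod_hom_minus rmod_hom_compose[OF s(1) y] PP.P.P_module N)
    have "y = (\<lambda>x\<in>carrier (P (Suc n)). ?dD n w x \<oplus>\<^bsub>N\<^esub> ?\<phi> (Suc n) ?f x)"
    proof -
      have "y x = ?dD n w x \<oplus>\<^bsub>N\<^esub> ?\<phi> (Suc n) ?f x" if x: "x \<in> carrier (P (Suc n))" for x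
      proof -
        have c: "y x \<in> carrier N" "y (s n (d n x)) \<in> carrier N"
          using x by (auto intro!: rmod_homD(1)[OF y] rmod_homD(1)[OF s(1)] dc)
        have "y (G (Suc n) (F (Suc n) x)) = y x \<oplus>\<^bsub>N\<^esub> y (s n (d n x))"
          using homotopic[of P d \<epsilon> s "\<lambda>x. G (Suc n) (F (Suc n) x)" x n y, OF PP.P.resolution_axioms s(1) s(2)[OF x] x y z] by simp
        then show ?thesis using x c
          by (simp add: compose_def w_def dc Fc N.M.a_lcomm[of "\<ominus>\<^bsub>N\<^esub> y (s n (d n x))"] N.M.l_neg)
      qed
      then have "restrict y (carrier (P (Suc n))) = (\<lambda>x\<in>carrier (P (Suc n)). ?dD n w x \<oplus>\<^bsub>N\<^esub> ?\<phi> (Suc n) ?f x)"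
        by (rule restrict_ext)
      then show ?thesis using rmod_hom_ext_eq[OF y] by simp
    qed
    moreover have "?dC (Suc n) ?f = (\<lambda>x\<in>carrier (P' (Suc (Suc n))). \<zero>\<^bsub>N\<^esub>)"
      unfolding compose_def
    proof (rule restrict_ext)
      fix x assume x: "x \<in> carrier (P' (Suc (Suc n)))"
      show "(\<lambda>x\<in>carrier (P' (Suc n)). y (G (Suc n) x)) (d' (Suc n) x) = \<zero>\<^bsub>N\<^esub>"
        using fun_cong[OF z, of "G (Suc (Suc n)) x"] x Gc[OF x] by (simp add: dc compose_def G(3)[symmetric])
    qed
    ultimately show "\<exists>f\<in>rmod_hom A (P' (Suc n)) N. ?dC (Suc n) f = (\<lambda>x\<in>carrier (P' (Suc (Suc n))). \<zero>\<^bsub>N\<^esub>) \<and>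
       (\<exists>w\<in>rmod_hom A (P n) N. y = (\<lambda>x\<in>carrier (P (Suc n)). ?dD n w x \<oplus>\<^bsub>N\<^esub> ?\<phi> (Suc n) f x))"
      using w precompose_hom[OF G(1) y PP.P'.P_module] by blast
  qed
qed

section \<open>A resolution of the simple module at the least vertex\<close>

lemma deletions_nonzeroD:
  assumes "deletions c xs \<noteq> 0"
  shows "\<exists>ys x zs. xs = ys @ x # zs \<and> c (ys @ zs) \<noteq> 0"
proof (rule ccontr)
  assume "\<not> ?thesis"
  then have "deletions c xs = deletions (\<lambda>_. 0) xs" by (intro deletions_cong) blast
  then show False using assms by simp
qed

text \<open>
  The situation of the extended quiver.  Whether \<open>a\<close> lies below \<open>b\<close> is left open, because for the empty
  quiver no path connects the two new vertices.
\<close>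

locale incidence_coordinates_bounded = incidence_coordinates A V below co
  for A :: "('k::field, 'x) module" (structure) and V :: "'v set" and below and co :: "'x \<Rightarrow> 'v \<Rightarrow> 'v \<Rightarrow> 'k" +
  fixes a b :: 'v
  assumes a_V: "a \<in> V" and b_V: "b \<in> V" and a_neq_b: "a \<noteq> b"
    and a_minimal: "below x a \<Longrightarrow> x = a"
    and b_maximal: "below b y \<Longrightarrow> y = b"
    and inner: "\<lbrakk>x \<in> V; x \<noteq> a; x \<noteq> b\<rbrakk> \<Longrightarrow> below a x \<and> below x b"
begin

text \<open>
  Lists of generators are in decreasing order and omit the entry \<open>a\<close> with which each chain starts, so the
  empty list stands for the chain \<open>a\<close> alone.
\<close>

definition chain_top :: "'v list \<Rightarrow> 'v" where
  "chain_top \<sigma> = (case \<sigma> of [] \<Rightarrow> a | x # _ \<Rightarrow> x)"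

text \<open>
  The generators of the \<open>m\<close>-th module of the resolution: chains \<open>a < x\<^sub>1 \<le> \<dots> \<le> x\<^sub>m\<close>, in decreasing order.
  Inside the poset entries may repeat, but \<open>b\<close> occurs at most once.  Thus homomorphisms to the
  simple module at \<open>b\<close> correspond to functions on all chains of the inner poset, with no chain
  that is degenerate at \<open>b\<close> left over.
\<close>

definition bar_gens :: "nat \<Rightarrow> 'v list set" where
  "bar_gens m = {\<sigma>. length \<sigma> = m \<and> set \<sigma> \<subseteq> V - {a} \<and> sorted_wrt (\<lambda>x y. below y x) \<sigma> \<and>
     (\<forall>x\<in>set \<sigma>. below a x) \<and> b \<notin> set (tl \<sigma>)}"

text \<open>
  The direct sum of the projective modules \<open>e\<^sub>x A\<close>, one for every generator with top entry \<open>x\<close>.  Here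
  \<open>\<beta> y \<sigma>\<close> is the coefficient, in the summand of \<open>\<sigma>\<close>, of the path from \<open>y\<close> to the top of \<open>\<sigma>\<close>.
\<close>

definition bar_module :: "nat \<Rightarrow> ('x, 'v \<Rightarrow> 'v list \<Rightarrow> 'k) module" where
  "bar_module m =
    \<lparr>carrier = {\<beta>. \<forall>y \<sigma>. \<beta> y \<sigma> \<noteq> 0 \<longrightarrow> \<sigma> \<in> bar_gens m \<and> below (chain_top \<sigma>) y}, monoid.mult = undefined, one = undefined,
     ring.zero = (\<lambda>_ _. 0), add = (\<lambda>\<beta> \<gamma> y \<sigma>. \<beta> y \<sigma> + \<gamma> y \<sigma>), smult = (\<lambda>X \<beta> y \<sigma>. \<Sum>z\<in>V. \<beta> z \<sigma> * co X z y)\<rparr>"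

definition ind :: "'v list \<Rightarrow> 'v list \<Rightarrow> 'k" where
  "ind \<tau> \<sigma> = (if \<sigma> = \<tau> then 1 else 0)"

text \<open>
  The transpose of \<open>deletions\<close>: the basis vector of \<open>\<sigma>\<close> is sent to the alternating sum over the deletions
  of an entry of \<open>\<sigma>\<close>, while \<open>y\<close> stays.
\<close>

definition bar_diff :: "nat \<Rightarrow> ('v \<Rightarrow> 'v list \<Rightarrow> 'k) \<Rightarrow> 'v \<Rightarrow> 'v list \<Rightarrow> 'k" where
  "bar_diff m = (\<lambda>\<beta>\<in>carrier (bar_module (Suc m)). \<lambda>y \<tau>. \<Sum>\<sigma>\<in>bar_gens (Suc m). deletions (ind \<tau>) \<sigma> * \<beta> y \<sigma>)"

definition bar_aug :: "('v \<Rightarrow> 'v list \<Rightarrow> 'k) \<Rightarrow> 'k" where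
  "bar_aug = (\<lambda>\<beta>\<in>carrier (bar_module 0). \<beta> a [])"

lemma bar_module_simps:
  "\<beta> \<in> carrier (bar_module m) \<longleftrightarrow> (\<forall>y \<sigma>. \<beta> y \<sigma> \<noteq> 0 \<longrightarrow> \<sigma> \<in> bar_gens m \<and> below (chain_top \<sigma>) y)"
  "\<zero>\<^bsub>bar_module m\<^esub> = (\<lambda>_ _. 0)"
  "\<beta> \<oplus>\<^bsub>bar_module m\<^esub> \<gamma> = (\<lambda>y \<sigma>. \<beta> y \<sigma> + \<gamma> y \<sigma>)"
  "X \<odot>\<^bsub>bar_module m\<^esub> \<beta> = (\<lambda>y \<sigma>. \<Sum>z\<in>V. \<beta> z \<sigma> * co X z y)"
  by (simp_all add: bar_module_def)

lemma bar_moduleD: "\<lbrakk>\<beta> \<in> carrier (bar_module m); \<beta> y \<sigma> \<noteq> 0\<rbrakk> \<Longrightarrow> \<sigma> \<in> bar_gens m \<and> below (chain_top \<sigma>) y"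
  by (simp add: bar_module_simps)

lemma finite_gens: "finite (bar_gens m)"
  by (rule finite_subset[OF _ finite_lists_length_eq[OF finite_V, of m]]) (auto simp: bar_gens_def)

lemma gens_0: "bar_gens 0 = {[]}"
  by (auto simp: bar_gens_def)

lemma bar_module_right_module: "right_module A (bar_module m)"
proof -
  have "abelian_group (bar_module m)"
  proof (rule abelian_groupI)
    fix \<beta> assume "\<beta> \<in> carrier (bar_module m)"
    then show "\<exists>\<gamma>\<in>carrier (bar_module m). \<gamma> \<oplus>\<^bsub>bar_module m\<^esub> \<beta> = \<zero>\<^bsub>bar_module m\<^esub>"
      by (intro bexI[of _ "\<lambda>y \<sigma>. - \<beta> y \<sigma>"]) (auto simp: bar_module_simps)
  next
    fix \<beta> \<gamma> assume "\<beta> \<in> carrier (bar_module m)" "\<gamma> \<in> carrier (bar_module m)"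
    then show "\<beta> \<oplus>\<^bsub>bar_module m\<^esub> \<gamma> \<in> carrier (bar_module m)"
      by (auto simp: bar_module_simps) (metis add.right_neutral)+
  qed (auto simp: bar_module_simps algebra_simps)
  then show ?thesis
  proof (intro right_module.intro right_module_axioms.intro ring_A)
    fix X \<beta> assume X: "X \<in> carrier A" and \<beta>: "\<beta> \<in> carrier (bar_module m)"
    show "X \<odot>\<^bsub>bar_module m\<^esub> \<beta> \<in> carrier (bar_module m)"
      unfolding bar_module_simps
    proof (intro allI impI)
      fix y \<sigma> assume "(\<Sum>z\<in>V. \<beta> z \<sigma> * co X z y) \<noteq> 0"
      then obtain z where "z \<in> V" "\<beta> z \<sigma> * co X z y \<noteq> 0" by (rule sum.not_neutral_contains_not_neutral)
      then have "\<beta> z \<sigma> \<noteq> 0" "co X z y \<noteq> 0" by auto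
      then show "\<sigma> \<in> bar_gens m \<and> below (chain_top \<sigma>) y"
        using bar_moduleD[OF \<beta>] co_below[OF X] below_trans by blast
    qed
    fix \<gamma>
    show "X \<odot>\<^bsub>bar_module m\<^esub> (\<beta> \<oplus>\<^bsub>bar_module m\<^esub> \<gamma>) = X \<odot>\<^bsub>bar_module m\<^esub> \<beta> \<oplus>\<^bsub>bar_module m\<^esub> X \<odot>\<^bsub>bar_module m\<^esub> \<gamma>"
      by (simp add: bar_module_simps distrib_right sum.distrib)
  next
    fix X Y \<beta> assume XY: "X \<in> carrier A" "Y \<in> carrier A" and \<beta>: "\<beta> \<in> carrier (bar_module m)"
    show "(X \<oplus> Y) \<odot>\<^bsub>bar_module m\<^esub> \<beta> = X \<odot>\<^bsub>bar_module m\<^esub> \<beta> \<oplus>\<^bsub>bar_module m\<^esub> Y \<odot>\<^bsub>bar_module m\<^esub> \<beta>"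
      using XY by (simp add: bar_module_simps distrib_left sum.distrib co_add)
    show "(X \<otimes> Y) \<odot>\<^bsub>bar_module m\<^esub> \<beta> = Y \<odot>\<^bsub>bar_module m\<^esub> (X \<odot>\<^bsub>bar_module m\<^esub> \<beta>)"
    proof (intro ext)
      fix y \<sigma>
      have "(\<Sum>z\<in>V. \<beta> z \<sigma> * co (X \<otimes> Y) z y) = (\<Sum>z\<in>V. \<Sum>w\<in>V. \<beta> z \<sigma> * co X z w * co Y w y)"
        using XY by (simp add: co_mult sum_distrib_left mult.assoc)
      also have "\<dots> = (\<Sum>w\<in>V. \<Sum>z\<in>V. \<beta> z \<sigma> * co X z w * co Y w y)" by (rule sum.swap)
      finally show "((X \<otimes> Y) \<odot>\<^bsub>bar_module m\<^esub> \<beta>) y \<sigma> = (Y \<odot>\<^bsub>bar_module m\<^esub> (X \<odot>\<^bsub>bar_module m\<^esub> \<beta>)) y \<sigma>"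
        by (simp add: bar_module_simps sum_distrib_right)
    qed
  next
    fix \<beta> assume \<beta>: "\<beta> \<in> carrier (bar_module m)"
    show "\<one> \<odot>\<^bsub>bar_module m\<^esub> \<beta> = \<beta>"
    proof (intro ext)
      fix y \<sigma>
      have "(\<Sum>z\<in>V. \<beta> z \<sigma> * co \<one> z y) = (\<Sum>z\<in>V. if z = y then \<beta> y \<sigma> else 0)"
        by (rule sum.cong) (auto simp: co_one)
      also have "\<dots> = \<beta> y \<sigma>" using bar_moduleD[OF \<beta>, of y \<sigma>] below_V finite_V by auto
      finally show "(\<one> \<odot>\<^bsub>bar_module m\<^esub> \<beta>) y \<sigma> = \<beta> y \<sigma>" by (simp add: bar_module_simps)
    qed
  qed
qed

text \<open>
  In coordinates the inclusion into the free module on the generators, and the retraction from it, only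
  rename indices.
\<close>

lemma bar_module_projective: "projective A (bar_module m)"
proof (rule projective_retract_of_free[OF ring_A bar_module_right_module])
  let ?F = "free_rmod A (bar_gens m)"
  let ?i = "\<lambda>\<beta> \<sigma>. if \<sigma> \<in> bar_gens m then of_coords (\<lambda>x y. if x = chain_top \<sigma> then \<beta> y \<sigma> else 0) else \<zero>"
  let ?r = "\<lambda>\<phi> y \<sigma>. if \<sigma> \<in> bar_gens m then co (\<phi> \<sigma>) (chain_top \<sigma>) y else 0"
  have i: "?i \<beta> \<sigma> \<in> carrier A" "co (?i \<beta> \<sigma>) x y = (if \<sigma> \<in> bar_gens m \<and> x = chain_top \<sigma> then \<beta> y \<sigma> else 0)"
    if "\<beta> \<in> carrier (bar_module m)" for \<beta> \<sigma> x y
  proof -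
    have "(if x = chain_top \<sigma> then \<beta> y \<sigma> else 0) \<noteq> 0 \<Longrightarrow> below x y" for x y
      using bar_moduleD[OF that] by (auto split: if_splits)
    then have "of_coords (\<lambda>x y. if x = chain_top \<sigma> then \<beta> y \<sigma> else 0) \<in> carrier A"
      "co (of_coords (\<lambda>x y. if x = chain_top \<sigma> then \<beta> y \<sigma> else 0)) x y = (if x = chain_top \<sigma> then \<beta> y \<sigma> else 0)"
      by (intro of_coords_closed co_of_coords; simp)+
    then show "?i \<beta> \<sigma> \<in> carrier A" "co (?i \<beta> \<sigma>) x y = (if \<sigma> \<in> bar_gens m \<and> x = chain_top \<sigma> then \<beta> y \<sigma> else 0)"
      by (auto simp: co_zero)
  qed
  interpret B: right_module A "bar_module m" by (rule bar_module_right_module)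
  show "restrict ?i (carrier (bar_module m)) \<in> rmod_hom A (bar_module m) ?F"
  proof (rule rmod_homI[OF _ _ _ bar_module_right_module])
    fix \<beta> assume \<beta>: "\<beta> \<in> carrier (bar_module m)"
    have "finite {\<sigma>. ?i \<beta> \<sigma> \<noteq> \<zero>}" by (rule finite_subset[OF _ finite_gens[of m]]) auto
    then show "?i \<beta> \<in> carrier ?F" using i(1)[OF \<beta>] by (auto simp: free_rmod_def)
    show "?i (X \<odot>\<^bsub>bar_module m\<^esub> \<beta>) = X \<odot>\<^bsub>?F\<^esub> ?i \<beta>" if X: "X \<in> carrier A" for X
    proof
      fix \<sigma>
      have "?i (X \<odot>\<^bsub>bar_module m\<^esub> \<beta>) \<sigma> = ?i \<beta> \<sigma> \<otimes> X"
      proof (rule co_eqI)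
        fix x y
        show "co (?i (X \<odot>\<^bsub>bar_module m\<^esub> \<beta>) \<sigma>) x y = co (?i \<beta> \<sigma> \<otimes> X) x y"
          using X i[OF \<beta>] by (simp only: co_mult i(2)[OF B.act_closed[OF X \<beta>]])
              (cases "\<sigma> \<in> bar_gens m \<and> x = chain_top \<sigma>"; auto simp: bar_module_simps)
      qed (use X i(1)[OF \<beta>] i(1)[OF B.act_closed[OF X \<beta>]] in simp_all)
      then show "?i (X \<odot>\<^bsub>bar_module m\<^esub> \<beta>) \<sigma> = (X \<odot>\<^bsub>?F\<^esub> ?i \<beta>) \<sigma>" by (simp add: free_rmod_def)
    qed
    show "?i (\<beta> \<oplus>\<^bsub>bar_module m\<^esub> \<gamma>) = ?i \<beta> \<oplus>\<^bsub>?F\<^esub> ?i \<gamma>" if \<gamma>: "\<gamma> \<in> carrier (bar_module m)" for \<gamma>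
    proof
      fix \<sigma>
      have "?i (\<beta> \<oplus>\<^bsub>bar_module m\<^esub> \<gamma>) \<sigma> = ?i \<beta> \<sigma> \<oplus> ?i \<gamma> \<sigma>"
      proof (rule co_eqI)
        fix x y
        show "co (?i (\<beta> \<oplus>\<^bsub>bar_module m\<^esub> \<gamma>) \<sigma>) x y = co (?i \<beta> \<sigma> \<oplus> ?i \<gamma> \<sigma>) x y"
          using i[OF \<beta>] i[OF \<gamma>] by (simp only: co_add i(2)[OF B.M.a_closed[OF \<beta> \<gamma>]]) (simp add: bar_module_simps)
      qed (use i(1)[OF \<beta>] i(1)[OF \<gamma>] i(1)[OF B.M.a_closed[OF \<beta> \<gamma>]] in simp_all)
      then show "?i (\<beta> \<oplus>\<^bsub>bar_module m\<^esub> \<gamma>) \<sigma> = (?i \<beta> \<oplus>\<^bsub>?F\<^esub> ?i \<gamma>) \<sigma>" by (simp add: free_rmod_def)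
    qed
  qed
  show r: "restrict ?r (carrier ?F) \<in> rmod_hom A ?F (bar_module m)"
  proof (rule rmod_homI[OF _ _ _ free_rmod_right_module[OF ring_A]])
    fix \<phi> assume \<phi>: "\<phi> \<in> carrier ?F"
    then have c: "\<phi> \<sigma> \<in> carrier A" for \<sigma> by (simp add: free_rmod_def)
    then show "?r \<phi> \<in> carrier (bar_module m)" using co_below by (auto simp: bar_module_simps split: if_splits)
    show "?r (X \<odot>\<^bsub>?F\<^esub> \<phi>) = X \<odot>\<^bsub>bar_module m\<^esub> ?r \<phi>" if "X \<in> carrier A" for X
    proof (intro ext)
      fix y \<sigma>
      show "?r (X \<odot>\<^bsub>?F\<^esub> \<phi>) y \<sigma> = (X \<odot>\<^bsub>bar_module m\<^esub> ?r \<phi>) y \<sigma>"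
        using c that by (cases "\<sigma> \<in> bar_gens m") (simp_all add: bar_module_simps free_rmod_def co_mult)
    qed
    show "?r (\<phi> \<oplus>\<^bsub>?F\<^esub> \<psi>) = ?r \<phi> \<oplus>\<^bsub>bar_module m\<^esub> ?r \<psi>" if "\<psi> \<in> carrier ?F" for \<psi>
    proof (intro ext)
      fix y \<sigma>
      show "?r (\<phi> \<oplus>\<^bsub>?F\<^esub> \<psi>) y \<sigma> = (?r \<phi> \<oplus>\<^bsub>bar_module m\<^esub> ?r \<psi>) y \<sigma>"
        using c that by (cases "\<sigma> \<in> bar_gens m") (simp_all add: bar_module_simps free_rmod_def co_add)
    qed
  qed
  fix \<beta> assume \<beta>: "\<beta> \<in> carrier (bar_module m)"
  have "finite {\<sigma>. ?i \<beta> \<sigma> \<noteq> \<zero>}" by (rule finite_subset[OF _ finite_gens[of m]]) auto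
  then have "?i \<beta> \<in> carrier ?F" using i(1)[OF \<beta>] by (auto simp: free_rmod_def)
  then have "restrict ?r (carrier ?F) (restrict ?i (carrier (bar_module m)) \<beta>) = ?r (?i \<beta>)" using \<beta> by simp
  also have "\<dots> = \<beta>"
  proof (intro ext)
    fix y \<sigma>
    show "?r (?i \<beta>) y \<sigma> = \<beta> y \<sigma>"
      using bar_moduleD[OF \<beta>, of y \<sigma>] by (simp only: i(2)[OF \<beta>]) auto
  qed
  finally show "restrict ?r (carrier ?F) (restrict ?i (carrier (bar_module m)) \<beta>) = \<beta>" .
qed

lemma gens_delete:
  assumes "ys @ x # zs \<in> bar_gens (Suc m)"
  shows "ys @ zs \<in> bar_gens m" "below (chain_top (ys @ zs)) (chain_top (ys @ x # zs))"
proof -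
  show "ys @ zs \<in> bar_gens m"
    using assms by (cases ys; cases zs) (auto simp: bar_gens_def sorted_wrt_append)
  show "below (chain_top (ys @ zs)) (chain_top (ys @ x # zs))"
    using assms by (cases ys; cases zs) (auto simp: bar_gens_def chain_top_def below_refl)
qed

lemma deletions_ind_nonzero:
  assumes "deletions (ind \<tau>) \<sigma> \<noteq> 0"
  shows "\<exists>ys x zs. \<sigma> = ys @ x # zs \<and> \<tau> = ys @ zs"
  using deletions_nonzeroD[OF assms] by (auto simp: ind_def split: if_splits)

lemma bar_diff_hom: "bar_diff m \<in> rmod_hom A (bar_module (Suc m)) (bar_module m)"
  unfolding bar_diff_def
proof (rule rmod_homI[OF _ _ _ bar_module_right_module])
  fix \<beta> assume \<beta>: "\<beta> \<in> carrier (bar_module (Suc m))"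
  show "(\<lambda>y \<tau>. \<Sum>\<sigma>\<in>bar_gens (Suc m). deletions (ind \<tau>) \<sigma> * \<beta> y \<sigma>) \<in> carrier (bar_module m)"
    unfolding bar_module_simps
  proof (intro allI impI)
    fix y \<tau> assume "(\<Sum>\<sigma>\<in>bar_gens (Suc m). deletions (ind \<tau>) \<sigma> * \<beta> y \<sigma>) \<noteq> 0"
    then obtain \<sigma> where s: "\<sigma> \<in> bar_gens (Suc m)" "deletions (ind \<tau>) \<sigma> * \<beta> y \<sigma> \<noteq> 0" by (rule sum.not_neutral_contains_not_neutral)
    then obtain ys x zs where \<sigma>: "\<sigma> = ys @ x # zs" "\<tau> = ys @ zs" using deletions_ind_nonzero[of \<tau> \<sigma>] by auto
    have "below (chain_top \<sigma>) y" using s(2) bar_moduleD[OF \<beta>] by auto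
    then show "\<tau> \<in> bar_gens m \<and> below (chain_top \<tau>) y"
      using gens_delete[of ys x zs m] s(1) \<sigma> below_trans by auto
  qed
  fix X assume "X \<in> carrier A"
  show "(\<lambda>y \<tau>. \<Sum>\<sigma>\<in>bar_gens (Suc m). deletions (ind \<tau>) \<sigma> * (X \<odot>\<^bsub>bar_module (Suc m)\<^esub> \<beta>) y \<sigma>) =
     X \<odot>\<^bsub>bar_module m\<^esub> (\<lambda>y \<tau>. \<Sum>\<sigma>\<in>bar_gens (Suc m). deletions (ind \<tau>) \<sigma> * \<beta> y \<sigma>)"
  proof (intro ext)
    fix y \<tau>
    have "(\<Sum>\<sigma>\<in>bar_gens (Suc m). deletions (ind \<tau>) \<sigma> * (\<Sum>z\<in>V. \<beta> z \<sigma> * co X z y)) =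
      (\<Sum>\<sigma>\<in>bar_gens (Suc m). \<Sum>z\<in>V. deletions (ind \<tau>) \<sigma> * \<beta> z \<sigma> * co X z y)"
      by (simp add: sum_distrib_left mult.assoc)
    also have "\<dots> = (\<Sum>z\<in>V. \<Sum>\<sigma>\<in>bar_gens (Suc m). deletions (ind \<tau>) \<sigma> * \<beta> z \<sigma> * co X z y)" by (rule sum.swap)
    finally show "(\<Sum>\<sigma>\<in>bar_gens (Suc m). deletions (ind \<tau>) \<sigma> * (X \<odot>\<^bsub>bar_module (Suc m)\<^esub> \<beta>) y \<sigma>) =
     (X \<odot>\<^bsub>bar_module m\<^esub> (\<lambda>y \<tau>. \<Sum>\<sigma>\<in>bar_gens (Suc m). deletions (ind \<tau>) \<sigma> * \<beta> y \<sigma>)) y \<tau>"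
      by (simp add: bar_module_simps sum_distrib_right)
  qed
qed (simp add: bar_module_simps distrib_left sum.distrib)

lemma deletions_expand:
  assumes \<sigma>: "\<sigma> \<in> bar_gens (Suc m)"
  shows "deletions c \<sigma> = (\<Sum>\<tau>\<in>bar_gens m. c \<tau> * deletions (ind \<tau>) \<sigma>)"
proof -
  have "deletions c \<sigma> = deletions (\<lambda>ys. \<Sum>\<tau>\<in>bar_gens m. c \<tau> * ind \<tau> ys) \<sigma>"
  proof (rule deletions_cong)
    fix ys zs x assume "\<sigma> = ys @ x # zs"
    then have g: "ys @ zs \<in> bar_gens m" using gens_delete \<sigma> by blast
    have "(\<Sum>\<tau>\<in>bar_gens m. c \<tau> * ind \<tau> (ys @ zs)) = (\<Sum>\<tau>\<in>bar_gens m. if \<tau> = ys @ zs then c \<tau> else 0)"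
      by (rule sum.cong) (auto simp: ind_def)
    then show "c (ys @ zs) = (\<Sum>\<tau>\<in>bar_gens m. c \<tau> * ind \<tau> (ys @ zs))" using g finite_gens by simp
  qed
  then show ?thesis by (simp add: deletions_sum deletions_scale)
qed

text \<open>
  The differential is adjoint to \<open>deletions\<close>, which transports identities between alternating sums.
\<close>

lemma bar_diff_pairing:
  assumes \<beta>: "\<beta> \<in> carrier (bar_module (Suc m))"
  shows "(\<Sum>\<tau>\<in>bar_gens m. c \<tau> * bar_diff m \<beta> y \<tau>) = (\<Sum>\<sigma>\<in>bar_gens (Suc m). deletions c \<sigma> * \<beta> y \<sigma>)"
proof -
  have "(\<Sum>\<tau>\<in>bar_gens m. c \<tau> * bar_diff m \<beta> y \<tau>) = (\<Sum>\<tau>\<in>bar_gens m. \<Sum>\<sigma>\<in>bar_gens (Suc m). c \<tau> * deletions (ind \<tau>) \<sigma> * \<beta> y \<sigma>)"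
    using \<beta> by (simp add: bar_diff_def sum_distrib_left mult.assoc)
  also have "\<dots> = (\<Sum>\<sigma>\<in>bar_gens (Suc m). \<Sum>\<tau>\<in>bar_gens m. c \<tau> * deletions (ind \<tau>) \<sigma> * \<beta> y \<sigma>)" by (rule sum.swap)
  also have "\<dots> = (\<Sum>\<sigma>\<in>bar_gens (Suc m). deletions c \<sigma> * \<beta> y \<sigma>)"
    by (rule sum.cong) (simp_all add: deletions_expand sum_distrib_right)
  finally show ?thesis .
qed

lemma bar_diff_bar_diff:
  assumes \<beta>: "\<beta> \<in> carrier (bar_module (Suc (Suc m)))"
  shows "bar_diff m (bar_diff (Suc m) \<beta>) y \<tau> = 0"
  using rmod_homD(1)[OF bar_diff_hom \<beta>] bar_diff_pairing[OF \<beta>, of "deletions (ind \<tau>)" y]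
  by (simp add: bar_diff_def[of m] deletions_deletions)

lemma bar_aug_bar_diff:
  assumes \<beta>: "\<beta> \<in> carrier (bar_module 1)"
  shows "bar_diff 0 \<beta> a [] = 0"
proof -
  have "\<beta> a \<sigma> = 0" if "\<sigma> \<in> bar_gens 1" for \<sigma>
    using bar_moduleD[OF \<beta>, of a \<sigma>] a_minimal that by (cases \<sigma>) (auto simp: bar_gens_def chain_top_def)
  then show ?thesis using \<beta> by (simp add: bar_diff_def)
qed

text \<open>
  The contracting homotopy: it prepends the vertex \<open>y\<close> at which the element lives.  If \<open>b\<close> already occurs,
  then \<open>y\<close> is \<open>b\<close> and the result would be degenerate at \<open>b\<close>, so the value is zero.  At \<open>y = a\<close> only the
  zeroth module is nonzero, and there the augmentation takes over.
\<close>

definition bar_split :: "('v \<Rightarrow> 'v list \<Rightarrow> 'k) \<Rightarrow> 'v \<Rightarrow> 'v list \<Rightarrow> 'k" where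
  "bar_split \<beta> y \<sigma>' = (case \<sigma>' of [] \<Rightarrow> 0 | x # \<sigma> \<Rightarrow> if x = y \<and> y \<noteq> a \<and> b \<notin> set \<sigma> then \<beta> y \<sigma> else 0)"

lemma gens_Cons:
  assumes "\<sigma> \<in> bar_gens m" "below (chain_top \<sigma>) y" "y \<noteq> a" "b \<notin> set \<sigma>"
  shows "y # \<sigma> \<in> bar_gens (Suc m)"
proof -
  have "below x y" if "x \<in> set \<sigma>" for x
    using that assms by (cases \<sigma>) (auto simp: bar_gens_def chain_top_def intro: below_trans)
  moreover have "below a y" using assms by (cases \<sigma>) (auto simp: bar_gens_def chain_top_def intro: below_trans)
  ultimately show ?thesis using assms below_V by (auto simp: bar_gens_def)
qed

lemma bar_split_closed:
  assumes \<beta>: "\<beta> \<in> carrier (bar_module m)"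
  shows "bar_split \<beta> \<in> carrier (bar_module (Suc m))"
  unfolding bar_module_simps
proof (intro allI impI)
  fix y \<sigma>' assume "bar_split \<beta> y \<sigma>' \<noteq> 0"
  then obtain \<sigma> where s: "\<sigma>' = y # \<sigma>" "y \<noteq> a" "b \<notin> set \<sigma>" "\<beta> y \<sigma> \<noteq> 0"
    by (auto simp: bar_split_def split: list.splits if_splits)
  then have "\<sigma> \<in> bar_gens m" "below (chain_top \<sigma>) y" using bar_moduleD[OF \<beta>] by auto
  then show "\<sigma>' \<in> bar_gens (Suc m) \<and> below (chain_top \<sigma>') y"
    using gens_Cons[of \<sigma> m y] s below_V below_refl by (auto simp: chain_top_def)
qed

lemma deletions_ind_member:
  assumes "x \<in> set \<tau>" "x \<notin> set \<sigma>" shows "deletions (ind \<tau>) \<sigma> = 0"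
  by (rule ccontr) (use deletions_ind_nonzero[of \<tau> \<sigma>] assms in auto)

text \<open>
  Away from \<open>b\<close> the deletion of the prepended vertex gives back the cycle, and the other deletions vanish
  since the cycle condition holds at each vertex \<open>y\<close> separately.  At \<open>y = b\<close> the sum over generators without
  \<open>b\<close> is not the whole cycle condition; the missing part is the term that recovers the
  coefficients at generators with \<open>b\<close>.
\<close>

lemma bar_exact:
  assumes \<beta>: "\<beta> \<in> carrier (bar_module m)"
    and z0: "m = 0 \<Longrightarrow> \<beta> a [] = 0"
    and zS: "\<And>k y \<tau>. m = Suc k \<Longrightarrow> bar_diff k \<beta> y \<tau> = 0"
  shows "\<beta> = bar_diff m (bar_split \<beta>)"
proof (intro ext)
  fix y \<tau>
  have z: "(\<Sum>\<sigma>\<in>bar_gens m. deletions (ind \<tau>') \<sigma> * \<beta> y \<sigma>) = 0" for y \<tau>'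
  proof (cases m)
    case 0 then show ?thesis by (simp add: gens_0)
  next
    case (Suc k) then show ?thesis using zS[OF Suc, of y \<tau>'] \<beta> by (simp add: bar_diff_def)
  qed
  have d: "bar_diff m (bar_split \<beta>) y \<tau> = (\<Sum>\<sigma>'\<in>bar_gens (Suc m). deletions (ind \<tau>) \<sigma>' * bar_split \<beta> y \<sigma>')"
    using bar_split_closed[OF \<beta>] by (simp add: bar_diff_def)
  show "\<beta> y \<tau> = bar_diff m (bar_split \<beta>) y \<tau>"
  proof (cases "y = a")
    case True
    have "\<beta> y \<tau> = 0"
    proof (rule ccontr)
      assume *: "\<beta> y \<tau> \<noteq> 0"
      then have "\<tau> \<in> bar_gens m" "chain_top \<tau> = a" using bar_moduleD[OF \<beta>, of y \<tau>] a_minimal True by auto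
      then have "\<tau> = []" "m = 0" by (cases \<tau>; auto simp: bar_gens_def chain_top_def)+
      then show False using * z0 True by simp
    qed
    moreover have "bar_split \<beta> y \<sigma>' = 0" for \<sigma>' using True by (auto simp: bar_split_def split: list.splits)
    ultimately show ?thesis unfolding d by simp
  next
    case False
    \<comment> \<open>The generators that \<open>bar_split\<close> extends by \<open>y\<close>.\<close>
    define K where "K = {\<sigma> \<in> bar_gens m. b \<notin> set \<sigma> \<and> \<beta> y \<sigma> \<noteq> 0}"
    have fK: "finite K" using finite_gens[of m] by (auto simp: K_def)
    have Ksub: "(#) y ` K \<subseteq> bar_gens (Suc m)"
      using gens_Cons bar_moduleD[OF \<beta>] False by (auto simp: K_def)
    have "(\<Sum>\<sigma>'\<in>bar_gens (Suc m). deletions (ind \<tau>) \<sigma>' * bar_split \<beta> y \<sigma>') = (\<Sum>\<sigma>'\<in>(#) y ` K. deletions (ind \<tau>) \<sigma>' * bar_split \<beta> y \<sigma>')"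
    proof (rule sum.mono_neutral_right[OF finite_gens Ksub], rule ballI)
      fix \<sigma>' assume s: "\<sigma>' \<in> bar_gens (Suc m) - (#) y ` K"
      have "bar_split \<beta> y \<sigma>' = 0"
        using s bar_moduleD[OF \<beta>] by (auto simp: bar_split_def K_def split: list.splits)
      then show "deletions (ind \<tau>) \<sigma>' * bar_split \<beta> y \<sigma>' = 0" by simp
    qed
    also have "\<dots> = (\<Sum>\<sigma>\<in>K. deletions (ind \<tau>) (y # \<sigma>) * bar_split \<beta> y (y # \<sigma>))"
      by (subst sum.reindex) (auto simp: inj_on_def)
    also have "\<dots> = (\<Sum>\<sigma>\<in>K. ind \<tau> \<sigma> * \<beta> y \<sigma> - deletions (\<lambda>ys. ind \<tau> (y # ys)) \<sigma> * \<beta> y \<sigma>)"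
      using False by (intro sum.cong) (auto simp: bar_split_def K_def left_diff_distrib)
    also have "\<dots> = (\<Sum>\<sigma>\<in>K. ind \<tau> \<sigma> * \<beta> y \<sigma>) - (\<Sum>\<sigma>\<in>K. deletions (\<lambda>ys. ind \<tau> (y # ys)) \<sigma> * \<beta> y \<sigma>)"
      by (rule sum_subtractf)
    also have "(\<Sum>\<sigma>\<in>K. ind \<tau> \<sigma> * \<beta> y \<sigma>) = (\<Sum>\<sigma>\<in>K. if \<sigma> = \<tau> then \<beta> y \<sigma> else 0)"
      by (rule sum.cong) (auto simp: ind_def)
    also have "\<dots> = (if b \<notin> set \<tau> then \<beta> y \<tau> else 0)"
      using fK bar_moduleD[OF \<beta>, of y \<tau>] by (auto simp: K_def)
    finally have d': "bar_diff m (bar_split \<beta>) y \<tau> = (if b \<notin> set \<tau> then \<beta> y \<tau> else 0) -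
       (\<Sum>\<sigma>\<in>K. deletions (\<lambda>ys. ind \<tau> (y # ys)) \<sigma> * \<beta> y \<sigma>)" unfolding d .
    \<comment> \<open>The cycle condition, with the generators containing \<open>b\<close> moved to the other side.\<close>
    have Kz: "(\<Sum>\<sigma>\<in>K. deletions (ind \<tau>') \<sigma> * \<beta> y \<sigma>) = - (if y = b \<and> b \<notin> set \<tau>' then \<beta> b (b # \<tau>') else 0)" for \<tau>'
    proof (cases "b \<in> set \<tau>'")
      case True
      then have "deletions (ind \<tau>') \<sigma> = 0" if "\<sigma> \<in> K" for \<sigma> using that by (intro deletions_ind_member) (auto simp: K_def)
      then show ?thesis using True by simp
    next
      case b\<tau>': False
      let ?N = "{\<sigma> \<in> bar_gens m. \<beta> y \<sigma> \<noteq> 0 \<and> b \<in> set \<sigma>}"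
      have "0 = (\<Sum>\<sigma>\<in>bar_gens m. deletions (ind \<tau>') \<sigma> * \<beta> y \<sigma>)" using z by simp
      also have "\<dots> = (\<Sum>\<sigma>\<in>K \<union> ?N. deletions (ind \<tau>') \<sigma> * \<beta> y \<sigma>)"
        by (rule sum.mono_neutral_right[OF finite_gens]) (auto simp: K_def)
      also have "\<dots> = (\<Sum>\<sigma>\<in>K. deletions (ind \<tau>') \<sigma> * \<beta> y \<sigma>) + (\<Sum>\<sigma>\<in>?N. deletions (ind \<tau>') \<sigma> * \<beta> y \<sigma>)"
        using finite_gens[of m] by (intro sum.union_disjoint fK) (auto simp: K_def)
      also have "(\<Sum>\<sigma>\<in>?N. deletions (ind \<tau>') \<sigma> * \<beta> y \<sigma>) = (\<Sum>\<sigma>\<in>?N. if \<sigma> = b # \<tau>' then \<beta> y \<sigma> else 0)"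
      proof (rule sum.cong[OF refl])
        fix \<sigma> assume s: "\<sigma> \<in> ?N"
        then obtain \<rho> where \<rho>: "\<sigma> = b # \<rho>" "b \<notin> set \<rho>" by (cases \<sigma>) (auto simp: bar_gens_def)
        have "deletions (\<lambda>ys. ind \<tau>' (b # ys)) \<rho> = deletions (\<lambda>_. 0) \<rho>"
          using b\<tau>' by (intro deletions_cong) (auto simp: ind_def)
        then show "deletions (ind \<tau>') \<sigma> * \<beta> y \<sigma> = (if \<sigma> = b # \<tau>' then \<beta> y \<sigma> else 0)"
          by (simp add: \<rho> ind_def)
      qed
      also have "\<dots> = (if b # \<tau>' \<in> ?N then \<beta> y (b # \<tau>') else 0)" using finite_gens[of m] by simp
      also have "\<dots> = (if y = b then \<beta> b (b # \<tau>') else 0)"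
        using bar_moduleD[OF \<beta>, of y "b # \<tau>'"] b_maximal by (auto simp: chain_top_def)
      finally show ?thesis using b\<tau>' by (simp add: eq_neg_iff_add_eq_0)
    qed
    have sm: "\<beta> y \<tau> \<noteq> 0 \<Longrightarrow> b \<in> set \<tau> \<Longrightarrow> y = b \<and> (\<exists>\<tau>'. \<tau> = b # \<tau>' \<and> b \<notin> set \<tau>')"
      using bar_moduleD[OF \<beta>, of y \<tau>] b_maximal by (cases \<tau>) (auto simp: bar_gens_def chain_top_def)
    show ?thesis
    proof (cases "\<exists>\<tau>'. \<tau> = y # \<tau>'")
      case True
      then obtain \<tau>' where \<tau>: "\<tau> = y # \<tau>'" by blast
      have "(\<lambda>ys. ind \<tau> (y # ys)) = ind \<tau>'" by (auto simp: ind_def \<tau>)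
      then show ?thesis unfolding d' using Kz[of \<tau>'] sm \<tau> by auto
    next
      case False
      then have "(\<lambda>ys. ind \<tau> (y # ys)) = (\<lambda>_. 0)" by (intro ext) (auto simp: ind_def)
      then show ?thesis unfolding d' using sm False by auto
    qed
  qed
qed

lemma bar_resolution:
  assumes M: "right_module A M" and M_simps: "carrier M = UNIV" "\<zero>\<^bsub>M\<^esub> = 0" "add M = (+)"
    and act: "\<And>X t. X \<in> carrier A \<Longrightarrow> X \<odot>\<^bsub>M\<^esub> t = t * co X a a"
  shows "projective_resolution A M bar_module bar_diff bar_aug"
  unfolding projective_resolution_def
proof (intro conjI allI M bar_module_projective bar_diff_hom)
  show "bar_aug \<in> rmod_hom A (bar_module 0) M"
    unfolding bar_aug_def
  proof (rule rmod_homI[OF _ _ _ bar_module_right_module])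
    fix X and \<beta> :: "'v \<Rightarrow> 'v list \<Rightarrow> 'k" assume X: "X \<in> carrier A"
    have "(\<Sum>z\<in>V. \<beta> z [] * co X z a) = (\<Sum>z\<in>V. if z = a then \<beta> a [] * co X a a else 0)"
      using co_below[OF X] a_minimal by (intro sum.cong) auto
    then show "(X \<odot>\<^bsub>bar_module 0\<^esub> \<beta>) a [] = X \<odot>\<^bsub>M\<^esub> \<beta> a []"
      using finite_V a_V by (simp add: bar_module_simps act[OF X])
  qed (simp_all add: M_simps bar_module_simps)
  have "(\<lambda>y \<sigma>. if y = a \<and> \<sigma> = [] then t else 0) \<in> carrier (bar_module 0)" for t
    using a_V below_refl by (auto simp: bar_module_simps gens_0 chain_top_def)
  then show "bar_aug ` carrier (bar_module 0) = carrier M"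
    unfolding M_simps by (auto intro!: image_eqI[where x = "\<lambda>y \<sigma>. if y = a \<and> \<sigma> = [] then _ else 0"] simp: bar_aug_def)
  show "a_kernel (bar_module 0) M bar_aug = bar_diff 0 ` carrier (bar_module 1)"
  proof (intro equalityI subsetI)
    fix \<beta> assume "\<beta> \<in> a_kernel (bar_module 0) M bar_aug"
    then have \<beta>: "\<beta> \<in> carrier (bar_module 0)" "\<beta> a [] = 0" by (auto simp: a_kernel_def kernel_def bar_aug_def M_simps)
    show "\<beta> \<in> bar_diff 0 ` carrier (bar_module 1)"
      using bar_exact[OF \<beta>(1)] \<beta>(2) bar_split_closed[OF \<beta>(1)] by (intro image_eqI[of _ _ "bar_split \<beta>"]) auto
  next
    fix \<gamma> assume "\<gamma> \<in> bar_diff 0 ` carrier (bar_module 1)"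
    then obtain \<beta> where \<beta>: "\<beta> \<in> carrier (bar_module 1)" "\<gamma> = bar_diff 0 \<beta>" by blast
    then have "\<gamma> \<in> carrier (bar_module 0)" using rmod_homD(1)[OF bar_diff_hom, of \<beta> 0] by simp
    then show "\<gamma> \<in> a_kernel (bar_module 0) M bar_aug"
      using bar_aug_bar_diff[OF \<beta>(1)] \<beta>(2) by (auto simp: a_kernel_def kernel_def bar_aug_def M_simps)
  qed
  fix n
  show "a_kernel (bar_module (Suc n)) (bar_module n) (bar_diff n) = bar_diff (Suc n) ` carrier (bar_module (Suc (Suc n)))"
  proof (intro equalityI subsetI)
    fix \<beta> assume "\<beta> \<in> a_kernel (bar_module (Suc n)) (bar_module n) (bar_diff n)"
    then have \<beta>: "\<beta> \<in> carrier (bar_module (Suc n))" "bar_diff n \<beta> = (\<lambda>_ _. 0)" by (auto simp: a_kernel_def kernel_def bar_module_simps)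
    have "\<beta> = bar_diff (Suc n) (bar_split \<beta>)"
      by (rule bar_exact[OF \<beta>(1)]) (use \<beta>(2) in \<open>auto dest: fun_cong\<close>)
    then show "\<beta> \<in> bar_diff (Suc n) ` carrier (bar_module (Suc (Suc n)))"
      using bar_split_closed[OF \<beta>(1)] by (rule image_eqI)
  next
    fix \<gamma> assume "\<gamma> \<in> bar_diff (Suc n) ` carrier (bar_module (Suc (Suc n)))"
    then obtain \<beta> where \<beta>: "\<beta> \<in> carrier (bar_module (Suc (Suc n)))" "\<gamma> = bar_diff (Suc n) \<beta>" by blast
    have "bar_diff n \<gamma> = (\<lambda>_ _. 0)" unfolding \<beta>(2) by (intro ext bar_diff_bar_diff[OF \<beta>(1)])
    then show "\<gamma> \<in> a_kernel (bar_module (Suc n)) (bar_module n) (bar_diff n)"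
      using rmod_homD(1)[OF bar_diff_hom \<beta>(1)] \<beta>(2) by (simp add: a_kernel_def kernel_def bar_module_simps(2))
  qed
qed

end

section \<open>Ext of the two simple modules is the cohomology of chains\<close>

lemma (in incidence_coordinates) central_scalars_A: "central_scalars A"
  unfolding central_scalars_def
proof (intro allI conjI ballI)
  fix c show c: "c \<odot> \<one> \<in> carrier A" by (simp add: smult_A_closed)
  fix X assume X: "X \<in> carrier A"
  have "co ((c \<odot> \<one>) \<otimes> X) x y = c * co X x y" "co (X \<otimes> (c \<odot> \<one>)) x y = c * co X x y" for x y
  proof -
    have "(\<Sum>z\<in>V. co (c \<odot> \<one>) x z * co X z y) = (\<Sum>z\<in>V. if z = x then c * co X x y else 0)"
      "(\<Sum>z\<in>V. co X x z * co (c \<odot> \<one>) z y) = (\<Sum>z\<in>V. if z = y then c * co X x y else 0)"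
      by (rule sum.cong; auto simp: co_smult co_one)+
    moreover have "co X x y \<noteq> 0 \<Longrightarrow> x \<in> V \<and> y \<in> V" using co_below[OF X] below_V by blast
    ultimately show "co ((c \<odot> \<one>) \<otimes> X) x y = c * co X x y" "co (X \<otimes> (c \<odot> \<one>)) x y = c * co X x y"
      using c X finite_V by (auto simp: co_mult)
  qed
  then show "(c \<odot> \<one>) \<otimes> X = X \<otimes> (c \<odot> \<one>)"
    using c X by (intro co_eqI) simp_all
qed

context incidence_coordinates_bounded begin

definition unit :: "'v \<Rightarrow> 'v list \<Rightarrow> 'v \<Rightarrow> 'v list \<Rightarrow> 'k" where
  "unit y \<sigma> = (\<lambda>y' \<sigma>'. if y' = y \<and> \<sigma>' = \<sigma> then 1 else 0)"

lemma unit_closed: "\<sigma> \<in> bar_gens m \<Longrightarrow> below (chain_top \<sigma>) y \<Longrightarrow> unit y \<sigma> \<in> carrier (bar_module m)"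
  by (auto simp: bar_module_simps unit_def split: if_splits)

lemma scalar_act:
  assumes "\<beta> \<in> carrier (bar_module m)"
  shows "(c \<odot> \<one>) \<odot>\<^bsub>bar_module m\<^esub> \<beta> = (\<lambda>y \<sigma>. c * \<beta> y \<sigma>)"
proof (intro ext)
  fix y \<sigma>
  have "(\<Sum>z\<in>V. \<beta> z \<sigma> * co (c \<odot> \<one>) z y) = (\<Sum>z\<in>V. if z = y then c * \<beta> y \<sigma> else 0)"
    by (rule sum.cong) (auto simp: co_smult co_one)
  then show "((c \<odot> \<one>) \<odot>\<^bsub>bar_module m\<^esub> \<beta>) y \<sigma> = c * \<beta> y \<sigma>"
    using finite_V bar_moduleD[OF assms, of y \<sigma>] below_V by (auto simp: bar_module_simps)
qed

lemma unit_act: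
  assumes "(x, y) \<in> pairs"
  shows "E (x, y) \<odot>\<^bsub>bar_module m\<^esub> unit x \<sigma> = unit y \<sigma>"
proof (intro ext)
  fix y' \<sigma>'
  have "(\<Sum>z\<in>V. unit x \<sigma> z \<sigma>' * co (E (x, y)) z y') = (\<Sum>z\<in>V. if z = x then unit y \<sigma> y' \<sigma>' else 0)"
    by (rule sum.cong) (auto simp: co_E[OF assms] unit_def)
  then show "(E (x, y) \<odot>\<^bsub>bar_module m\<^esub> unit x \<sigma>) y' \<sigma>' = unit y \<sigma> y' \<sigma>'"
    using finite_V assms below_V by (auto simp: bar_module_simps pairs_def)
qed

text \<open>
  Homomorphisms are linear over the scalars, and the \<open>unit\<close> elements are a basis.
\<close>

lemma bar_module_hom_ext:
  assumes N: "right_module A N" and f: "f \<in> rmod_hom A (bar_module m) N" and g: "g \<in> rmod_hom A (bar_module m) N"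
    and fg: "\<And>\<sigma> y. \<sigma> \<in> bar_gens m \<Longrightarrow> below (chain_top \<sigma>) y \<Longrightarrow> f (unit y \<sigma>) = g (unit y \<sigma>)"
  shows "f = g"
proof (rule rmod_hom_eqI[OF f g])
  interpret N: right_module A N by fact
  interpret B: right_module A "bar_module m" by (rule bar_module_right_module)
  fix \<beta> assume \<beta>: "\<beta> \<in> carrier (bar_module m)"
  have "f \<beta> = g \<beta>" if "finite S" "\<beta> \<in> carrier (bar_module m)" "\<And>y \<sigma>. \<beta> y \<sigma> \<noteq> 0 \<Longrightarrow> (y, \<sigma>) \<in> S" for S \<beta>
    using that
  proof (induction S arbitrary: \<beta> rule: finite_induct)
    case empty
    then have "\<beta> = \<zero>\<^bsub>bar_module m\<^esub>" unfolding bar_module_simps by (intro ext) auto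
    then show ?case using rmod_hom_zero[OF f B.right_module_axioms N] rmod_hom_zero[OF g B.right_module_axioms N] by simp
  next
    case (insert p S)
    obtain y \<sigma> where p: "p = (y, \<sigma>)" by (cases p)
    define \<gamma> where "\<gamma> = (\<lambda>y' \<sigma>'. if (y', \<sigma>') = p then 0 else \<beta> y' \<sigma>')"
    have \<gamma>: "\<gamma> \<in> carrier (bar_module m)" using insert.prems(1) by (auto simp: bar_module_simps \<gamma>_def)
    have "f \<gamma> = g \<gamma>"
    proof (rule insert.IH[OF \<gamma>])
      fix y' \<sigma>' assume "\<gamma> y' \<sigma>' \<noteq> 0"
      then show "(y', \<sigma>') \<in> S" using insert.prems(2)[of y' \<sigma>'] by (auto simp: \<gamma>_def split: if_splits)
    qed
    show ?case
    proof (cases "\<beta> y \<sigma> = 0")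
      case True
      then have "\<gamma> = \<beta>" by (intro ext) (auto simp: \<gamma>_def p)
      then show ?thesis using \<open>f \<gamma> = g \<gamma>\<close> by simp
    next
      case False
      then have s: "\<sigma> \<in> bar_gens m" "below (chain_top \<sigma>) y" using bar_moduleD[OF insert.prems(1)] by auto
      note u = unit_closed[OF s]
      let ?c = "\<beta> y \<sigma> \<odot> \<one>"
      have c: "?c \<in> carrier A" by (simp add: smult_A_closed)
      have "\<beta> = \<gamma> \<oplus>\<^bsub>bar_module m\<^esub> ?c \<odot>\<^bsub>bar_module m\<^esub> unit y \<sigma>"
        unfolding scalar_act[OF u] bar_module_simps(3) by (intro ext) (auto simp: \<gamma>_def p unit_def)
      moreover have "f (\<gamma> \<oplus>\<^bsub>bar_module m\<^esub> (?c \<odot>\<^bsub>bar_module m\<^esub> unit y \<sigma>)) = g (\<gamma> \<oplus>\<^bsub>bar_module m\<^esub> (?c \<odot>\<^bsub>bar_module m\<^esub> unit y \<sigma>))"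
        using \<gamma> c u fg[OF s] \<open>f \<gamma> = g \<gamma>\<close> B.act_closed[OF c u]
        by (simp only: rmod_homD[OF f] rmod_homD[OF g])
      ultimately show ?thesis by metis
    qed
  qed
  note main = this
  show "f \<beta> = g \<beta>"
  proof (rule main[OF _ \<beta>])
    show "finite (V \<times> bar_gens m)" by (rule finite_cartesian_product[OF finite_V finite_gens])
    fix y \<sigma> assume "\<beta> y \<sigma> \<noteq> 0"
    then show "(y, \<sigma>) \<in> V \<times> bar_gens m" using bar_moduleD[OF \<beta>] below_V by blast
  qed
qed

end

text \<open>
  The inner poset \<open>(U, R)\<close> sits in \<open>V\<close> through an embedding \<open>e\<close>, since the vertices of the extended quiver
  have a type of their own; \<open>M\<close> and \<open>N\<close> are the simple modules at \<open>a\<close> and \<open>b\<close>.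
\<close>

locale bounded_extension = incidence_coordinates_bounded A V below co a b
  for A :: "('k::field, 'x) module" (structure) and V :: "'v set" and below and co :: "'x \<Rightarrow> 'v \<Rightarrow> 'v \<Rightarrow> 'k" and a b +
  fixes U :: "'w set" and R :: "'w \<Rightarrow> 'w \<Rightarrow> bool" and e :: "'w \<Rightarrow> 'v" and M N :: "('x, 'k) module"
  assumes V_eq: "V = insert a (insert b (e ` U))" and inj_e: "inj_on e U"
    and e_inner: "x \<in> U \<Longrightarrow> e x \<noteq> a \<and> e x \<noteq> b"
    and R_iff: "\<lbrakk>x \<in> U; y \<in> U\<rbrakk> \<Longrightarrow> R x y \<longleftrightarrow> below (e x) (e y)"
    and M: "right_module A M" and M_simps: "carrier M = UNIV" "\<zero>\<^bsub>M\<^esub> = 0" "add M = (+)"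
    and M_act: "\<And>X t. X \<in> carrier A \<Longrightarrow> X \<odot>\<^bsub>M\<^esub> t = t * co X a a"
    and N: "right_module A N" and N_simps: "carrier N = UNIV" "\<zero>\<^bsub>N\<^esub> = 0" "add N = (+)"
    and N_act: "\<And>X t. X \<in> carrier A \<Longrightarrow> X \<odot>\<^bsub>N\<^esub> t = t * co X b b"
begin

text \<open>
  The reversal is due to the decreasing order of generators.
\<close>

definition chain_gen :: "'w list \<Rightarrow> 'v list" where
  "chain_gen xs = b # rev (map e xs)"

lemma chain_gen_gens:
  assumes "xs \<in> poset_chains U R (Suc m)"
  shows "chain_gen xs \<in> bar_gens (Suc (Suc m))"
proof -
  have xs: "set xs \<subseteq> U" "length xs = Suc m" "sorted_wrt R xs" using assms by (auto simp: poset_chains_def)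
  have "sorted_wrt (\<lambda>x y. below (e x) (e y)) xs"
    by (rule sorted_wrt_mono_rel[OF _ xs(3)]) (use xs(1) R_iff in auto)
  then have "sorted_wrt (\<lambda>x y. below y x) (rev (map e xs))" by (simp add: sorted_wrt_rev sorted_wrt_map)
  moreover have *: "below a (e x)" "below (e x) b" "e x \<in> V" "e x \<noteq> a" "e x \<noteq> b" if "x \<in> set xs" for x
    using that xs(1) inner[of "e x"] e_inner[of x] V_eq by auto
  moreover have "below a b" using *(1,2)[of "hd xs"] xs(2) below_trans by (cases xs) auto
  ultimately have "b \<notin> set (rev (map e xs))" "a \<notin> set (rev (map e xs))" "set (rev (map e xs)) \<subseteq> V"
    "\<forall>x\<in>set (rev (map e xs)). below a x \<and> below x b" "below a b" "sorted_wrt (\<lambda>x y. below y x) (rev (map e xs))"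
    by (auto, metis+)
  then show ?thesis
    using xs(2) b_V a_neq_b unfolding bar_gens_def chain_gen_def by auto
qed

abbreviation "e' \<equiv> inv_into U e"

lemma gens_chain_gen:
  assumes "\<sigma> \<in> bar_gens (Suc m)" "hd \<sigma> = b"
  shows "rev (map e' (tl \<sigma>)) \<in> poset_chains U R m" "\<sigma> = chain_gen (rev (map e' (tl \<sigma>)))"
proof -
  obtain \<rho> where \<sigma>: "\<sigma> = b # \<rho>" using assms by (cases \<sigma>) (auto simp: bar_gens_def)
  have V_sub: "x \<in> V \<Longrightarrow> x \<noteq> a \<Longrightarrow> x \<noteq> b \<Longrightarrow> x \<in> e ` U" for x by (subst (asm) V_eq) auto
  have \<rho>: "length \<rho> = m" "sorted_wrt (\<lambda>x y. below y x) \<rho>" "set \<rho> \<subseteq> e ` U"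
    using assms(1) V_sub unfolding \<sigma> bar_gens_def by auto
  have inv: "e' x \<in> U" "e (e' x) = x" if "x \<in> set \<rho>" for x
    using that \<rho>(3) by (auto simp: inv_into_into f_inv_into_f subset_iff)
  have "sorted_wrt (\<lambda>x y. R (e' y) (e' x)) \<rho>"
    by (rule sorted_wrt_mono_rel[OF _ \<rho>(2)]) (simp add: R_iff inv)
  then have "sorted_wrt R (rev (map e' \<rho>))" by (simp add: sorted_wrt_rev sorted_wrt_map)
  then show "rev (map e' (tl \<sigma>)) \<in> poset_chains U R m" using \<rho>(1) inv(1) by (auto simp: \<sigma> poset_chains_def)
  have "map (\<lambda>x. e (e' x)) \<rho> = \<rho>" using inv(2) by (intro map_idI) auto
  then show "\<sigma> = chain_gen (rev (map e' (tl \<sigma>)))" by (simp add: \<sigma> chain_gen_def rev_map comp_def)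
qed

definition gen_cochain :: "('w list \<Rightarrow> 'k) \<Rightarrow> 'v list \<Rightarrow> 'k" where
  "gen_cochain c \<sigma> = (if \<sigma> \<noteq> [] \<and> hd \<sigma> = b then c (rev (map e' (tl \<sigma>))) else 0)"

lemma gen_cochain_chain_gen:
  assumes "xs \<in> poset_chains U R m" shows "gen_cochain c (chain_gen xs) = c xs"
proof -
  have "map (\<lambda>x. e' (e x)) xs = xs"
    using assms inj_e by (intro map_idI) (auto simp: poset_chains_def)
  then show ?thesis by (simp add: gen_cochain_def chain_gen_def rev_map comp_def)
qed

abbreviation "WC \<equiv> chain_cochains U R :: nat \<Rightarrow> ('k, 'w list \<Rightarrow> 'k) module"
abbreviation "dW \<equiv> chain_coboundary U R :: nat \<Rightarrow> ('w list \<Rightarrow> 'k) \<Rightarrow> 'w list \<Rightarrow> 'k"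
abbreviation "bar_hom i \<equiv> hom_space A (bar_module (Suc (Suc i))) N"
abbreviation "bar_codiff i f \<equiv> compose (carrier (bar_module (Suc (Suc (Suc i))))) f (bar_diff (Suc (Suc i)))"

definition cochain_to_hom :: "nat \<Rightarrow> ('w list \<Rightarrow> 'k) \<Rightarrow> ('v \<Rightarrow> 'v list \<Rightarrow> 'k) \<Rightarrow> 'k" where
  "cochain_to_hom n c = (\<lambda>\<beta>\<in>carrier (bar_module (Suc (Suc n))). \<Sum>\<sigma>\<in>bar_gens (Suc (Suc n)). gen_cochain c \<sigma> * \<beta> b \<sigma>)"

text \<open>
  Deleting \<open>b\<close> leaves a generator on which the cochain vanishes; the other deletions delete an entry of
  the inner chain.  The sign comes from the decreasing order of generators.
\<close>

lemma deletions_gen_cochain: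
  assumes \<sigma>: "\<sigma> \<in> bar_gens (Suc (Suc (Suc n)))"
  shows "deletions (gen_cochain c) \<sigma> = (- 1) ^ n * gen_cochain (dW n c) \<sigma>"
proof (cases "hd \<sigma> = b")
  case False
  have "b \<notin> set \<sigma>" using \<sigma> False by (cases \<sigma>) (auto simp: bar_gens_def)
  then have "deletions (gen_cochain c) \<sigma> = deletions (\<lambda>_. 0) \<sigma>"
    by (intro deletions_cong) (metis Un_iff gen_cochain_def hd_in_set list.set_intros(2) set_append)
  then show ?thesis using False by (simp add: gen_cochain_def)
next
  case True
  then obtain \<rho> where \<rho>: "\<sigma> = b # \<rho>" using \<sigma> by (cases \<sigma>) (auto simp: bar_gens_def)
  have len: "length \<rho> = Suc (Suc n)" and b\<rho>: "b \<notin> set \<rho>" using \<sigma> \<rho> by (auto simp: bar_gens_def)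
  have "gen_cochain c \<rho> = 0" using len b\<rho> by (cases \<rho>) (auto simp: gen_cochain_def)
  then have "deletions (gen_cochain c) \<sigma> = - deletions (\<lambda>ys. c (rev (map e' ys))) \<rho>"
    by (simp add: \<rho> gen_cochain_def)
  also have "\<dots> = - deletions (\<lambda>zs. c (rev zs)) (map e' \<rho>)" by (simp only: deletions_map[of "\<lambda>zs. c (rev zs)"])
  also have "\<dots> = (- 1) ^ n * deletions c (rev (map e' \<rho>))" by (simp add: deletions_rev len)
  also have "deletions c (rev (map e' \<rho>)) = dW n c (rev (map e' \<rho>))"
    using gens_chain_gen(1)[OF \<sigma> True] by (simp add: chain_coboundary_def \<rho>)
  finally show ?thesis by (simp add: gen_cochain_def \<rho>)
qed

lemma cochain_to_hom_closed: "cochain_to_hom n c \<in> rmod_hom A (bar_module (Suc (Suc n))) N"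
  unfolding cochain_to_hom_def
proof (rule rmod_homI[OF _ _ _ bar_module_right_module])
  fix X and \<beta> :: "'v \<Rightarrow> 'v list \<Rightarrow> 'k" assume X: "X \<in> carrier A"
  have "(\<Sum>z\<in>V. \<beta> z \<sigma> * co X z b) = \<beta> b \<sigma> * co X b b" if "\<beta> \<in> carrier (bar_module (Suc (Suc n)))" "hd \<sigma> = b" "\<sigma> \<noteq> []" for \<sigma>
  proof -
    have "\<beta> z \<sigma> \<noteq> 0 \<Longrightarrow> z = b" for z
      using bar_moduleD[OF that(1), of z \<sigma>] b_maximal that(2,3) by (cases \<sigma>) (auto simp: chain_top_def)
    then have "(\<Sum>z\<in>V. \<beta> z \<sigma> * co X z b) = (\<Sum>z\<in>V. if z = b then \<beta> b \<sigma> * co X b b else 0)"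
      by (intro sum.cong) auto
    then show ?thesis using finite_V b_V by simp
  qed
  then have "gen_cochain c \<sigma> * (\<Sum>z\<in>V. \<beta> z \<sigma> * co X z b) = gen_cochain c \<sigma> * \<beta> b \<sigma> * co X b b" if "\<beta> \<in> carrier (bar_module (Suc (Suc n)))" for \<sigma>
    using that by (auto simp: gen_cochain_def)
  note act = this
  show "(\<Sum>\<sigma>\<in>bar_gens (Suc (Suc n)). gen_cochain c \<sigma> * (X \<odot>\<^bsub>bar_module (Suc (Suc n))\<^esub> \<beta>) b \<sigma>) = X \<odot>\<^bsub>N\<^esub> (\<Sum>\<sigma>\<in>bar_gens (Suc (Suc n)). gen_cochain c \<sigma> * \<beta> b \<sigma>)"
    if "\<beta> \<in> carrier (bar_module (Suc (Suc n)))"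
    unfolding bar_module_simps(4) N_act[OF X] sum_distrib_right by (intro sum.cong refl act that)
qed (simp_all add: N_simps bar_module_simps distrib_left sum.distrib)

lemma cochain_to_hom_unit:
  assumes "\<sigma> \<in> bar_gens (Suc (Suc n))" "below (chain_top \<sigma>) y"
  shows "cochain_to_hom n c (unit y \<sigma>) = (if y = b then gen_cochain c \<sigma> else 0)"
proof -
  have "(\<Sum>\<tau>\<in>bar_gens (Suc (Suc n)). gen_cochain c \<tau> * unit y \<sigma> b \<tau>) = (\<Sum>\<tau>\<in>bar_gens (Suc (Suc n)). if \<tau> = \<sigma> then (if y = b then gen_cochain c \<sigma> else 0) else 0)"
    by (rule sum.cong) (auto simp: unit_def)
  then show ?thesis using assms finite_gens by (simp add: cochain_to_hom_def unit_closed)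
qed

lemma cochain_to_hom_chain_gen:
  assumes "xs \<in> poset_chains U R (Suc n)"
  shows "cochain_to_hom n c (unit b (chain_gen xs)) = c xs"
  using chain_gen_gens[OF assms] below_refl[OF b_V]
  by (subst cochain_to_hom_unit) (auto simp: gen_cochain_chain_gen[OF assms], simp add: chain_top_def chain_gen_def)

text \<open>
  A homomorphism to the simple module at \<open>b\<close> vanishes on every basis element that is the product of
  another one with a nontrivial path, or that does not live at \<open>b\<close>.  What remains are the
  generators with top entry \<open>b\<close>.
\<close>

lemma cochain_to_hom_surj:
  assumes f: "f \<in> rmod_hom A (bar_module (Suc (Suc n))) N"
  shows "\<exists>c\<in>carrier (WC n). f = cochain_to_hom n c"
proof (intro bexI)
  define c where "c xs = (if xs \<in> poset_chains U R (Suc n) then f (unit b (chain_gen xs)) else 0)" for xs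
  show "c \<in> carrier (WC n)" by (simp add: chain_cochains_def c_def)
  show "f = cochain_to_hom n c"
  proof (rule bar_module_hom_ext[OF N f cochain_to_hom_closed])
    fix \<sigma> y assume s: "\<sigma> \<in> bar_gens (Suc (Suc n))" "below (chain_top \<sigma>) y"
    obtain x \<rho> where \<sigma>: "\<sigma> = x # \<rho>" using s by (cases \<sigma>) (auto simp: bar_gens_def)
    have sx: "below (chain_top \<sigma>) x" "below x y" "x \<in> V" using s below_V below_refl by (auto simp: \<sigma> chain_top_def)
    have p: "(x, y) \<in> pairs" using sx by (simp add: pairs_def)
    have "f (unit y \<sigma>) = f (unit x \<sigma>) * co (E (x, y)) b b"
      using rmod_homD(3)[OF f E_closed[OF p] unit_closed[OF s(1) sx(1)]] unit_act[OF p] N_act[OF E_closed[OF p]] by simp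
    then have f0: "f (unit y \<sigma>) = 0" if "\<not> (x = b \<and> y = b)" using that by (auto simp: co_E[OF p])
    show "f (unit y \<sigma>) = cochain_to_hom n c (unit y \<sigma>)"
    proof (cases "x = b \<and> y = b")
      case True
      then have "hd \<sigma> = b" by (simp add: \<sigma>)
      note g = gens_chain_gen[OF s(1) this]
      have "cochain_to_hom n c (unit y \<sigma>) = c (rev (map e' (tl \<sigma>)))"
        unfolding cochain_to_hom_unit[OF s] using True by (simp add: gen_cochain_def \<sigma>)
      then show ?thesis using g True by (simp add: c_def)
    next
      case False
      then show ?thesis using f0 unfolding cochain_to_hom_unit[OF s] by (auto simp: gen_cochain_def \<sigma>)
    qed
  qed
qed

lemma cochain_to_hom_coboundary:
  "bar_codiff n (cochain_to_hom n c) = cochain_to_hom (Suc n) (\<lambda>xs. (- 1) ^ n * dW n c xs)"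
  unfolding compose_def cochain_to_hom_def[of "Suc n"]
proof (rule restrict_ext)
  fix \<beta> assume \<beta>: "\<beta> \<in> carrier (bar_module (Suc (Suc (Suc n))))"
  have "cochain_to_hom n c (bar_diff (Suc (Suc n)) \<beta>) = (\<Sum>\<sigma>\<in>bar_gens (Suc (Suc (Suc n))). deletions (gen_cochain c) \<sigma> * \<beta> b \<sigma>)"
    using rmod_homD(1)[OF bar_diff_hom \<beta>] by (simp add: cochain_to_hom_def bar_diff_pairing[OF \<beta>])
  also have "\<dots> = (\<Sum>\<sigma>\<in>bar_gens (Suc (Suc (Suc n))). gen_cochain (\<lambda>xs. (- 1) ^ n * dW n c xs) \<sigma> * \<beta> b \<sigma>)"
    by (rule sum.cong) (auto simp: deletions_gen_cochain gen_cochain_def)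
  finally show "cochain_to_hom n c (bar_diff (Suc (Suc n)) \<beta>) = \<dots>" .
qed

lemma cochain_to_hom_inj:
  assumes "c \<in> carrier (WC n)" "c' \<in> carrier (WC n)" "cochain_to_hom n c = cochain_to_hom n c'"
  shows "c = c'"
proof
  fix xs
  show "c xs = c' xs"
    using assms cochain_to_hom_chain_gen[of xs n c] cochain_to_hom_chain_gen[of xs n c']
    by (cases "xs \<in> poset_chains U R (Suc n)") (auto simp: chain_cochains_def)
qed

lemma cochain_to_hom_linear: "linear_map (WC n) (bar_hom n) (cochain_to_hom n)"
  unfolding linear_map_def
proof (intro conjI ballI allI Pi_I)
  fix c c' r
  show "cochain_to_hom n c \<in> carrier (bar_hom n)" by (simp add: hom_space_simps cochain_to_hom_closed)
  show "cochain_to_hom n (c \<oplus>\<^bsub>WC n\<^esub> c') = cochain_to_hom n c \<oplus>\<^bsub>bar_hom n\<^esub> cochain_to_hom n c'"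
    unfolding hom_space_simps cochain_to_hom_def
    by (rule restrict_ext) (auto simp: chain_cochains_def gen_cochain_def N_simps sum.distrib[symmetric] distrib_right intro!: sum.cong)
  have "r \<odot> \<one> \<in> carrier A" "co (r \<odot> \<one>) b b = r" using b_V by (simp_all add: smult_A_closed co_smult co_one)
  then show "cochain_to_hom n (r \<odot>\<^bsub>WC n\<^esub> c) = r \<odot>\<^bsub>bar_hom n\<^esub> cochain_to_hom n c"
    unfolding hom_space_simps cochain_to_hom_def
    by (intro restrict_ext) (auto simp: chain_cochains_def gen_cochain_def N_act sum_distrib_right intro!: sum.cong)
qed

text \<open>
  The degree shift by two arises because a generator of degree \<open>n + 2\<close> with top entry \<open>b\<close> contains \<open>n + 1\<close>
  inner vertices, which form a chain of dimension \<open>n\<close>.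
\<close>

theorem chain_cohomology_isomorphic_Ext:
  assumes P: "projective_resolution A M P d \<epsilon>"
  shows "isomorphic_spaces (cohomology WC dW (Suc n)) (Ext_via A P d N (Suc (Suc (Suc n))))"
proof (rule isomorphic_spaces_trans)
  have B: "projective_resolution A M bar_module bar_diff bar_aug"
    by (rule bar_resolution[OF M M_simps M_act])
  show "isomorphic_spaces (Ext_via A bar_module bar_diff N (Suc (Suc (Suc n)))) (Ext_via A P d N (Suc (Suc (Suc n))))"
    by (rule Ext_independent_of_resolution[OF central_scalars_A N P B])
  have complex: "cochain_complex bar_hom bar_codiff"
    using Ext_complex[OF central_scalars_A B N] unfolding cochain_complex_def by blast
  have zero: "cochain_to_hom m (\<lambda>_. 0) = \<zero>\<^bsub>bar_hom m\<^esub>" for m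
    unfolding cochain_to_hom_def hom_space_simps by (rule restrict_ext) (simp add: gen_cochain_def N_simps)
  have sign: "(\<lambda>xs. (- 1) ^ m * dW m c xs) = dW m (\<lambda>xs. (- 1) ^ m * c xs)" for m c
    by (auto simp: chain_coboundary_def deletions_scale)
  have sign2: "(- 1) ^ m * ((- 1) ^ m * r) = (r :: 'k)" for m r
    by (simp add: mult.assoc[symmetric] power_mult_distrib[symmetric])
  have scaled: "c \<in> carrier (WC m) \<Longrightarrow> (\<lambda>xs. (- 1) ^ m * c xs) \<in> carrier (WC m)" for c m
    by (simp add: chain_cochains_def)
  have coboundary: "cochain_to_hom (Suc n) (dW n c) = bar_codiff n (cochain_to_hom n (\<lambda>xs. (- 1) ^ n * c xs))" for c
    unfolding cochain_to_hom_coboundary sign by (simp add: sign2)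
  have "isomorphic_spaces (cohomology WC dW (Suc n)) (cohomology bar_hom bar_codiff (Suc n))"
  proof (rule isomorphic_cohomology[OF chain_cochain_complex complex cochain_to_hom_linear])
    fix c assume "dW (Suc n) c = \<zero>\<^bsub>WC (Suc (Suc n))\<^esub>"
    then show "bar_codiff (Suc n) (cochain_to_hom (Suc n) c) = \<zero>\<^bsub>bar_hom (Suc (Suc n))\<^esub>"
      unfolding cochain_to_hom_coboundary zero[symmetric] by (simp add: chain_cochains_def)
  next
    fix c assume "c \<in> carrier (WC n)"
    then show "cochain_to_hom (Suc n) (dW n c) \<in> bar_codiff n ` carrier (bar_hom n)"
      unfolding coboundary hom_space_simps by (intro imageI cochain_to_hom_closed)
  next
    fix c w assume c: "c \<in> carrier (WC (Suc n))" and w: "w \<in> carrier (bar_hom n)" "cochain_to_hom (Suc n) c = bar_codiff n w"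
    obtain c' where c': "c' \<in> carrier (WC n)" "w = cochain_to_hom n c'"
      using cochain_to_hom_surj w(1) by (auto simp: hom_space_simps)
    have "dW n (\<lambda>xs. (- 1) ^ n * c' xs) \<in> carrier (WC (Suc n))" by (simp add: chain_cochains_def chain_coboundary_def)
    then have "c = dW n (\<lambda>xs. (- 1) ^ n * c' xs)"
      using w(2) unfolding c'(2) cochain_to_hom_coboundary sign by (rule cochain_to_hom_inj[OF c])
    then show "c \<in> dW n ` carrier (WC n)" using scaled[OF c'(1)] by blast
  next
    fix f assume f: "f \<in> carrier (bar_hom (Suc n))" "bar_codiff (Suc n) f = \<zero>\<^bsub>bar_hom (Suc (Suc n))\<^esub>"
    obtain c where c: "c \<in> carrier (WC (Suc n))" "f = cochain_to_hom (Suc n) c"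
      using cochain_to_hom_surj f(1) by (auto simp: hom_space_simps)
    have "cochain_to_hom (Suc (Suc n)) (\<lambda>xs. (- 1) ^ Suc n * dW (Suc n) c xs) = cochain_to_hom (Suc (Suc n)) (\<lambda>_. 0)"
      using f(2) unfolding c(2) cochain_to_hom_coboundary zero by simp
    then have "(\<lambda>xs. (- 1) ^ Suc n * dW (Suc n) c xs) = (\<lambda>_. 0)"
      by (rule cochain_to_hom_inj[rotated 2]) (simp_all add: chain_cochains_def chain_coboundary_def)
    then have "dW (Suc n) c = \<zero>\<^bsub>WC (Suc (Suc n))\<^esub>" by (simp add: chain_cochains_def fun_eq_iff)
    moreover have "f = bar_codiff n \<zero>\<^bsub>bar_hom n\<^esub> \<oplus>\<^bsub>bar_hom (Suc n)\<^esub> f"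
    proof -
      interpret B: vector_space_record "bar_hom i" for i by (rule cochain_complexD[OF complex])
      have "bar_codiff n \<zero>\<^bsub>bar_hom n\<^esub> = \<zero>\<^bsub>bar_hom (Suc n)\<^esub>"
        by (rule linear_map_zero[OF cochain_complexD(1)[OF complex] cochain_complexD(1)[OF complex] cochain_complexD(2)[OF complex]])
      then show ?thesis using f(1) by simp
    qed
    moreover have "\<zero>\<^bsub>bar_hom n\<^esub> \<in> carrier (bar_hom n)"
      unfolding zero[symmetric] by (simp add: hom_space_simps cochain_to_hom_closed)
    ultimately show "\<exists>c\<in>carrier (WC (Suc n)). dW (Suc n) c = \<zero>\<^bsub>WC (Suc (Suc n))\<^esub> \<and>
       (\<exists>w\<in>carrier (bar_hom n). f = bar_codiff n w \<oplus>\<^bsub>bar_hom (Suc n)\<^esub> cochain_to_hom (Suc n) c)"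
      using c by blast
  qed
  then show "isomorphic_spaces (cohomology WC dW (Suc n)) (Ext_via A bar_module bar_diff N (Suc (Suc (Suc n))))"
    by (simp add: Ext_via_def cohomology_def)
qed

end

section \<open>Coordinates on the path algebra modulo parallel paths\<close>

text \<open>
  Sources are maximal and sinks are minimal in this order, as in the poset of the quiver.
\<close>

definition path_below :: "('v, 'e) pre_digraph \<Rightarrow> 'v \<Rightarrow> 'v \<Rightarrow> bool" where
  "path_below Q x y \<longleftrightarrow> (\<exists>p. pre_digraph.awalk Q y p x)"

text \<open>
  The coefficient at the interval from \<open>x\<close> to \<open>y\<close> once parallel paths are identified.
\<close>

definition path_sum :: "('v, 'e) pre_digraph \<Rightarrow> (('v, 'e) path \<Rightarrow>\<^sub>0 'k::field) \<Rightarrow> 'v \<Rightarrow> 'v \<Rightarrow> 'k" where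
  "path_sum Q f x y = (\<Sum>p\<in>Poly_Mapping.keys f. if path_start p = y \<and> path_end Q p = x then Poly_Mapping.lookup f p else 0)"

text \<open>
  Well defined on cosets, as \<open>path_sum\<close> vanishes on the parallel ideal.
\<close>

definition incidence_coefficient :: "('v, 'e) pre_digraph \<Rightarrow> (('v, 'e) path \<Rightarrow>\<^sub>0 'k::field) set \<Rightarrow> 'v \<Rightarrow> 'v \<Rightarrow> 'k" where
  "incidence_coefficient Q X = the_elem (path_sum Q ` X)"

lemma path_sum_add: "path_sum Q (f + g) x y = path_sum Q f x y + path_sum Q g x y"
  unfolding path_sum_def by (rule setsum_keys_plus_distrib) auto

lemma path_sum_zero [simp]: "path_sum Q 0 x y = 0"
  by (simp add: path_sum_def)

lemma path_sum_single: "path_sum Q (Poly_Mapping.single p c) x y = (if path_start p = y \<and> path_end Q p = x then c else 0)"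
  by (simp add: path_sum_def)

lemma path_sum_sum: "path_sum Q (\<Sum>i\<in>I. f i) x y = (\<Sum>i\<in>I. path_sum Q (f i) x y)"
  by (induction I rule: infinite_finite_induct) (simp_all add: path_sum_add)

lemma path_sum_uminus: "path_sum Q (- f) x y = - path_sum Q f x y"
  using path_sum_add[of Q f "- f" x y] by (simp add: eq_neg_iff_add_eq_0 add.commute)

lemma path_sum_diff: "path_sum Q (f - g) x y = path_sum Q f x y - path_sum Q g x y"
  using path_sum_add[of Q f "- g" x y] by (simp add: path_sum_uminus)

lemma path_sum_smult: "path_sum Q (Poly_Mapping.map ((*) c) f) x y = c * path_sum Q f x y"
proof -
  have "path_sum Q (Poly_Mapping.map ((*) c) f) x y = (\<Sum>p\<in>Poly_Mapping.keys f. if path_start p = y \<and> path_end Q p = x then Poly_Mapping.lookup (Poly_Mapping.map ((*) c) f) p else 0)"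
    unfolding path_sum_def
    by (rule sum.mono_neutral_left) (auto simp: in_keys_iff Poly_Mapping.map.rep_eq when_def)
  also have "\<dots> = c * path_sum Q f x y"
    unfolding path_sum_def sum_distrib_left
    by (rule sum.cong) (auto simp: Poly_Mapping.map.rep_eq when_def)
  finally show ?thesis .
qed

context fin_digraph begin

lemma path_below_path: "p \<in> paths G \<Longrightarrow> path_below G (path_end G p) (path_start p)"
  by (cases p) (auto simp: path_below_def paths_iff path_start_def path_end_def)

lemma path_sum_nonzeroD:
  assumes "Poly_Mapping.keys f \<subseteq> paths G" "path_sum G f x y \<noteq> 0"
  shows "path_below G x y"
proof -
  obtain p where "p \<in> Poly_Mapping.keys f" "path_start p = y" "path_end G p = x"
    using assms(2) unfolding path_sum_def
    by (elim sum.not_neutral_contains_not_neutral) (simp split: if_splits)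
  then show ?thesis using assms(1) path_below_path[of p] by blast
qed

lemma path_start_end_verts: "p \<in> paths G \<Longrightarrow> path_start p \<in> verts G \<and> path_end G p \<in> verts G"
  using path_end_in_verts[of p] by (cases p) (auto simp: paths_iff path_start_def)

text \<open>
  The product ``first \<open>q\<close>, then \<open>p\<close>'' makes \<open>path_sum\<close> multiplicative with the end point as the first index,
  in agreement with the product of the incidence algebra.
\<close>

lemma path_sum_mult:
  fixes f g :: "('a, 'b) path \<Rightarrow>\<^sub>0 'k::field"
  assumes f: "Poly_Mapping.keys f \<subseteq> paths G" and g: "Poly_Mapping.keys g \<subseteq> paths G"
  shows "path_sum G (f \<otimes>\<^bsub>path_algebra G\<^esub> g) x y = (\<Sum>z\<in>verts G. path_sum G f x z * path_sum G g z y)"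
proof (rule poly_mapping_single_induct[OF f])
  fix p c and f' :: "('a, 'b) path \<Rightarrow>\<^sub>0 'k"
  assume p: "p \<in> paths G" and f': "path_sum G (f' \<otimes>\<^bsub>path_algebra G\<^esub> g) x y = (\<Sum>z\<in>verts G. path_sum G f' x z * path_sum G g z y)"
  have "path_sum G (Poly_Mapping.single p c \<otimes>\<^bsub>path_algebra G\<^esub> g) x y = (\<Sum>z\<in>verts G. path_sum G (Poly_Mapping.single p c) x z * path_sum G g z y)"
  proof (rule poly_mapping_single_induct[OF g])
    fix q d and g' :: "('a, 'b) path \<Rightarrow>\<^sub>0 'k"
    assume q: "q \<in> paths G" and g': "path_sum G (Poly_Mapping.single p c \<otimes>\<^bsub>path_algebra G\<^esub> g') x y = (\<Sum>z\<in>verts G. path_sum G (Poly_Mapping.single p c) x z * path_sum G g' z y)"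
    have "(\<Sum>z\<in>verts G. path_sum G (Poly_Mapping.single p c) x z * path_sum G (Poly_Mapping.single q d) z y)
      = (\<Sum>z\<in>verts G. if z = path_start p then (if path_end G p = x \<and> path_end G q = z \<and> path_start q = y then c * d else 0) else 0)"
      by (rule sum.cong) (auto simp: path_sum_single)
    also have "\<dots> = path_sum G (path_term G p q (c * d)) x y"
      using path_start_end_verts[OF p] path_end_comp[of q p]
      by (auto simp: path_term_def path_sum_single path_start_def)
    finally show "path_sum G (Poly_Mapping.single p c \<otimes>\<^bsub>path_algebra G\<^esub> (Poly_Mapping.single q d + g')) x y =
       (\<Sum>z\<in>verts G. path_sum G (Poly_Mapping.single p c) x z * path_sum G (Poly_Mapping.single q d + g') z y)"
      by (simp add: path_algebra_r_distr path_algebra_mult_single path_sum_add distrib_left sum.distrib g')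
  qed (simp add: path_algebra_mult_zero)
  then show "path_sum G ((Poly_Mapping.single p c + f') \<otimes>\<^bsub>path_algebra G\<^esub> g) x y =
       (\<Sum>z\<in>verts G. path_sum G (Poly_Mapping.single p c + f') x z * path_sum G g z y)"
    by (simp add: path_algebra_l_distr path_sum_add distrib_right sum.distrib f')
qed (simp add: path_algebra_mult_zero)

lemma path_sum_kernel_ideal:
  "ideal {f. Poly_Mapping.keys f \<subseteq> paths G \<and> (\<forall>x y. path_sum G f x y = 0)} (path_algebra G :: ('k::field, _) module)"
  (is "ideal ?J ?R")
proof -
  interpret ring ?R by (rule path_algebra_ring)
  show ?thesis
  proof (rule idealI[OF path_algebra_ring])
    show "subgroup ?J (add_monoid ?R)"
    proof (rule add.subgroupI)
      show "\<ominus>\<^bsub>?R\<^esub> f \<in> ?J" if f: "f \<in> ?J" for f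
      proof -
        have "\<ominus>\<^bsub>?R\<^esub> f = - f" using f by (intro minus_equality) (auto simp: path_algebra_carrier)
        then show ?thesis using f by (auto simp: path_sum_uminus)
      qed
    qed (auto simp: path_algebra_carrier path_sum_add intro!: exI[of _ 0] dest!: set_mp[OF keys_add])
  next
    fix f g assume f: "f \<in> ?J" and g: "g \<in> carrier ?R"
    then show "g \<otimes>\<^bsub>?R\<^esub> f \<in> ?J" "f \<otimes>\<^bsub>?R\<^esub> g \<in> ?J"
      using m_closed[of g f] m_closed[of f g] by (auto simp: path_algebra_carrier path_sum_mult)
  qed
qed

definition representative_path :: "'a \<Rightarrow> 'a \<Rightarrow> ('a, 'b) path" where
  "representative_path x y = (y, SOME p. awalk y p x)"

lemma representative_path:
  assumes "path_below G x y"
  shows "representative_path x y \<in> paths G" "path_start (representative_path x y) = y" "path_end G (representative_path x y) = x"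
proof -
  have "awalk y (SOME p. awalk y p x) x" using assms unfolding path_below_def by (rule someI_ex)
  then show "representative_path x y \<in> paths G" "path_start (representative_path x y) = y" "path_end G (representative_path x y) = x"
    by (auto simp: representative_path_def paths_iff path_start_def path_end_def awalk_def)
qed

text \<open>
  The linear combination of one chosen path for each comparable pair that has prescribed coefficients.
\<close>

definition normal_form :: "('a \<Rightarrow> 'a \<Rightarrow> 'k::field) \<Rightarrow> ('a, 'b) path \<Rightarrow>\<^sub>0 'k" where
  "normal_form \<phi> = (\<Sum>x\<in>verts G. \<Sum>y\<in>verts G. Poly_Mapping.single (representative_path x y) (\<phi> x y))"

lemma path_below_verts: "path_below G x y \<Longrightarrow> x \<in> verts G \<and> y \<in> verts G"
  by (auto simp: path_below_def)

lemma normal_form: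
  assumes "\<And>x y. \<phi> x y \<noteq> 0 \<Longrightarrow> path_below G x y"
  shows "Poly_Mapping.keys (normal_form \<phi>) \<subseteq> paths G" "path_sum G (normal_form \<phi>) x y = \<phi> x y"
proof -
  have "Poly_Mapping.keys (Poly_Mapping.single (representative_path x y) (\<phi> x y)) \<subseteq> paths G" for x y
    using assms representative_path(1) by (cases "\<phi> x y = 0") auto
  then show "Poly_Mapping.keys (normal_form \<phi>) \<subseteq> paths G"
    unfolding normal_form_def by (intro keys_sum_subset)
  have "path_sum G (normal_form \<phi>) x y = (\<Sum>x'\<in>verts G. \<Sum>y'\<in>verts G. path_sum G (Poly_Mapping.single (representative_path x' y') (\<phi> x' y')) x y)"
    by (simp add: normal_form_def path_sum_sum)
  also have "\<dots> = (\<Sum>x'\<in>verts G. \<Sum>y'\<in>verts G. if y' = y then (if x' = x then \<phi> x y else 0) else 0)"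
  proof (intro sum.cong refl)
    fix x' y'
    show "path_sum G (Poly_Mapping.single (representative_path x' y') (\<phi> x' y')) x y = (if y' = y then (if x' = x then \<phi> x y else 0) else 0)"
      using assms[of x' y'] representative_path(2,3)[of x' y'] by (cases "\<phi> x' y' = 0") (auto simp: path_sum_single)
  qed
  also have "\<dots> = \<phi> x y" using assms[of x y] path_below_verts[of x y] by (cases "\<phi> x y = 0") (simp_all cong: if_cong)
  finally show "path_sum G (normal_form \<phi>) x y = \<phi> x y" .
qed

text \<open>
  A path differs from the chosen parallel path by a generator of the ideal, and coefficients enter by
  multiplication with a multiple of the trivial path.
\<close>

lemma normal_form_congruent:
  fixes f :: "('a, 'b) path \<Rightarrow>\<^sub>0 'k::field"
  assumes f: "Poly_Mapping.keys f \<subseteq> paths G"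
  shows "f - normal_form (path_sum G f) \<in> parallel_ideal G"
proof (rule poly_mapping_single_induct[OF f])
  let ?R = "path_algebra G :: ('k, _) module"
  interpret I: ideal "parallel_ideal G" ?R by (rule parallel_ideal_ideal)
  show "0 - normal_form (path_sum G (0 :: ('a, 'b) path \<Rightarrow>\<^sub>0 'k)) \<in> parallel_ideal G"
    using additive_subgroup.zero_closed[OF I.additive_subgroup_axioms] by (simp add: normal_form_def)
  fix p and c :: 'k and g :: "('a, 'b) path \<Rightarrow>\<^sub>0 'k"
  assume p: "p \<in> paths G" and g: "g - normal_form (path_sum G g) \<in> parallel_ideal G"
  have vp: "path_start p \<in> verts G" "path_end G p \<in> verts G" using path_start_end_verts[OF p] by auto
  let ?q = "representative_path (path_end G p) (path_start p)"
  note q = representative_path[OF path_below_path[OF p]]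
  have "normal_form (path_sum G (Poly_Mapping.single p c)) =
    (\<Sum>x\<in>verts G. \<Sum>y\<in>verts G. if y = path_start p then (if x = path_end G p then Poly_Mapping.single ?q c else 0) else 0)"
    unfolding normal_form_def by (intro sum.cong refl) (auto simp: path_sum_single)
  also have "\<dots> = Poly_Mapping.single ?q c" using vp by simp
  finally have nf: "normal_form (path_sum G (Poly_Mapping.single p c)) = Poly_Mapping.single ?q c" .
  have "Poly_Mapping.single p 1 - Poly_Mapping.single ?q 1 \<in> parallel_ideal G"
    unfolding parallel_ideal_def
  proof (rule ring.genideal_self[OF path_algebra_ring, THEN subsetD])
    show "Poly_Mapping.single p 1 - Poly_Mapping.single ?q 1 \<in> gens"
      using p q by (intro CollectI exI[of _ p] exI[of _ ?q]) simp
  qed (auto simp: path_algebra_carrier dest!: set_mp[OF keys_diff])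
  moreover have "Poly_Mapping.single (path_start p, []) c \<in> carrier ?R"
    using vp by (auto simp: path_algebra_carrier paths_iff awalk_Nil_iff)
  ultimately have "(Poly_Mapping.single p 1 - Poly_Mapping.single ?q 1) \<otimes>\<^bsub>?R\<^esub> Poly_Mapping.single (path_start p, []) c \<in> parallel_ideal G"
    by (rule I.I_r_closed)
  moreover have "(Poly_Mapping.single p 1 - Poly_Mapping.single ?q 1) \<otimes>\<^bsub>?R\<^esub> Poly_Mapping.single (path_start p, []) c
     = Poly_Mapping.single p c - Poly_Mapping.single ?q c"
  proof -
    have e: "Poly_Mapping.single r 1 \<otimes>\<^bsub>?R\<^esub> Poly_Mapping.single (path_start r, []) c = Poly_Mapping.single r c" for r
      by (cases r) (simp add: path_algebra_mult_single path_term_def path_start_def path_end_def)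
    have "(Poly_Mapping.single p 1 - Poly_Mapping.single ?q 1) \<otimes>\<^bsub>?R\<^esub> h + Poly_Mapping.single ?q 1 \<otimes>\<^bsub>?R\<^esub> h = Poly_Mapping.single p 1 \<otimes>\<^bsub>?R\<^esub> h" for h
      by (simp add: path_algebra_l_distr[symmetric])
    from this[of "Poly_Mapping.single (path_start p, []) c"] show ?thesis
      using e[of p] e[of ?q] q(2) by (simp add: eq_diff_eq)
  qed
  ultimately have "Poly_Mapping.single p c - Poly_Mapping.single ?q c \<in> parallel_ideal G" by simp
  from additive_subgroup.a_closed[OF I.additive_subgroup_axioms this g]
  have "(Poly_Mapping.single p c - Poly_Mapping.single ?q c) + (g - normal_form (path_sum G g)) \<in> parallel_ideal G" by simp
  moreover have "normal_form (path_sum G (Poly_Mapping.single p c + g)) = Poly_Mapping.single ?q c + normal_form (path_sum G g)"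
    unfolding nf[symmetric] by (simp add: normal_form_def path_sum_add single_add sum.distrib)
  ultimately show "Poly_Mapping.single p c + g - normal_form (path_sum G (Poly_Mapping.single p c + g)) \<in> parallel_ideal G"
    by (simp add: algebra_simps)
qed

text \<open>
  The ideal consists of the combinations that vanish after identification of parallel paths: the kernel
  of \<open>path_sum\<close> is an ideal that contains the generators, and its elements are congruent to the normal
  form with all coefficients zero.
\<close>

lemma parallel_ideal_eq_kernel:
  "parallel_ideal G = {f :: ('a, 'b) path \<Rightarrow>\<^sub>0 'k::field. Poly_Mapping.keys f \<subseteq> paths G \<and> (\<forall>x y. path_sum G f x y = 0)}"
proof (intro equalityI subsetI)
  fix f :: "('a, 'b) path \<Rightarrow>\<^sub>0 'k" assume "f \<in> parallel_ideal G"
  moreover have "(parallel_ideal G :: (('a, 'b) path \<Rightarrow>\<^sub>0 'k) set) \<subseteq> {f. Poly_Mapping.keys f \<subseteq> paths G \<and> (\<forall>x y. path_sum G f x y = 0)}"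
    unfolding parallel_ideal_def
    by (rule ring.genideal_minimal[OF path_algebra_ring path_sum_kernel_ideal])
      (auto simp: path_sum_diff path_sum_single dest!: set_mp[OF keys_diff])
  ultimately show "f \<in> {f. Poly_Mapping.keys f \<subseteq> paths G \<and> (\<forall>x y. path_sum G f x y = 0)}" by blast
next
  fix f :: "('a, 'b) path \<Rightarrow>\<^sub>0 'k" assume f: "f \<in> {f. Poly_Mapping.keys f \<subseteq> paths G \<and> (\<forall>x y. path_sum G f x y = 0)}"
  then have "path_sum G f = (\<lambda>_ _. 0)" by (intro ext) auto
  then show "f \<in> parallel_ideal G" using normal_form_congruent[of f] f by (simp add: normal_form_def)
qed

lemma path_algebra_vector_space: "vector_space_record (path_algebra G :: ('k::field, _) module)"
proof -
  interpret ring "path_algebra G :: ('k, _) module" by (rule path_algebra_ring)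
  show ?thesis
  proof (intro vector_space_record.intro vector_space_record_axioms.intro abelian_group_axioms)
    fix f :: "('a, 'b) path \<Rightarrow>\<^sub>0 'k" and c assume "f \<in> carrier (path_algebra G)"
    moreover have "Poly_Mapping.keys (Poly_Mapping.map ((*) c) f) \<subseteq> Poly_Mapping.keys f"
      by (auto simp: in_keys_iff Poly_Mapping.map.rep_eq when_def)
    ultimately show "c \<odot>\<^bsub>path_algebra G\<^esub> f \<in> carrier (path_algebra G)"
      by (auto simp: path_algebra_def)
  next
    fix f g :: "('a, 'b) path \<Rightarrow>\<^sub>0 'k" and c
    show "c \<odot>\<^bsub>path_algebra G\<^esub> (f \<oplus>\<^bsub>path_algebra G\<^esub> g) = c \<odot>\<^bsub>path_algebra G\<^esub> f \<oplus>\<^bsub>path_algebra G\<^esub> c \<odot>\<^bsub>path_algebra G\<^esub> g"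
      by (auto simp: path_algebra_def Poly_Mapping.map.rep_eq lookup_add when_def intro!: poly_mapping_eqI simp flip: distrib_left)
  qed
qed

lemma incidence_algebra_coset:
  assumes "X \<in> carrier (incidence_algebra G :: ('k::field, _) module)"
  shows "\<exists>f. Poly_Mapping.keys f \<subseteq> paths G \<and> X = parallel_ideal G +>\<^bsub>path_algebra G :: ('k, _) module\<^esub> f"
  using assms by (auto simp: incidence_algebra_def A_RCOSETS_def' path_algebra_carrier)

lemma coset_iff:
  fixes f h :: "('a, 'b) path \<Rightarrow>\<^sub>0 'k::field"
  assumes f: "Poly_Mapping.keys f \<subseteq> paths G"
  shows "h \<in> parallel_ideal G +>\<^bsub>path_algebra G\<^esub> f \<longleftrightarrow> Poly_Mapping.keys h \<subseteq> paths G \<and> path_sum G h = path_sum G f"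
proof
  assume "h \<in> parallel_ideal G +>\<^bsub>path_algebra G\<^esub> f"
  then obtain i where "i \<in> parallel_ideal G" "h = i + f" by (auto simp: a_r_coset_def')
  then show "Poly_Mapping.keys h \<subseteq> paths G \<and> path_sum G h = path_sum G f"
    using f by (auto intro!: ext simp: parallel_ideal_eq_kernel path_sum_add dest!: set_mp[OF keys_add])
next
  assume h: "Poly_Mapping.keys h \<subseteq> paths G \<and> path_sum G h = path_sum G f"
  then have "h - f \<in> parallel_ideal G"
    using f by (auto simp: parallel_ideal_eq_kernel path_sum_diff dest!: set_mp[OF keys_diff])
  then show "h \<in> parallel_ideal G +>\<^bsub>path_algebra G\<^esub> f" by (auto simp: a_r_coset_def' intro!: bexI[of _ "h - f"])
qed

lemma incidence_coefficient_coset: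
  fixes f :: "('a, 'b) path \<Rightarrow>\<^sub>0 'k::field"
  assumes f: "Poly_Mapping.keys f \<subseteq> paths G"
  shows "incidence_coefficient G (parallel_ideal G +>\<^bsub>path_algebra G\<^esub> f) = path_sum G f"
proof -
  have "path_sum G ` (parallel_ideal G +>\<^bsub>path_algebra G\<^esub> f) = {path_sum G f}"
    using coset_iff[OF f] f by auto
  then show ?thesis by (simp add: incidence_coefficient_def)
qed

text \<open>
  Cosets correspond to coefficient functions: distinct cosets have distinct coefficients because the
  ideal is the kernel of \<open>path_sum\<close>, and the normal form realizes every coefficient function that is
  supported on the order.
\<close>

theorem incidence_algebra_coordinates:
  "incidence_coordinates (incidence_algebra G :: ('k::field, _) module) (verts G) (path_below G) (incidence_coefficient G)"
proof -
  let ?R = "path_algebra G :: ('k, _) module" and ?A = "incidence_algebra G :: ('k, _) module"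
  let ?I = "parallel_ideal G :: (('a, 'b) path \<Rightarrow>\<^sub>0 'k) set"
  interpret I: ideal ?I ?R by (rule parallel_ideal_ideal)
  interpret R: vector_space_record ?R by (rule path_algebra_vector_space)
  have closed: "?I +>\<^bsub>?R\<^esub> f \<in> carrier ?A" if "Poly_Mapping.keys f \<subseteq> paths G" for f
    using that by (auto simp: incidence_algebra_def A_RCOSETS_def' path_algebra_carrier)
  have keys: "Poly_Mapping.keys f \<subseteq> paths G \<longleftrightarrow> f \<in> carrier ?R" for f :: "('a, 'b) path \<Rightarrow>\<^sub>0 'k"
    by (simp add: path_algebra_carrier)
  note co = incidence_coefficient_coset
  have sm: "c \<odot>\<^bsub>?R\<^esub> f = Poly_Mapping.map ((*) c) f" for c f by (simp add: path_algebra_def)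
  have smult: "c \<odot>\<^bsub>?A\<^esub> (?I +>\<^bsub>?R\<^esub> f) = ?I +>\<^bsub>?R\<^esub> (c \<odot>\<^bsub>?R\<^esub> f)" if "Poly_Mapping.keys f \<subseteq> paths G" for c f
  proof -
    have "c \<odot>\<^bsub>?R\<^esub> i \<in> ?I" if i: "i \<in> ?I" for c i
    proof -
      have "i \<in> carrier ?R" and z: "path_sum G i x y = 0" for x y using i by (auto simp: parallel_ideal_eq_kernel path_algebra_carrier)
      then have "c \<odot>\<^bsub>?R\<^esub> i \<in> carrier ?R" by (intro R.smult_closed)
      then show ?thesis by (simp add: parallel_ideal_eq_kernel path_algebra_carrier sm path_sum_smult z)
    qed
    then show ?thesis
      using smult_coset[OF path_algebra_vector_space abelian_subgroupI3[OF I.is_additive_subgroup vector_space_record.axioms(1)[OF path_algebra_vector_space]], of f c] that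
      by (simp add: incidence_algebra_def path_algebra_carrier)
  qed
  show ?thesis
  proof (rule incidence_coordinates.intro)
    show "finite (verts G)" by simp
    show "ring ?A" by (rule incidence_algebra_ring)
    show "path_below G x y \<Longrightarrow> x \<in> verts G \<and> y \<in> verts G" for x y by (rule path_below_verts)
    show "x \<in> verts G \<Longrightarrow> path_below G x x" for x
      by (auto simp: path_below_def awalk_Nil_iff intro!: exI[of _ "[]"])
    show "path_below G x y \<Longrightarrow> path_below G y z \<Longrightarrow> path_below G x z" for x y z
      unfolding path_below_def by (metis awalk_appendI)
    show "bij_betw (incidence_coefficient G) (carrier ?A) {\<phi>. \<forall>x y. \<phi> x y \<noteq> 0 \<longrightarrow> path_below G x y}"
      unfolding bij_betw_def
    proof (intro conjI inj_onI)
      fix X Y assume X: "X \<in> carrier ?A" and Y: "Y \<in> carrier ?A" and eq: "incidence_coefficient G X = incidence_coefficient G Y"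
      obtain f g where f: "Poly_Mapping.keys f \<subseteq> paths G" "X = ?I +>\<^bsub>?R\<^esub> f" and g: "Poly_Mapping.keys g \<subseteq> paths G" "Y = ?I +>\<^bsub>?R\<^esub> g"
        using incidence_algebra_coset[OF X] incidence_algebra_coset[OF Y] by blast
      have "path_sum G f = path_sum G g" using eq f g by (simp add: co)
      then show "X = Y" unfolding f(2) g(2) using coset_iff[OF f(1)] coset_iff[OF g(1)] by auto
    next
      show "incidence_coefficient G ` carrier ?A = {\<phi>. \<forall>x y. \<phi> x y \<noteq> 0 \<longrightarrow> path_below G x y}"
      proof (intro equalityI subsetI)
        fix \<phi> assume "\<phi> \<in> incidence_coefficient G ` carrier ?A"
        then obtain X where X: "X \<in> carrier ?A" "\<phi> = incidence_coefficient G X" by blast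
        obtain f where f: "Poly_Mapping.keys f \<subseteq> paths G" "X = ?I +>\<^bsub>?R\<^esub> f" using incidence_algebra_coset[OF X(1)] by blast
        show "\<phi> \<in> {\<phi>. \<forall>x y. \<phi> x y \<noteq> 0 \<longrightarrow> path_below G x y}"
          using path_sum_nonzeroD[OF f(1)] by (auto simp: X f co)
      next
        fix \<phi> :: "'a \<Rightarrow> 'a \<Rightarrow> 'k" assume "\<phi> \<in> {\<phi>. \<forall>x y. \<phi> x y \<noteq> 0 \<longrightarrow> path_below G x y}"
        then have \<phi>: "\<phi> x y \<noteq> 0 \<Longrightarrow> path_below G x y" for x y by blast
        have k: "Poly_Mapping.keys (normal_form \<phi>) \<subseteq> paths G" and s: "path_sum G (normal_form \<phi>) x y = \<phi> x y" for x y
          by (rule normal_form; erule \<phi>)+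
        have "\<phi> = incidence_coefficient G (?I +>\<^bsub>?R\<^esub> normal_form \<phi>)" unfolding co[OF k] by (intro ext) (rule s[symmetric])
        then show "\<phi> \<in> incidence_coefficient G ` carrier ?A" using closed[OF k] by blast
      qed
    qed
    fix X assume X: "X \<in> carrier ?A"
    obtain f where f: "Poly_Mapping.keys f \<subseteq> paths G" "X = ?I +>\<^bsub>?R\<^esub> f" using incidence_algebra_coset[OF X] by blast
    have cf: "Poly_Mapping.keys (Poly_Mapping.map ((*) c) f) \<subseteq> paths G" for c
      using R.smult_closed[of f c] f(1) by (simp add: keys sm)
    show "c \<odot>\<^bsub>?A\<^esub> X \<in> carrier ?A" for c unfolding f(2) smult[OF f(1)] sm by (rule closed[OF cf])
    show "incidence_coefficient G (c \<odot>\<^bsub>?A\<^esub> X) x y = c * incidence_coefficient G X x y" for c x y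
      unfolding f(2) smult[OF f(1)] sm by (simp add: co[OF cf] co[OF f(1)] path_sum_smult)
    fix Y assume Y: "Y \<in> carrier ?A"
    obtain g where g: "Poly_Mapping.keys g \<subseteq> paths G" "Y = ?I +>\<^bsub>?R\<^esub> g" using incidence_algebra_coset[OF Y] by blast
    have 1: "X \<oplus>\<^bsub>?A\<^esub> Y = ?I +>\<^bsub>?R\<^esub> (f + g)" "Poly_Mapping.keys (f + g) \<subseteq> paths G"
      using f g I.a_rcos_sum[of f g] I.a_closed[of f g] by (simp_all add: incidence_algebra_def keys)
    have 2: "X \<otimes>\<^bsub>?A\<^esub> Y = ?I +>\<^bsub>?R\<^esub> (f \<otimes>\<^bsub>?R\<^esub> g)" "Poly_Mapping.keys (f \<otimes>\<^bsub>?R\<^esub> g) \<subseteq> paths G"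
      using f g I.rcoset_mult_add[of f g] I.m_closed[of f g] by (simp_all add: incidence_algebra_def keys)
    show "incidence_coefficient G (X \<oplus>\<^bsub>?A\<^esub> Y) x y = incidence_coefficient G X x y + incidence_coefficient G Y x y" for x y
      unfolding 1(1) co[OF 1(2)] unfolding f g co[OF f(1)] co[OF g(1)] by (rule path_sum_add)
    show "incidence_coefficient G (X \<otimes>\<^bsub>?A\<^esub> Y) x y = (\<Sum>z\<in>verts G. incidence_coefficient G X x z * incidence_coefficient G Y z y)" for x y
      unfolding 2(1) co[OF 2(2)] unfolding f g co[OF f(1)] co[OF g(1)] by (rule path_sum_mult[OF f(1) g(1)])
  next
    fix x y
    have k: "Poly_Mapping.keys \<one>\<^bsub>?R\<^esub> \<subseteq> paths G" using I.one_closed by (simp add: keys)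
    have "path_sum G \<one>\<^bsub>?R\<^esub> x y = (\<Sum>v\<in>verts G. if v = x then (if x = y then 1 else 0) else 0)"
      unfolding path_algebra_one path_sum_sum by (rule sum.cong) (auto simp: path_sum_single path_start_def path_end_def)
    then show "incidence_coefficient G \<one>\<^bsub>?A\<^esub> x y = (if x = y \<and> x \<in> verts G then 1 else 0)"
      by (simp add: incidence_algebra_def co[OF k])
  qed
qed

text \<open>
  If no oriented cycle passes through \<open>x\<close>, then the trivial path is the only path from \<open>x\<close> to \<open>x\<close>.
\<close>

lemma simple_module_act:
  assumes x: "\<And>p. awalk x p x \<Longrightarrow> p = []" and X: "X \<in> carrier (incidence_algebra G :: ('k::field, _) module)"
  shows "X \<odot>\<^bsub>simple_module x\<^esub> t = t * incidence_coefficient G X x x"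
proof -
  obtain f where f: "Poly_Mapping.keys f \<subseteq> paths G" "X = parallel_ideal G +>\<^bsub>path_algebra G :: ('k, _) module\<^esub> f"
    using incidence_algebra_coset[OF X] by blast
  have "Poly_Mapping.lookup h (x, []) = path_sum G h x x" if "Poly_Mapping.keys h \<subseteq> paths G" for h :: "('a, 'b) path \<Rightarrow>\<^sub>0 'k"
  proof -
    have "path_sum G h x x = (\<Sum>p\<in>Poly_Mapping.keys h. if p = (x, []) then Poly_Mapping.lookup h p else 0)"
      unfolding path_sum_def
    proof (rule sum.cong[OF refl])
      fix p assume "p \<in> Poly_Mapping.keys h"
      then have "p \<in> paths G" using that by blast
      then have "path_start p = x \<and> path_end G p = x \<longleftrightarrow> p = (x, [])"
        using x by (cases p) (auto simp: paths_iff path_start_def path_end_def awalk_def)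
      then show "(if path_start p = x \<and> path_end G p = x then Poly_Mapping.lookup h p else 0) = (if p = (x, []) then Poly_Mapping.lookup h p else 0)" by simp
    qed
    then show ?thesis by (simp add: in_keys_iff)
  qed
  then have "(\<lambda>h. Poly_Mapping.lookup h (x, [])) ` X = (\<lambda>h. path_sum G h x x) ` X"
    unfolding f(2) using coset_iff[OF f(1)] by (intro image_cong) auto
  also have "\<dots> = {path_sum G f x x}" unfolding f(2) using coset_iff[OF f(1)] f(1) by auto
  finally show ?thesis by (simp add: simple_module_def f(2) incidence_coefficient_coset[OF f(1)])
qed

end

section \<open>The extended quiver\<close>

lemma extended_quiver_simps:
  "verts (extended_quiver Q) = Vert ` verts Q \<union> {Vert_a, Vert_b}"
  "arcs (extended_quiver Q) = Arrow ` arcs Q \<union> From_b ` sources Q \<union> To_a ` sinks Q"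
  "tail (extended_quiver Q) (Arrow \<alpha>) = Vert (tail Q \<alpha>)" "head (extended_quiver Q) (Arrow \<alpha>) = Vert (head Q \<alpha>)"
  "tail (extended_quiver Q) (From_b x) = Vert_b" "head (extended_quiver Q) (From_b x) = Vert x"
  "tail (extended_quiver Q) (To_a x) = Vert x" "head (extended_quiver Q) (To_a x) = Vert_a"
  by (simp_all add: extended_quiver_def)

locale acyclic_quiver = fin_digraph Q for Q :: "('v, 'e) pre_digraph" +
  assumes acyclic: "awalk x p x \<Longrightarrow> p = []"
begin

abbreviation "Q' \<equiv> extended_quiver Q"

sublocale ext: fin_digraph Q'
proof
  fix \<alpha> assume "\<alpha> \<in> arcs Q'"
  then show "tail Q' \<alpha> \<in> verts Q'" "head Q' \<alpha> \<in> verts Q'"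
    by (auto simp: extended_quiver_simps sources_def sinks_def)
qed (auto simp: extended_quiver_simps sources_def sinks_def)

lemma ext_path_from_a: "ext.awalk Vert_a p y \<Longrightarrow> p = []"
  by (cases p) (auto simp: ext.awalk_Cons_iff extended_quiver_simps)

lemma ext_path_to_b: "ext.awalk x p Vert_b \<Longrightarrow> p = []"
proof (induction p arbitrary: x)
  case (Cons \<alpha> p)
  then have "p = []" by (auto simp: ext.awalk_Cons_iff)
  then show ?case using Cons.prems by (auto simp: ext.awalk_Cons_iff ext.awalk_Nil_iff extended_quiver_simps)
qed simp

lemma ext_path_inner: "ext.awalk (Vert x) p (Vert y) \<Longrightarrow> \<exists>q. awalk x q y"
proof (induction p arbitrary: x)
  case Nil
  then show ?case by (auto simp: ext.awalk_Nil_iff awalk_Nil_iff extended_quiver_simps intro!: exI[of _ "[]"])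
next
  case (Cons \<alpha> p)
  then have w: "\<alpha> \<in> arcs Q'" "tail Q' \<alpha> = Vert x" "ext.awalk (head Q' \<alpha>) p (Vert y)" by (auto simp: ext.awalk_Cons_iff)
  then consider \<beta> where "\<alpha> = Arrow \<beta>" "\<beta> \<in> arcs Q" "tail Q \<beta> = x" | "head Q' \<alpha> = Vert_a"
    by (auto simp: extended_quiver_simps)
  then show ?case
  proof cases
    case (1 \<beta>)
    then obtain q where "awalk (head Q \<beta>) q y" using Cons.IH w(3) by (auto simp: extended_quiver_simps)
    then have "awalk x (\<beta> # q) y" using 1 by (simp add: awalk_Cons_iff)
    then show ?thesis by blast
  next
    case 2
    then show ?thesis using w(3) ext_path_from_a[of p "Vert y"] by (auto simp: ext.awalk_Nil_iff)
  qed
qed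

lemma path_ext: "awalk x q y \<Longrightarrow> ext.awalk (Vert x) (map Arrow q) (Vert y)"
  by (induction q arbitrary: x)
    (auto simp: awalk_Nil_iff ext.awalk_Nil_iff awalk_Cons_iff ext.awalk_Cons_iff extended_quiver_simps)

lemma path_below_ext: "path_below Q' (Vert x) (Vert y) \<longleftrightarrow> path_below Q x y"
  using ext_path_inner path_ext unfolding path_below_def by blast

text \<open>
  A vertex that is not a sink has a successor, from which strictly fewer vertices can be reached.
\<close>

lemma sink_reachable:
  assumes "x \<in> verts Q" shows "\<exists>y\<in>sinks Q. \<exists>p. awalk x p y"
  using assms
proof (induction "card {y. \<exists>p. awalk x p y}" arbitrary: x rule: less_induct)
  case less
  show ?case
  proof (cases "x \<in> sinks Q")
    case True
    then show ?thesis using less.prems by (auto simp: awalk_Nil_iff intro!: bexI[of _ x] exI[of _ "[]"])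
  next
    case False
    then obtain \<alpha> where \<alpha>: "\<alpha> \<in> arcs Q" "tail Q \<alpha> = x" using less.prems by (auto simp: sinks_def out_arcs_def)
    let ?y = "head Q \<alpha>"
    have step: "awalk x (\<alpha> # p) z" if "awalk ?y p z" for p z using that \<alpha> by (simp add: awalk_Cons_iff)
    have "x \<notin> {z. \<exists>p. awalk ?y p z}" using acyclic[OF step] by auto
    moreover have "{z. \<exists>p. awalk ?y p z} \<subseteq> {z. \<exists>p. awalk x p z}" using step by blast
    moreover have "x \<in> {z. \<exists>p. awalk x p z}" using less.prems by (auto simp: awalk_Nil_iff intro!: exI[of _ "[]"])
    ultimately have "{z. \<exists>p. awalk ?y p z} \<subset> {z. \<exists>p. awalk x p z}" by blast
    moreover have "finite {z. \<exists>p. awalk x p z}" by (rule finite_subset[OF _ finite_verts]) auto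
    ultimately have "card {z. \<exists>p. awalk ?y p z} < card {z. \<exists>p. awalk x p z}" by (intro psubset_card_mono)
    from less.hyps[OF this] obtain y p where "y \<in> sinks Q" "awalk ?y p y" using \<alpha> by auto
    then show ?thesis using step by blast
  qed
qed

lemma source_reaches:
  assumes "x \<in> verts Q" shows "\<exists>y\<in>sources Q. \<exists>p. awalk y p x"
  using assms
proof (induction "card {y. \<exists>p. awalk y p x}" arbitrary: x rule: less_induct)
  case less
  show ?case
  proof (cases "x \<in> sources Q")
    case True
    then show ?thesis using less.prems by (auto simp: awalk_Nil_iff intro!: bexI[of _ x] exI[of _ "[]"])
  next
    case False
    then obtain \<alpha> where \<alpha>: "\<alpha> \<in> arcs Q" "head Q \<alpha> = x" using less.prems by (auto simp: sources_def in_arcs_def)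
    let ?y = "tail Q \<alpha>"
    have step: "awalk z (p @ [\<alpha>]) x" if "awalk z p ?y" for p z
      using that \<alpha> by (auto simp: awalk_Cons_iff awalk_Nil_iff)
    have "x \<notin> {z. \<exists>p. awalk z p ?y}" using acyclic[OF step] by auto
    moreover have "{z. \<exists>p. awalk z p ?y} \<subseteq> {z. \<exists>p. awalk z p x}" using step by blast
    moreover have "x \<in> {z. \<exists>p. awalk z p x}" using less.prems by (auto simp: awalk_Nil_iff intro!: exI[of _ "[]"])
    ultimately have "{z. \<exists>p. awalk z p ?y} \<subset> {z. \<exists>p. awalk z p x}" by blast
    moreover have "finite {z. \<exists>p. awalk z p x}" by (rule finite_subset[OF _ finite_verts]) auto
    ultimately have "card {z. \<exists>p. awalk z p ?y} < card {z. \<exists>p. awalk z p x}" by (intro psubset_card_mono)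
    from less.hyps[OF this] obtain y p where "y \<in> sources Q" "awalk y p ?y" using \<alpha> by auto
    then show ?thesis using step by blast
  qed
qed

lemma a_below: "x \<in> verts Q \<Longrightarrow> path_below Q' Vert_a (Vert x)"
proof -
  assume "x \<in> verts Q"
  then obtain y p where y: "y \<in> sinks Q" "awalk x p y" using sink_reachable by blast
  have "ext.awalk (Vert y) [To_a y] Vert_a" using y(1) by (auto simp: ext.awalk_Cons_iff ext.awalk_Nil_iff extended_quiver_simps)
  then show ?thesis using path_ext[OF y(2)] unfolding path_below_def by (metis ext.awalk_appendI)
qed

lemma below_b: "x \<in> verts Q \<Longrightarrow> path_below Q' (Vert x) Vert_b"
proof -
  assume "x \<in> verts Q"
  then obtain y p where y: "y \<in> sources Q" "awalk y p x" using source_reaches by blast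
  have "y \<in> verts Q" using y(1) by (simp add: sources_def)
  then have "ext.awalk Vert_b [From_b y] (Vert y)" using y(1) by (auto simp: ext.awalk_Cons_iff ext.awalk_Nil_iff extended_quiver_simps)
  then show ?thesis using path_ext[OF y(2)] unfolding path_below_def by (metis ext.awalk_appendI)
qed

lemma simple_module_ends:
  assumes "x \<in> {Vert_a, Vert_b}"
  shows "right_module (incidence_algebra Q' :: ('k::field, _) module) (simple_module x)"
    "X \<in> carrier (incidence_algebra Q' :: ('k::field, _) module) \<Longrightarrow> X \<odot>\<^bsub>simple_module x\<^esub> t = t * incidence_coefficient Q' X x x"
proof -
  have "ext.awalk x p x \<Longrightarrow> p = []" for p using assms ext_path_from_a ext_path_to_b by auto
  then show "right_module (incidence_algebra Q' :: ('k::field, _) module) (simple_module x)"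
    "X \<in> carrier (incidence_algebra Q' :: ('k::field, _) module) \<Longrightarrow> X \<odot>\<^bsub>simple_module x\<^esub> t = t * incidence_coefficient Q' X x x"
    using assms by (auto intro!: ext.simple_module_right_module ext.simple_module_act simp: extended_quiver_simps)
qed

text \<open>
  Every inner vertex reaches a sink and is reached from a source, hence lies between \<open>a\<close> and \<open>b\<close>.
\<close>

lemma extension_bounded:
  "bounded_extension (incidence_algebra Q' :: ('k::field, _) module) (verts Q') (path_below Q') (incidence_coefficient Q')
     Vert_a Vert_b (verts Q) (path_below Q) Vert (simple_module Vert_a) (simple_module Vert_b)"
proof -
  interpret E: incidence_coordinates "incidence_algebra Q' :: ('k, _) module" "verts Q'" "path_below Q'" "incidence_coefficient Q'"
    by (rule ext.incidence_algebra_coordinates)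
  show ?thesis
  proof (intro bounded_extension.intro incidence_coordinates_bounded.intro E.incidence_coordinates_axioms
      incidence_coordinates_bounded_axioms.intro bounded_extension_axioms.intro)
    show "path_below Q' x Vert_a \<Longrightarrow> x = Vert_a" for x
      unfolding path_below_def by (metis ext_path_from_a ext.awalk_Nil_iff)
    show "path_below Q' Vert_b y \<Longrightarrow> y = Vert_b" for y
      unfolding path_below_def by (metis ext_path_to_b ext.awalk_Nil_iff)
  qed (auto simp: extended_quiver_simps path_below_ext simple_module_ends a_below below_b inj_on_def, auto simp: simple_module_def)
qed

end

lemma ordered_quiver_acyclic: "ordered_quiver Q \<Longrightarrow> acyclic_quiver Q"
  by (auto simp: ordered_quiver_def acyclic_quiver_def acyclic_quiver_axioms_def)

lemma Ext_eq_Ext_via: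
  assumes "right_module A M"
  shows "\<exists>P d \<epsilon>. projective_resolution A M P d \<epsilon> \<and> Ext A M N n = Ext_via A P d N n"
proof -
  obtain P d \<epsilon> where S: "(SOME (P, d, \<epsilon>). projective_resolution A M P d \<epsilon>) = (P :: nat \<Rightarrow> ('a, ('c, 'a) formal) module, d, \<epsilon>)"
    by (rule prod_cases3)
  have "\<exists>S. (\<lambda>(P :: nat \<Rightarrow> ('a, ('c, 'a) formal) module, d, \<epsilon>). projective_resolution A M P d \<epsilon>) S"
    using projective_resolution_exists[OF assms] by auto
  from someI_ex[OF this] have "projective_resolution A M P d \<epsilon>" unfolding S by simp
  moreover have "Ext A M N n = Ext_via A P d N n" unfolding Ext_def S by simp
  ultimately show ?thesis by blast
qed

theorem theorem5p7:
  fixes Q :: "('v, 'e) pre_digraph" and n :: nat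
  assumes "ordered_quiver Q" and "n \<ge> 1"
  shows "isomorphic_spaces
    (HH (incidence_algebra Q :: ('k::field_char_0, _) module) n)
    (Ext (incidence_algebra (extended_quiver Q) :: ('k, _) module)
      (simple_module Vert_a) (simple_module Vert_b) (n + 2))"
proof -
  interpret acyclic_quiver Q by (rule ordered_quiver_acyclic[OF assms(1)])
  let ?A = "incidence_algebra Q :: ('k, _) module" and ?A' = "incidence_algebra (extended_quiver Q) :: ('k, _) module"
  let ?Ka = "simple_module Vert_a :: ((('v ext_vertex, ('v, 'e) ext_arrow) path \<Rightarrow>\<^sub>0 'k) set, 'k) module"
  obtain m where n: "n = Suc m" using assms(2) by (cases n) auto
  interpret I: incidence_coordinates ?A "verts Q" "path_below Q" "incidence_coefficient Q"
    by (rule incidence_algebra_coordinates)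
  interpret E: bounded_extension ?A' "verts Q'" "path_below Q'" "incidence_coefficient Q'"
     Vert_a Vert_b "verts Q" "path_below Q" Vert "simple_module Vert_a" "simple_module Vert_b"
    by (rule extension_bounded)
  let ?Kb = "simple_module Vert_b :: ((('v ext_vertex, ('v, 'e) ext_arrow) path \<Rightarrow>\<^sub>0 'k) set, 'k) module"
  obtain P d \<epsilon> where P: "projective_resolution ?A' ?Ka P d \<epsilon>" "Ext ?A' ?Ka ?Kb (n + 2) = Ext_via ?A' P d ?Kb (n + 2)"
    using Ext_eq_Ext_via[OF E.M] by blast
  have "isomorphic_spaces (cohomology (chain_cochains (verts Q) (path_below Q)) (chain_coboundary (verts Q) (path_below Q)) n)
     (Ext_via ?A' P d (simple_module Vert_b) (n + 2))"
    using E.chain_cohomology_isomorphic_Ext[OF P(1), of m] by (simp add: n)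
  moreover have "isomorphic_spaces (HH ?A n) (cohomology (chain_cochains (verts Q) (path_below Q)) (chain_coboundary (verts Q) (path_below Q)) n)"
    unfolding n by (rule I.HH_isomorphic_chain_cohomology)
  ultimately show ?thesis unfolding P(2) by (rule isomorphic_spaces_trans[rotated])
qed

end
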